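(* Let $\theta_0:\mathbb{R}\to\mathbb{R}$ be smooth, non-constant, decaying at infinity, even, non-negative, and monotone decreasing on $(0,\infty)$. Let $s\in(-1,1)$. Then the initial value problem $$\partial_t\theta+u\,\partial_x\theta=0,\qquad u=\Lambda^sH\theta,\qquad\theta(0,\cdot)=\theta_0,$$ cannot have a global in time $C^1_x$ smooth solution.
   Context: $H$ is the Hilbert transform in $x$, $H\theta(x)=\frac1\pi\,\mathrm{p.v.}\int_{\mathbb{R}}\frac{\theta(y)}{y-x}\,dy$, and $\Lambda=(-\Delta)^{1/2}$. With these conventions $\Lambda^sH\theta=H\Lambda^s\theta=\partial_x\Lambda^{s-1}\theta$, explicitly $$H\Lambda^s\theta(x)=\kappa_s\,\mathrm{p.v.}\int_{\mathbb{R}}\frac{\theta(y)-\theta(x)}{(y-x)|y-x|^s}\,dy,\qquad \kappa_s=\frac{2^s\,\Gamma(1+s/2)}{\sqrt\pi\,\Gamma((1-s)/2)}>0,$$ which for $s=0$ is $H\theta$. The equation is posed for $(t,x)\in[0,\infty)\times\mathbb{R}$. A global in time $C^1_x$ smooth solution is a classical solution that belongs to $L^\infty(0,T;C^1(\mathbb{R}))$ for every $T>0$. *)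

theory Defs
  imports "HOL-Analysis.Analysis"
begin

definition smooth :: "(real \<Rightarrow> real) \<Rightarrow> bool" where
  "smooth f \<longleftrightarrow> (\<forall>n x. (deriv ^^ n) f differentiable (at x))"

(* The truncation is symmetric about the singular point x, both at x and at
   infinity. The cut-off at infinity matters when the kernel below is not
   integrable at infinity, i.e. for s <= 0. *)
definition has_pv_integral :: "(real \<Rightarrow> real) \<Rightarrow> real \<Rightarrow> real \<Rightarrow> bool" where
  "has_pv_integral f x I \<longleftrightarrow>
     (\<forall>\<epsilon> R. 0 < \<epsilon> \<and> \<epsilon> < R \<longrightarrow>
        set_integrable lborel {y. \<epsilon> < \<bar>y - x\<bar> \<and> \<bar>y - x\<bar> < R} f) \<and>
     ((\<lambda>(\<epsilon>, R). LINT y:{y. \<epsilon> < \<bar>y - x\<bar> \<and> \<bar>y - x\<bar> < R}|lborel. f y) \<longlongrightarrow> I)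
       (at_right 0 \<times>\<^sub>F at_top)"

definition kappa :: "real \<Rightarrow> real" where
  "kappa s = 2 powr s * Gamma (1 + s / 2) / (sqrt pi * Gamma ((1 - s) / 2))"

(* has_Lambda_H s f x v: the principal value defining (Lambda^s H f)(x)
   converges, and (Lambda^s H f)(x) = v. For s = 0 the subtracted constant f x
   contributes nothing to the symmetric truncations, and kappa 0 = 1 / pi, so
   this is the Hilbert transform with kernel 1 / (pi (y - x)). *)
definition has_Lambda_H :: "real \<Rightarrow> (real \<Rightarrow> real) \<Rightarrow> real \<Rightarrow> real \<Rightarrow> bool" where
  "has_Lambda_H s f x v \<longleftrightarrow>
     (\<exists>I. has_pv_integral (\<lambda>y. (f y - f x) / ((y - x) * \<bar>y - x\<bar> powr s)) x I \<and>
          v = kappa s * I)"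

(* Functions of (t, x) are curried, and only their values for t >= 0 matter; the
   time derivative at t = 0 is one-sided. The only requirement on the velocity u
   is that its defining principal value converges at every (t, x): neither decay
   nor symmetry of theta t is imposed for t > 0. *)
definition classical_solution ::
    "real \<Rightarrow> (real \<Rightarrow> real) \<Rightarrow> (real \<Rightarrow> real \<Rightarrow> real) \<Rightarrow> bool" where
  "classical_solution s \<theta>0 \<theta> \<longleftrightarrow>
     (\<exists>\<theta>t \<theta>x u.
        continuous_on ({0..} \<times> UNIV) (\<lambda>(t, x). \<theta>t t x) \<and>
        continuous_on ({0..} \<times> UNIV) (\<lambda>(t, x). \<theta>x t x) \<and>
        (\<forall>t\<ge>0. \<forall>x.
           ((\<lambda>\<tau>. \<theta> \<tau> x) has_real_derivative \<theta>t t x) (at t within {0..}) \<and>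
           (\<theta> t has_real_derivative \<theta>x t x) (at x) \<and>
           has_Lambda_H s (\<theta> t) x (u t x) \<and>
           \<theta>t t x + u t x * \<theta>x t x = 0) \<and>
        (\<forall>x. \<theta> 0 x = \<theta>0 x))"

(* As theta and its x-derivative are continuous in (t, x), the essential
   supremum over t in the L^infinity(0,T; C^1) norm is a supremum. *)
definition global_C1_solution ::
    "real \<Rightarrow> (real \<Rightarrow> real) \<Rightarrow> (real \<Rightarrow> real \<Rightarrow> real) \<Rightarrow> bool" where
  "global_C1_solution s \<theta>0 \<theta> \<longleftrightarrow>
     classical_solution s \<theta>0 \<theta> \<and>
     (\<forall>T>0. \<exists>C. \<forall>t\<in>{0<..<T}. \<forall>x. \<bar>\<theta> t x\<bar> \<le> C \<and> \<bar>deriv (\<theta> t) x\<bar> \<le> C)"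

end

theory Submission
  imports Defs
begin

text \<open>
  The solution is not known to be even or to decay for \<open>t > 0\<close>, and the velocity need not be
  Lipschitz, so there is no flow to work with. All that is used of the equation is
  \<open>\<theta>(t - h, x - h u) = \<theta>(t, x) + o(h)\<close>: a compact set of configurations of points violating some
  property, once it can be moved backwards in time along the velocity, is empty because it has no
  earliest element. In this way \<open>\<theta>(t, \<cdot>)\<close> stays non-negative and unimodal, with undiminished supremum.

  Let \<open>W\<close> bound the width of the superlevel set of a level \<open>a\<close>. At the ends of the superlevel set of a
  higher level \<open>b\<close>, the difference of the velocities is at most \<open>- c (b - a) W\<^bsup>-s\<^esup>\<close> as long as
  its width is at least \<open>W / 2\<close>, so after a time of order \<open>W\<^bsup>1+s\<^esup> / (b - a)\<close> the
  width is below \<open>W / 2\<close>. Iterating along levels that increase to half of the maximum, the widths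
  \<open>2\<^bsup>-n\<^esup> W\<close> are reached at times that stay bounded since \<open>1 + s > 0\<close>. A profile of positive height
  over an interval of width zero contradicts the bound on \<open>\<partial>\<^sub>x \<theta>\<close>.

  The argument needs \<open>u\<close> to be locally bounded uniformly in time, and the only obstruction is a
  large velocity at the origin generated by \<open>\<theta>\<close> near infinity. For \<open>s > - 1 / 2\<close> it is controlled by a
  Gronwall estimate, because a unimodal function has bounded variation. For \<open>s < 0\<close> the velocity is
  Lipschitz in \<open>x\<close>, so there is a trajectory starting at the origin, and a weighted \<open>L\<^sup>1\<close> estimate shows
  that \<open>\<theta>\<close> stays even about it; hence the trajectory does not move and \<open>u(t, 0) = 0\<close>.
\<close>

text \<open>The obstacle is a circle: decay and unimodality of \<theta>(t) rest on a velocity of at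
  most linear growth, while bounding the velocity rests on unimodality (bounded variation) or
  evenness. So boundedness of \<open>u t 0\<close> is first assumed qualitatively, with a constant
  \<open>A\<close>; the bounds then derived do not contain \<open>A\<close>, and continuation in
  time removes the assumption.

  Without decay of \<theta>(t) the kernel gives no estimate of \<open>u t x\<close> alone. It does
  for differences \<open>u t x - u t y\<close>, which grow at most like |x|^max(1/2, -s). The tail
  of \<open>u t 0\<close> changes in time through u \<theta>x against the weight |y|^(-1-s). For s <
  0, growth |y|^(-s) times this weight is |y|^(-1-2s), which is bounded at infinity if and only if s
  \<ge> -1/2; this is the origin of the threshold. For s < 0 the kernel is integrable at 0, which
  makes u Lipschitz and lets the source of the odd part be estimated by the odd part itself. The two
  ranges overlap, and the final argument splits at s = 0.\<close>

lemma compact_no_earliest: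
  fixes B :: "(real \<times> 'a::topological_space) set"
  assumes "compact B" "\<And>p. p \<in> B \<Longrightarrow> \<exists>q\<in>B. fst q < fst p"
  shows "B = {}"
proof (rule ccontr)
  assume "B \<noteq> {}"
  have "continuous_on B fst" by (intro continuous_intros)
  from continuous_attains_inf[OF assms(1) \<open>B \<noteq> {}\<close> this]
  obtain p where "p \<in> B" "\<forall>q\<in>B. fst p \<le> fst q" by blast
  with assms(2)[of p] show False by force
qed

section \<open>The velocity as a limit of truncated integrals\<close>

text \<open>The singular kernel takes opposite values at y = x + r and y = x - r. Pairing them
  cancels the subtracted constant and leaves f(x + r) - f(x - r) times this weight. Its value at r =
  0 is 0, since \<open>0 powr a = 0\<close>.\<close>

definition ker :: "real \<Rightarrow> real \<Rightarrow> real" where "ker s r = r powr (- 1 - s)"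

lemma ker_nonneg [simp]: "0 \<le> ker s r" by (simp add: ker_def)

lemma ker_pos: "0 < r \<Longrightarrow> 0 < ker s r" by (simp add: ker_def)

lemma ker_antimono: "- 1 < s \<Longrightarrow> 0 < a \<Longrightarrow> a \<le> b \<Longrightarrow> ker s b \<le> ker s a"
  unfolding ker_def by (rule powr_mono2') auto

lemma ker_has_derivative:
  assumes "0 < r"
  shows "(ker s has_real_derivative - (1 + s) * r powr (- 2 - s)) (at r)"
proof -
  have "((\<lambda>r. r powr (- 1 - s)) has_real_derivative (- 1 - s) * r powr (- 1 - s - 1)) (at r)"
    by (rule has_real_derivative_powr[OF assms])
  moreover have "(- 1 - s) * r powr (- 1 - s - 1) = - (1 + s) * r powr (- 2 - s)"
    by (rule arg_cong2[where f = "(*)"]) simp_all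
  moreover have "ker s = (\<lambda>r. r powr (- 1 - s))" by (auto simp: ker_def)
  ultimately show ?thesis by (simp only:)
qed

lemma continuous_on_ker [continuous_intros]:
  assumes "continuous_on A f" "\<And>x. x \<in> A \<Longrightarrow> f x > 0"
  shows "continuous_on A (\<lambda>x. ker s (f x))"
  unfolding ker_def using assms by (intro continuous_intros) (auto simp: less_imp_neq[symmetric])

lemma kappa_pos: assumes "- 1 < s" "s < 1" shows "0 < kappa s"
  unfolding kappa_def using assms by (intro divide_pos_pos mult_pos_pos Gamma_real_pos) auto

lemma set_integral_shift_interval:
  fixes g :: "real \<Rightarrow> real"
  shows "(LINT y:{x + a<..<x + b}|lborel. g y) = (LINT r:{a<..<b}|lborel. g (x + r))"
proof -
  have "(LINT y:{x + a<..<x + b}|lborel. g y) = (LINT r|lborel. indicator {x + a<..<x + b} (x + r) *\<^sub>R g (x + r))"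
    unfolding set_lebesgue_integral_def
    using lborel_integral_real_affine[of 1 "\<lambda>y. indicator {x + a<..<x + b} y *\<^sub>R g y" x] by simp
  also have "\<dots> = (LINT r:{a<..<b}|lborel. g (x + r))"
    unfolding set_lebesgue_integral_def by (rule Bochner_Integration.integral_cong) (auto simp: indicator_def)
  finally show ?thesis .
qed

lemma set_integral_reflect_interval:
  fixes g :: "real \<Rightarrow> real"
  shows "(LINT y:{x - b<..<x - a}|lborel. g y) = (LINT r:{a<..<b}|lborel. g (x - r))"
proof -
  have "(LINT y:{x - b<..<x - a}|lborel. g y) = (LINT r|lborel. indicator {x - b<..<x - a} (x - r) *\<^sub>R g (x - r))"
    unfolding set_lebesgue_integral_def
    using lborel_integral_real_affine[of "- 1" "\<lambda>y. indicator {x - b<..<x - a} y *\<^sub>R g y" x] by simp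
  also have "\<dots> = (LINT r:{a<..<b}|lborel. g (x - r))"
    unfolding set_lebesgue_integral_def by (rule Bochner_Integration.integral_cong) (auto simp: indicator_def)
  finally show ?thesis .
qed

lemma set_integral_greaterThanLessThan_eq:
  fixes g :: "real \<Rightarrow> real"
  assumes "continuous_on {a..b} g"
  shows "(LINT r:{a<..<b}|lborel. g r) = integral {a..b} g" "set_integrable lborel {a<..<b} g"
proof -
  have "set_integrable lborel {a..b} g"
    using assms by (rule borel_integrable_atLeastAtMost')
  then show 1: "set_integrable lborel {a<..<b} g"
    by (rule set_integrable_subset) auto
  have "(LINT r:{a<..<b}|lborel. g r) = integral {a<..<b} g"
    using 1 by (rule set_borel_integral_eq_integral)
  also have "\<dots> = integral {a..b} g" by (simp add: integral_open_interval_real)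
  finally show "(LINT r:{a<..<b}|lborel. g r) = integral {a..b} g" .
qed

definition odd_diff :: "(real \<Rightarrow> real) \<Rightarrow> real \<Rightarrow> real \<Rightarrow> real" where
  "odd_diff f x y = f (x + y) - f (x - y)"

lemma continuous_on_odd_diff [continuous_intros]:
  assumes "continuous_on UNIV f" "continuous_on A g"
  shows "continuous_on A (\<lambda>y. odd_diff f x (g y))"
  unfolding odd_diff_def using assms
  by (auto intro!: continuous_intros continuous_on_compose2[OF assms(1)])

text \<open>The two-parameter limit is restricted to the curve \<epsilon> = 1/R and the annulus is
  folded onto \<open>{1/R..R}\<close>, where \<open>f x\<close> cancels between the two halves.
  Later estimates work with this one-parameter limit of integrals of continuous functions.\<close>

lemma has_Lambda_H_limit:
  assumes "has_Lambda_H s f x v" "continuous_on UNIV f"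
  shows "((\<lambda>R. kappa s * integral {1/R..R} (\<lambda>y. odd_diff f x y * ker s y)) \<longlongrightarrow> v) at_top"
proof -
  define F where "F = (\<lambda>y. (f y - f x) / ((y - x) * \<bar>y - x\<bar> powr s))"
  obtain I where I: "has_pv_integral F x I" "v = kappa s * I"
    using assms(1) unfolding has_Lambda_H_def F_def by auto
  define J where "J = (\<lambda>(\<epsilon>, R). LINT y:{y. \<epsilon> < \<bar>y - x\<bar> \<and> \<bar>y - x\<bar> < R}|lborel. F y)"
  have lim: "(J \<longlongrightarrow> I) (at_right 0 \<times>\<^sub>F at_top)"
    using I(1) unfolding has_pv_integral_def J_def by auto
  have fl: "filterlim (\<lambda>R::real. (1 / R, R)) (at_right 0 \<times>\<^sub>F at_top) at_top"
  proof (rule filterlim_Pair)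
    show "LIM R at_top. 1 / R :> at_right (0::real)"
      using filterlim_inverse_at_right_top by (simp add: inverse_eq_divide)
  qed (rule filterlim_ident)
  have "((\<lambda>R. J (1/R, R)) \<longlongrightarrow> I) at_top"
    using filterlim_compose[OF lim fl] .
  moreover have "eventually (\<lambda>R. J (1/R, R) = integral {1/R..R} (\<lambda>y. odd_diff f x y * ker s y)) at_top"
    using eventually_gt_at_top[of 1]
  proof eventually_elim
    case (elim R)
    define e where "e = 1 / R"
    have "1 < R * R" using elim by (rule less_1_mult[OF _ elim])
    then have e: "0 < e" "e < R" using elim unfolding e_def by (auto simp: field_simps)
    have set: "{y. e < \<bar>y - x\<bar> \<and> \<bar>y - x\<bar> < R} = {x - R<..<x - e} \<union> {x + e<..<x + R}"
      using e by auto
    have int: "set_integrable lborel {y. e < \<bar>y - x\<bar> \<and> \<bar>y - x\<bar> < R} F"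
      using I(1) e unfolding has_pv_integral_def by auto
    have cont: "continuous_on {e..R} (\<lambda>r. (f (x + r) - f x) * ker s r)"
       "continuous_on {e..R} (\<lambda>r. (f x - f (x - r)) * ker s r)"
      using assms(2) e by (auto intro!: continuous_intros continuous_on_compose2[OF assms(2)])
    have "J (1/R, R) = (LINT y:{x - R<..<x - e}|lborel. F y) + (LINT y:{x + e<..<x + R}|lborel. F y)"
      unfolding J_def e_def[symmetric] prod.case set
      by (rule set_integral_Un) (use e int set in \<open>auto intro: set_integrable_subset[OF int]\<close>)
    also have "(LINT y:{x - R<..<x - e}|lborel. F y) = (LINT r:{e<..<R}|lborel. (f x - f (x - r)) * ker s r)"
      unfolding set_integral_reflect_interval
      by (rule set_lebesgue_integral_cong)
        (use e in \<open>auto simp: F_def ker_def field_simps powr_diff powr_minus powr_add\<close>)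
    also have "\<dots> = integral {e..R} (\<lambda>r. (f x - f (x - r)) * ker s r)"
      by (rule set_integral_greaterThanLessThan_eq(1)[OF cont(2)])
    also have "(LINT y:{x + e<..<x + R}|lborel. F y) = (LINT r:{e<..<R}|lborel. (f (x + r) - f x) * ker s r)"
      unfolding set_integral_shift_interval
      by (rule set_lebesgue_integral_cong)
        (use e in \<open>auto simp: F_def ker_def field_simps powr_diff powr_minus powr_add\<close>)
    also have "\<dots> = integral {e..R} (\<lambda>r. (f (x + r) - f x) * ker s r)"
      by (rule set_integral_greaterThanLessThan_eq(1)[OF cont(1)])
    also have "integral {e..R} (\<lambda>r. (f x - f (x - r)) * ker s r) + \<dots>
        = integral {e..R} (\<lambda>y. odd_diff f x y * ker s y)"
      by (subst integral_add[symmetric])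
         (use cont in \<open>auto intro!: integrable_continuous_interval simp: odd_diff_def algebra_simps\<close>)
    finally show ?case by (simp add: e_def)
  qed
  ultimately have "((\<lambda>R. integral {1/R..R} (\<lambda>y. odd_diff f x y * ker s y)) \<longlongrightarrow> I) at_top"
    by (rule Lim_transform_eventually)
  then show ?thesis unfolding I(2) by (intro tendsto_intros)
qed

section \<open>Integrals against the kernel and differences of velocities\<close>

lemma abs_integral_le_integral:
  fixes f g :: "real \<Rightarrow> real"
  assumes "f integrable_on S" "g integrable_on S" "\<And>x. x \<in> S \<Longrightarrow> \<bar>f x\<bar> \<le> g x"
  shows "\<bar>integral S f\<bar> \<le> integral S g"
  using integral_norm_bound_integral[of f S g] assms by auto

text \<open>A decreasing weight against a derivative with bounded primitive: after integration by
  parts the boundary terms cost S (ker a + ker b) and the remaining integral S (ker a - ker b). The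
  sum does not depend on b, which controls tails even where the kernel is not integrable at
  infinity.\<close>

lemma integral_ker_by_parts_bound:
  assumes s: "- 1 < s" and ab: "0 < a" "a \<le> b"
    and F: "\<And>r. r \<in> {a..b} \<Longrightarrow> (F has_real_derivative F' r) (at r)" and F': "continuous_on {a..b} F'"
    and S: "\<And>r. r \<in> {a..b} \<Longrightarrow> \<bar>F r\<bar> \<le> S"
  shows "\<bar>integral {a..b} (\<lambda>r. F' r * ker s r)\<bar> \<le> 2 * S * ker s a"
proof -
  define k' where "k' = (\<lambda>r. (1 + s) * r powr (- 2 - s))"
  have k: "(ker s has_vector_derivative - k' r) (at r within {a..b})" if "r \<in> {a..b}" for r
  proof -
    have "(ker s has_vector_derivative - k' r) (at r)"
      using ker_has_derivative[of r s] that ab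
      unfolding k'_def has_real_derivative_iff_has_vector_derivative minus_mult_left by simp
    then show ?thesis by (rule has_vector_derivative_at_within)
  qed
  have Fc: "continuous_on {a..b} F"
    using F by (meson DERIV_isCont continuous_at_imp_continuous_on)
  have kc: "continuous_on {a..b} k'" unfolding k'_def using ab by (auto intro!: continuous_intros)
  have Fk: "((\<lambda>r. - k' r) has_integral ker s b - ker s a) {a..b}"
    by (rule fundamental_theorem_of_calculus) (use k ab in auto)
  have ik: "(k' has_integral ker s a - ker s b) {a..b}"
    using has_integral_neg[OF Fk] by simp
  have d: "((\<lambda>r. F r * ker s r) has_vector_derivative F' r * ker s r - F r * k' r) (at r within {a..b})"
    if "r \<in> {a..b}" for r
  proof -
    have "(F has_vector_derivative F' r) (at r within {a..b})"
      using F[OF that] by (auto simp: has_real_derivative_iff_has_vector_derivative intro: has_vector_derivative_at_within)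
    from has_vector_derivative_mult[OF this k[OF that]] show ?thesis by (simp add: algebra_simps)
  qed
  have i1: "((\<lambda>r. F' r * ker s r - F r * k' r) has_integral F b * ker s b - F a * ker s a) {a..b}"
    by (rule fundamental_theorem_of_calculus) (use d ab in auto)
  have int2: "(\<lambda>r. F r * k' r) integrable_on {a..b}"
    by (intro integrable_continuous_interval continuous_intros Fc kc)
  have "((\<lambda>r. F' r * ker s r) has_integral F b * ker s b - F a * ker s a + integral {a..b} (\<lambda>r. F r * k' r)) {a..b}"
    using has_integral_add[OF i1 integrable_integral[OF int2]] by simp
  then have eq: "integral {a..b} (\<lambda>r. F' r * ker s r) = F b * ker s b - F a * ker s a + integral {a..b} (\<lambda>r. F r * k' r)"
    by (rule integral_unique)
  have "\<bar>integral {a..b} (\<lambda>r. F r * k' r)\<bar> \<le> integral {a..b} (\<lambda>r. S * k' r)"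
  proof (rule abs_integral_le_integral[OF int2])
    show "(\<lambda>r. S * k' r) integrable_on {a..b}" by (intro integrable_continuous_interval continuous_intros kc)
    show "\<bar>F r * k' r\<bar> \<le> S * k' r" if "r \<in> {a..b}" for r
    proof -
      have "0 \<le> k' r" unfolding k'_def using s by auto
      then show ?thesis using S[OF that] by (auto simp: abs_mult intro: mult_right_mono)
    qed
  qed
  also have "\<dots> = S * (ker s a - ker s b)" using ik by (simp add: integral_unique)
  finally have "\<bar>integral {a..b} (\<lambda>r. F r * k' r)\<bar> \<le> S * (ker s a - ker s b)" .
  moreover have "\<bar>F b * ker s b\<bar> \<le> S * ker s b" "\<bar>F a * ker s a\<bar> \<le> S * ker s a"
    using S[of a] S[of b] ab by (auto simp: abs_mult intro: mult_right_mono)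
  ultimately show ?thesis unfolding eq by (auto simp: algebra_simps)
qed

lemma integral_id_mult_ker_le:
  assumes s: "s < 1" and a: "0 < a" "a \<le> 1"
  shows "integral {a..1} (\<lambda>y. y * ker s y) \<le> 1 / (1 - s)"
proof -
  have "((\<lambda>y. y * ker s y) has_integral 1 powr (1 - s) / (1 - s) - a powr (1 - s) / (1 - s)) {a..1}"
  proof (rule fundamental_theorem_of_calculus)
    fix y assume y: "y \<in> {a..1}"
    have "((\<lambda>y. y powr (1 - s) / (1 - s)) has_real_derivative (1 - s) * y powr (1 - s - 1) / (1 - s)) (at y)"
      using y a by (intro DERIV_cdivide has_real_derivative_powr) auto
    moreover have "(1 - s) * y powr (1 - s - 1) / (1 - s) = y * ker s y"
      using s y a by (simp add: ker_def powr_mult_base)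
    ultimately show "((\<lambda>y. y powr (1 - s) / (1 - s)) has_vector_derivative y * ker s y) (at y within {a..1})"
      by (simp add: has_real_derivative_iff_has_vector_derivative has_vector_derivative_at_within)
  qed (use a in auto)
  moreover have "0 \<le> a powr (1 - s) / (1 - s)" using s by auto
  ultimately show ?thesis by (simp add: integral_unique)
qed

text \<open>Raising the exponent -1 - s to \<beta> - 1 with \<beta> > 0 treats s < 0, the
  logarithmic case s = 0 and s > 0 at once.\<close>

lemma integral_ker_growth_le:
  assumes \<beta>: "0 < \<beta>" "- s \<le> \<beta>" and Y: "1 \<le> Y"
  shows "integral {1..Y} (ker s) \<le> Y powr \<beta> / \<beta>"
proof -
  have hi: "((\<lambda>y. y powr (\<beta> - 1)) has_integral Y powr \<beta> / \<beta> - 1 powr \<beta> / \<beta>) {1..Y}"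
  proof (rule fundamental_theorem_of_calculus)
    fix y assume y: "y \<in> {1..Y}"
    have "((\<lambda>y. y powr \<beta> / \<beta>) has_real_derivative \<beta> * y powr (\<beta> - 1) / \<beta>) (at y)"
      using y by (intro DERIV_cdivide has_real_derivative_powr) auto
    then show "((\<lambda>y. y powr \<beta> / \<beta>) has_vector_derivative y powr (\<beta> - 1)) (at y within {1..Y})"
      using \<beta> by (simp add: has_real_derivative_iff_has_vector_derivative has_vector_derivative_at_within)
  qed (use Y in auto)
  have "integral {1..Y} (ker s) \<le> integral {1..Y} (\<lambda>y. y powr (\<beta> - 1))"
  proof (rule integral_le)
    show "ker s integrable_on {1..Y}"
      by (intro integrable_continuous_interval continuous_on_ker[where f = "\<lambda>x. x", simplified]) auto
    show "(\<lambda>y. y powr (\<beta> - 1)) integrable_on {1..Y}" using hi by blast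
    show "ker s y \<le> y powr (\<beta> - 1)" if "y \<in> {1..Y}" for y
      unfolding ker_def using that \<beta> by (intro powr_mono) auto
  qed
  also have "\<dots> \<le> Y powr \<beta> / \<beta>" using hi \<beta> by (simp add: integral_unique)
  finally show ?thesis .
qed

lemma continuous_antiderivative:
  fixes f :: "real \<Rightarrow> real"
  assumes "continuous_on UNIV f"
  obtains F where "\<And>x. (F has_real_derivative f x) (at x)"
proof -
  have "isCont f x" for x using assms by (simp add: continuous_on_eq_continuous_at)
  then obtain F where "\<forall>x. - \<infinity> < ereal x \<longrightarrow> ereal x < \<infinity> \<longrightarrow> (F has_vector_derivative f x) (at x)"
    using einterval_antiderivative[of "- \<infinity>" \<infinity> f] by auto
  then have "\<And>x. (F has_real_derivative f x) (at x)"
    by (simp add: has_real_derivative_iff_has_vector_derivative)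
  then show ?thesis using that by blast
qed

text \<open>The difference of two odd differences is the derivative of a bounded function: this turns the
  decay of the kernel into convergence, without any decay of \<open>f\<close>.\<close>

lemma odd_diff_tail_bound:
  assumes s: "- 1 < s" and f: "continuous_on UNIV f" "\<And>x. \<bar>f x\<bar> \<le> C" and Y: "0 < Y" "Y \<le> R"
  shows "\<bar>integral {Y..R} (\<lambda>y. (odd_diff f x1 y - odd_diff f x2 y) * ker s y)\<bar> \<le> 4 * C * \<bar>x1 - x2\<bar> * ker s Y"
proof -
  obtain F where F: "\<And>x. (F has_real_derivative f x) (at x)"
    using continuous_antiderivative[OF f(1)] by blast
  have lip: "\<bar>F a - F b\<bar> \<le> C * \<bar>a - b\<bar>" for a b
    using field_differentiable_bound[of UNIV F f C a b] F f(2) by auto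
  have "\<bar>integral {Y..R} (\<lambda>y. (odd_diff f x1 y - odd_diff f x2 y) * ker s y)\<bar> \<le> 2 * (2 * C * \<bar>x1 - x2\<bar>) * ker s Y"
  \<comment> \<open>Grouped by the sign in front of y, the primitive consists of two increments of
    the Lipschitz function F over the distance |x1 - x2|.\<close>
  proof (rule integral_ker_by_parts_bound[OF s Y, where F = "\<lambda>y. F (x1 + y) - F (x2 + y) + F (x1 - y) - F (x2 - y)"])
    show "((\<lambda>y. F (x1 + y) - F (x2 + y) + F (x1 - y) - F (x2 - y)) has_real_derivative
          odd_diff f x1 r - odd_diff f x2 r) (at r)" for r
      by (auto intro!: derivative_eq_intros DERIV_chain'[OF _ F] simp: odd_diff_def)
    show "continuous_on {Y..R} (\<lambda>r. odd_diff f x1 r - odd_diff f x2 r)"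
      by (intro continuous_intros f)
    show "\<bar>F (x1 + r) - F (x2 + r) + F (x1 - r) - F (x2 - r)\<bar> \<le> 2 * C * \<bar>x1 - x2\<bar>" for r
      using lip[of "x1 + r" "x2 + r"] lip[of "x1 - r" "x2 - r"] by auto
  qed
  then show ?thesis by simp
qed

lemma odd_diff_ker_integrable:
  assumes "continuous_on UNIV f" "0 < a"
  shows "(\<lambda>y. odd_diff f x y * ker s y) integrable_on {a..b}"
  using assms by (intro integrable_continuous_interval continuous_intros) auto

lemma odd_diff_near_bound:
  assumes f: "continuous_on UNIV f" "\<And>x y. \<bar>f x - f y\<bar> \<le> C * \<bar>x - y\<bar>"
    and s: "s < 1" and a: "0 < a" "a \<le> 1"
  shows "\<bar>integral {a..1} (\<lambda>y. odd_diff f x y * ker s y)\<bar> \<le> 2 * C / (1 - s)"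
proof -
  have C: "0 \<le> C" using f(2)[of 0 1] by auto
  have "\<bar>integral {a..1} (\<lambda>y. odd_diff f x y * ker s y)\<bar> \<le> integral {a..1} (\<lambda>y. 2 * C * (y * ker s y))"
  proof (rule abs_integral_le_integral)
    show "(\<lambda>y. 2 * C * (y * ker s y)) integrable_on {a..1}"
      using a by (intro integrable_continuous_interval continuous_intros) auto
    show "\<bar>odd_diff f x y * ker s y\<bar> \<le> 2 * C * (y * ker s y)" if "y \<in> {a..1}" for y
      using mult_right_mono[OF f(2)[of "x + y" "x - y"], of "ker s y"] that a
      by (auto simp: odd_diff_def abs_mult)
  qed (intro odd_diff_ker_integrable f a)
  also have "\<dots> = 2 * C * integral {a..1} (\<lambda>y. y * ker s y)" by simp
  also have "\<dots> \<le> 2 * C * (1 / (1 - s))"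
    using integral_id_mult_ker_le[OF s a] C by (intro mult_left_mono) auto
  finally show ?thesis by simp
qed

text \<open>Below 1 the Lipschitz bound beats the singularity, on [1, Y] boundedness of f is enough,
  beyond Y the tail bound applies. \<open>Y\<close> is left free, to be taken of the size of the
  distance of the two points.\<close>

lemma Lambda_H_diff_bound:
  assumes s: "- 1 < s" "s < 1"
    and f: "continuous_on UNIV f" "\<And>x. \<bar>f x\<bar> \<le> C" "\<And>x y. \<bar>f x - f y\<bar> \<le> C * \<bar>x - y\<bar>"
    and v: "has_Lambda_H s f x1 v1" "has_Lambda_H s f x2 v2"
    and \<beta>: "0 < \<beta>" "- s \<le> \<beta>" and Y: "1 \<le> Y"
  shows "\<bar>v1 - v2\<bar> \<le> kappa s * (4 * C / (1 - s) + 4 * C * (Y powr \<beta> / \<beta>) + 4 * C * \<bar>x1 - x2\<bar> * ker s Y)"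
    (is "_ \<le> kappa s * ?B")
proof -
  have C: "0 \<le> C" using f(2)[of 0] by auto
  define D where "D = (\<lambda>y. (odd_diff f x1 y - odd_diff f x2 y) * ker s y)"
  note lim = tendsto_diff[OF has_Lambda_H_limit[OF v(1) f(1)] has_Lambda_H_limit[OF v(2) f(1)]]
  have "\<bar>v1 - v2\<bar> \<le> kappa s * ?B"
  proof (rule tendsto_upperbound[OF tendsto_rabs[OF lim]])
    show "eventually (\<lambda>R. \<bar>kappa s * integral {1/R..R} (\<lambda>y. odd_diff f x1 y * ker s y) -
          kappa s * integral {1/R..R} (\<lambda>y. odd_diff f x2 y * ker s y)\<bar> \<le> kappa s * ?B) at_top"
      using eventually_gt_at_top[of Y]
    proof eventually_elim
      case (elim R)
      then have R: "0 < 1 / R" "1 / R \<le> 1" "1 \<le> R" "Y \<le> R" using Y by auto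
      have int: "(\<lambda>y. odd_diff f x y * ker s y) integrable_on {a..b}" if "0 < a" for a b x
        using odd_diff_ker_integrable[OF f(1) that] .
      have intD: "D integrable_on {a..b}" if "0 < a" for a b
        using integrable_diff[OF int[OF that, of x1] int[OF that, of x2]] by (simp add: D_def left_diff_distrib)
      have "integral {1/R..R} (\<lambda>y. odd_diff f x1 y * ker s y) - integral {1/R..R} (\<lambda>y. odd_diff f x2 y * ker s y)
          = integral {1/R..R} D"
        unfolding D_def left_diff_distrib by (rule integral_diff[symmetric]) (use R int in auto)
      also have "\<dots> = integral {1/R..1} D + integral {1..Y} D + integral {Y..R} D"
        using Henstock_Kurzweil_Integration.integral_combine[of "1/R" 1 R D]
          Henstock_Kurzweil_Integration.integral_combine[of 1 Y R D] R Y intD by auto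
      finally have eq: "integral {1/R..R} (\<lambda>y. odd_diff f x1 y * ker s y) - integral {1/R..R} (\<lambda>y. odd_diff f x2 y * ker s y)
          = integral {1/R..1} D + integral {1..Y} D + integral {Y..R} D" .
      have "integral {1/R..1} D = integral {1/R..1} (\<lambda>y. odd_diff f x1 y * ker s y) - integral {1/R..1} (\<lambda>y. odd_diff f x2 y * ker s y)"
        unfolding D_def left_diff_distrib by (rule integral_diff) (use R int in auto)
      then have b1: "\<bar>integral {1/R..1} D\<bar> \<le> 4 * C / (1 - s)"
        using odd_diff_near_bound[OF f(1) f(3) s(2) R(1,2), of x1] odd_diff_near_bound[OF f(1) f(3) s(2) R(1,2), of x2]
        by auto
      have "\<bar>integral {1..Y} D\<bar> \<le> integral {1..Y} (\<lambda>y. 4 * C * ker s y)"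
      proof (rule abs_integral_le_integral)
        show "(\<lambda>y. 4 * C * ker s y) integrable_on {1..Y}"
          by (intro integrable_continuous_interval continuous_intros) auto
        show "\<bar>D y\<bar> \<le> 4 * C * ker s y" if "y \<in> {1..Y}" for y
        proof -
          have "\<bar>odd_diff f x1 y - odd_diff f x2 y\<bar> \<le> 4 * C"
            unfolding odd_diff_def using f(2)[of "x1 + y"] f(2)[of "x2 + y"] f(2)[of "x1 - y"] f(2)[of "x2 - y"] by linarith
          then show ?thesis unfolding D_def abs_mult by (intro mult_mono) auto
        qed
      qed (use intD in auto)
      also have "\<dots> = 4 * C * integral {1..Y} (ker s)" by simp
      also have "\<dots> \<le> 4 * C * (Y powr \<beta> / \<beta>)"
        using integral_ker_growth_le[OF \<beta> Y] C by (intro mult_left_mono) auto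
      finally have b2: "\<bar>integral {1..Y} D\<bar> \<le> 4 * C * (Y powr \<beta> / \<beta>)" .
      have b3: "\<bar>integral {Y..R} D\<bar> \<le> 4 * C * \<bar>x1 - x2\<bar> * ker s Y"
        unfolding D_def using odd_diff_tail_bound[OF s(1) f(1,2), of Y R] R Y by auto
      have "\<bar>kappa s * (integral {1/R..1} D + integral {1..Y} D + integral {Y..R} D)\<bar> \<le> kappa s * ?B"
        using b1 b2 b3 kappa_pos[OF s] by (subst abs_mult) (auto intro!: mult_left_mono)
      then show ?case by (simp only: right_diff_distrib[symmetric] eq)
    qed
  qed auto
  then show ?thesis .
qed

text \<open>The mean value theorem evaluates the slope of the kernel at a point below y + w \<le> 3
  W, whence the base 3 W.\<close>

lemma ker_increment_ge:
  assumes s: "- 1 < s" and W: "0 < W" "y \<in> {W..2 * W}" "0 \<le> w" "w \<le> W"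
  shows "(1 + s) * w * (3 * W) powr (- 2 - s) \<le> ker s y - ker s (y + w)"
proof (cases "w = 0")
  case False
  then have "\<exists>z. y < z \<and> z < y + w \<and> ker s (y + w) - ker s y = (y + w - y) * (- (1 + s) * z powr (- 2 - s))"
    using W by (intro MVT2 ker_has_derivative) auto
  then obtain z where z: "y < z" "z < y + w" "ker s (y + w) - ker s y = w * (- (1 + s) * z powr (- 2 - s))" by auto
  have "(3 * W) powr (- 2 - s) \<le> z powr (- 2 - s)"
    using z W s by (intro powr_mono2') auto
  then have "(1 + s) * w * (3 * W) powr (- 2 - s) \<le> (1 + s) * w * z powr (- 2 - s)"
    using s W by (intro mult_left_mono) auto
  then show ?thesis using z(3) by (auto simp: algebra_simps)
qed auto

text \<open>The two ends \<open>x\<close>, \<open>z\<close> of a superlevel set approach each other. The part of \<open>f\<close> inside the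
  superlevel set contributes with the right sign; the parts outside, seen from the two ends,
  differ by a shift of the kernel by the width \<open>w\<close>.\<close>

lemma Lambda_H_superlevel_ends:
  assumes s: "- 1 < s" "s < 1"
    and f: "continuous_on UNIV f" "\<And>x. \<bar>f x\<bar> \<le> C"
    and v: "has_Lambda_H s f x v1" "has_Lambda_H s f z v2"
    and w: "w = z - x" "0 < w" "w \<le> W"
    and inside: "\<And>y. x \<le> y \<Longrightarrow> y \<le> z \<Longrightarrow> l \<le> f y"
    and outside: "\<And>y. y \<le> x \<Longrightarrow> f y \<le> l" "\<And>y. z \<le> y \<Longrightarrow> f y \<le> l"
    and far: "0 \<le> \<Delta>" "\<And>y. z + W \<le> y \<Longrightarrow> f y \<le> l - \<Delta>"
  shows "v2 - v1 \<le> - kappa s * (\<Delta> * W * ((1 + s) * w * (3 * W) powr (- 2 - s)))"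
proof -
  \<comment> \<open>The total deficit below the level \<open>l\<close> at distance y outside the two
    ends.\<close>
  define g where "g = (\<lambda>y. (l - f (z + y)) + (l - f (x - y)))"
  have gc: "continuous_on A (\<lambda>y. g (h y))" if "continuous_on A h" for A h
    unfolding g_def using that by (intro continuous_intros continuous_on_compose2[OF f(1)]) auto
  have g0: "0 \<le> g y" if "0 \<le> y" for y
    unfolding g_def using outside(1)[of "x - y"] outside(2)[of "z + y"] that by auto
  have lC: "\<bar>l\<bar> \<le> C"
    using f(2)[of "x + w / 2"] f(2)[of z] inside[of "x + w / 2"] inside[of x] outside(2)[of z] f(2)[of x] w by auto
  have gC: "g y \<le> 4 * C" for y
    unfolding g_def using f(2)[of "z + y"] f(2)[of "x - y"] lC by linarith
  have far_g: "\<Delta> \<le> g y" if "W \<le> y" for y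
    unfolding g_def using far(2)[of "z + y"] outside(1)[of "x - y"] that w by auto
  have W: "0 < W" using w by auto
  define D where "D = (\<lambda>y. odd_diff f z y - odd_diff f x y)"
  have D1: "D y \<le> - g y" if "0 \<le> y" "y \<le> w" for y
    unfolding D_def g_def odd_diff_def using inside[of "z - y"] inside[of "x + y"] that w by auto
  \<comment> \<open>The points z - y and x + y lie at signed distance y - w outside the two ends, so
    the integrand is a difference of g and its shift by w. After a change of variable g is
    integrated against ker y - ker (y + w), which is nonnegative.\<close>
  have D2: "D y = - g y + g (y - w)" for y
  proof -
    have "z + (y - w) = x + y" "x - (y - w) = z - y" using w by auto
    then show ?thesis unfolding D_def g_def odd_diff_def by (simp only:)
  qed
  have Dc: "continuous_on A D" for A unfolding D_def by (intro continuous_intros f)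
  note lim = tendsto_diff[OF has_Lambda_H_limit[OF v(2) f(1)] has_Lambda_H_limit[OF v(1) f(1)]]
  define G where "G = \<Delta> * W * ((1 + s) * w * (3 * W) powr (- 2 - s))"
  \<comment> \<open>The shifted integral starts at 0 and not at the cut-off 1/R. The piece on
    [0, 1/R] is the error term, which vanishes in the limit.\<close>
  have ev: "eventually (\<lambda>R. kappa s * integral {1/R..R} (\<lambda>y. odd_diff f z y * ker s y) -
          kappa s * integral {1/R..R} (\<lambda>y. odd_diff f x y * ker s y)
          \<le> kappa s * (- G + (1/R) * (4 * C * ker s w))) at_top"
    using eventually_gt_at_top[of "1 + 1 / w + 2 * W + w"]
  proof eventually_elim
    case (elim R)
    have pos: "0 < 1 / w" using w by auto
    define e where "e = 1 / R"
    have R: "R > 1" "1 / w < R" "2 * W \<le> R - w" using elim pos w(2) W by linarith+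
    have "1 < w * R" using R(2) w(2) by (simp add: field_simps)
    then have "e < w" using R(1) by (simp add: e_def field_simps)
    then have e: "0 < e" "e < w" "e < W" "w < R"
      using R(1,3) w(2,3) unfolding e_def by auto
    have ik: "(\<lambda>y. h y * ker s (y + c)) integrable_on {a..b}"
      if "continuous_on {a..b} h" "0 < a + c" for h a b c
      using that by (intro integrable_continuous_interval continuous_intros) auto
    have ik0: "(\<lambda>y. h y * ker s y) integrable_on {a..b}" if "continuous_on {a..b} h" "0 < a" for h a b
      using ik[of a b h 0] that by simp
    have ig: "(\<lambda>y. - g y * ker s y) integrable_on {a..b}" "(\<lambda>y. g y * ker s y) integrable_on {a..b}" if "0 < a" for a b
      by (rule ik0[OF _ that], intro continuous_intros gc)+
    have igw: "(\<lambda>y. g y * ker s (y + w)) integrable_on {a..b}" if "0 \<le> a" for a b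
      by (rule ik) (use that w(2) in \<open>auto intro!: continuous_intros gc\<close>)
    have igs: "(\<lambda>y. g (y - w) * ker s y) integrable_on {a..b}" if "0 < a" for a b
      by (rule ik0[OF _ that], intro continuous_intros gc)
    have "integral {e..R} (\<lambda>y. odd_diff f z y * ker s y) - integral {e..R} (\<lambda>y. odd_diff f x y * ker s y)
      = integral {e..R} (\<lambda>y. D y * ker s y)"
      unfolding D_def left_diff_distrib
      by (rule integral_diff[symmetric]) (use e odd_diff_ker_integrable[OF f(1)] in auto)
    also have "\<dots> = integral {e..w} (\<lambda>y. D y * ker s y) + integral {w..R} (\<lambda>y. D y * ker s y)"
      by (rule Henstock_Kurzweil_Integration.integral_combine[symmetric]) (use e ik0 Dc in auto)
    also have "integral {e..w} (\<lambda>y. D y * ker s y) \<le> integral {e..w} (\<lambda>y. - g y * ker s y)"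
      by (rule integral_le[OF ik0[OF Dc e(1)] ig(1)[OF e(1)] mult_right_mono[OF D1]]) (use e in auto)
    also have "integral {w..R} (\<lambda>y. D y * ker s y)
        = integral {w..R} (\<lambda>y. - g y * ker s y) + integral {w..R} (\<lambda>y. g (y - w) * ker s y)"
      unfolding D2 distrib_right
      by (rule integral_add[OF ig(1) igs]) (use w in auto)
    also have "integral {w..R} (\<lambda>y. g (y - w) * ker s y) = integral {0..R - w} (\<lambda>y. g y * ker s (y + w))"
      using integral_shift_real_ivl[of w w R "\<lambda>y. g (y - w) * ker s y"] by simp
    also have "\<dots> = integral {0..e} (\<lambda>y. g y * ker s (y + w)) + integral {e..R - w} (\<lambda>y. g y * ker s (y + w))"
      by (rule Henstock_Kurzweil_Integration.integral_combine[symmetric, OF _ _ igw]) (use e R W in auto)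
    also have "integral {0..e} (\<lambda>y. g y * ker s (y + w)) \<le> integral {0..e} (\<lambda>y. 4 * C * ker s w)"
    proof (rule integral_le)
      show "g y * ker s (y + w) \<le> 4 * C * ker s w" if "y \<in> {0..e}" for y
        using that w(2,3) g0[of y] gC[of y] s by (intro mult_mono ker_antimono) auto
    qed (auto intro!: igw)
    also have "\<dots> = e * (4 * C * ker s w)" using e by simp
    finally have 1: "integral {e..R} (\<lambda>y. odd_diff f z y * ker s y) - integral {e..R} (\<lambda>y. odd_diff f x y * ker s y)
      \<le> integral {e..w} (\<lambda>y. - g y * ker s y) + integral {w..R} (\<lambda>y. - g y * ker s y)
        + e * (4 * C * ker s w) + integral {e..R - w} (\<lambda>y. g y * ker s (y + w))" by simp
    have 2: "integral {e..w} (\<lambda>y. - g y * ker s y) + integral {w..R} (\<lambda>y. - g y * ker s y)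
      = integral {e..R} (\<lambda>y. - g y * ker s y)"
      by (rule Henstock_Kurzweil_Integration.integral_combine) (use e ig in auto)
    have 3: "\<dots> = integral {e..R - w} (\<lambda>y. - g y * ker s y) + integral {R - w..R} (\<lambda>y. - g y * ker s y)"
      by (rule Henstock_Kurzweil_Integration.integral_combine[symmetric])
        (use e w(2,3) W R ig in auto)
    have 4: "integral {R - w..R} (\<lambda>y. - g y * ker s y) \<le> integral {R - w..R} (\<lambda>y. 0)"
    proof (rule integral_le)
      show "(\<lambda>y. - g y * ker s y) integrable_on {R - w..R}" by (rule ig) (use e W R in linarith)
      show "- g y * ker s y \<le> 0" if "y \<in> {R - w..R}" for y
        using g0[of y] that e W R by auto
    qed auto
    have 5: "integral {e..R - w} (\<lambda>y. - g y * ker s y) + integral {e..R - w} (\<lambda>y. g y * ker s (y + w))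
      = integral {e..R - w} (\<lambda>y. - (g y * (ker s y - ker s (y + w))))"
      by (subst integral_add[OF ig(1) igw, symmetric]) (use e in \<open>auto simp: algebra_simps\<close>)
    define h where "h = (\<lambda>y. - (g y * (ker s y - ker s (y + w))))"
    have hc: "continuous_on {a..b} h" if "0 < a" for a b
      unfolding h_def using that w(2) by (intro continuous_intros gc) auto
    have h0: "h y \<le> 0" if "0 < y" for y
      unfolding h_def using g0[of y] ker_antimono[OF s(1), of y "y + w"] that w(2) by auto
    have 6: "integral {e..R - w} h = integral {e..W} h + integral {W..2*W} h + integral {2*W..R - w} h"
      using Henstock_Kurzweil_Integration.integral_combine[of e W "2*W" h]
        Henstock_Kurzweil_Integration.integral_combine[of e "2*W" "R-w" h] e W R
        integrable_continuous_interval[OF hc[OF e(1)]] by auto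
    have 7: "integral {e..W} h \<le> integral {e..W} (\<lambda>y. 0)" "integral {2*W..R - w} h \<le> integral {2*W..R - w} (\<lambda>y. 0)"
      by (rule integral_le; use e W h0 hc in \<open>auto intro!: integrable_continuous_interval\<close>)+
    \<comment> \<open>All three ranges have the favourable sign. The gain is taken from [W, 2 W]:
      there g \<ge> \<Delta>, and the length of the range is the factor W in G.\<close>
    have 8: "integral {W..2*W} h \<le> integral {W..2*W} (\<lambda>y. - (\<Delta> * ((1 + s) * w * (3 * W) powr (- 2 - s))))"
    proof (rule integral_le)
      show "h y \<le> - (\<Delta> * ((1 + s) * w * (3 * W) powr (- 2 - s)))" if "y \<in> {W..2*W}" for y
        unfolding h_def neg_le_iff_le
        by (rule mult_mono[OF far_g ker_increment_ge]) (use that W w(2,3) s g0[of y] in auto)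
    qed (use W hc in \<open>auto intro!: integrable_continuous_interval\<close>)
    also have "\<dots> = - G" using W by (simp add: G_def)
    finally have "integral {e..R} (\<lambda>y. odd_diff f z y * ker s y) - integral {e..R} (\<lambda>y. odd_diff f x y * ker s y)
      \<le> - G + e * (4 * C * ker s w)"
      using 1 2 3 4 5 6 7 unfolding h_def[symmetric] by simp
    then show ?case
      unfolding e_def[symmetric] right_diff_distrib[symmetric] using kappa_pos[OF s] by (intro mult_left_mono) auto
  qed
  have "((\<lambda>R. kappa s * (- G + (1/R) * (4 * C * ker s w))) \<longlongrightarrow> kappa s * (- G + 0 * (4 * C * ker s w))) at_top"
    using tendsto_inverse_0_at_top[OF filterlim_ident[of at_top]]
    by (intro tendsto_intros) (simp add: inverse_eq_divide)
  from tendsto_le[OF _ this lim ev] show ?thesis by (simp add: G_def)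
qed

section \<open>Transport and the comparison principle\<close>

text \<open>One Lipschitz constant in x for all times turns separate continuity into joint
  continuity. It serves for \<theta> and, when s < 0, for u.\<close>

lemma continuous_on_Times_Lipschitz:
  fixes g :: "real \<Rightarrow> real \<Rightarrow> real"
  assumes cont: "\<And>x. continuous_on S (\<lambda>t. g t x)"
    and lip: "\<And>t x y. t \<in> S \<Longrightarrow> \<bar>g t x - g t y\<bar> \<le> L * \<bar>x - y\<bar>"
  shows "continuous_on (S \<times> UNIV) (\<lambda>(t, x). g t x)"
  unfolding continuous_on_eq_continuous_within
proof
  fix p :: "real \<times> real" assume p: "p \<in> S \<times> UNIV"
  obtain t x where tx: "p = (t, x)" by (cases p)
  have t: "t \<in> S" using p tx by auto
  show "continuous (at p within S \<times> UNIV) (\<lambda>(t, x). g t x)"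
    unfolding continuous_within tx prod.case
  proof (rule Lim_transform)
    have "continuous_on (S \<times> (UNIV :: real set)) (\<lambda>q. g (fst q) x)"
      by (rule continuous_on_compose2[OF cont]) (auto intro!: continuous_intros)
    then show "((\<lambda>q. g (fst q) x) \<longlongrightarrow> g t x) (at (t, x) within S \<times> UNIV)"
      using t by (fastforce simp: continuous_on_def)
    have "((\<lambda>q. L * \<bar>snd q - x\<bar>) \<longlongrightarrow> L * \<bar>snd (t, x) - x\<bar>) (at (t, x) within S \<times> UNIV)"
      by (intro tendsto_intros)
    then have 0: "((\<lambda>q. L * \<bar>snd q - x\<bar>) \<longlongrightarrow> 0) (at (t, x) within S \<times> UNIV)" by simp
    show "((\<lambda>q. (case q of (t, x) \<Rightarrow> g t x) - g (fst q) x) \<longlongrightarrow> 0) (at (t, x) within S \<times> UNIV)"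
    proof (rule Lim_null_comparison[OF _ 0])
      show "eventually (\<lambda>q. norm ((case q of (t, x) \<Rightarrow> g t x) - g (fst q) x) \<le> L * \<bar>snd q - x\<bar>) (at (t, x) within S \<times> UNIV)"
        unfolding eventually_at_filter using lip by (auto intro!: always_eventually)
    qed
  qed
qed

text \<open>The solution on a compact time interval. One constant \<open>C\<close> bounds \<theta>
  and its x-derivative, so it is a Lipschitz constant as well. The function \<open>u\<close> is
  known through the principal value and the equation alone.\<close>

locale transport =
  fixes s T C :: real and \<theta> \<theta>t \<theta>x u :: "real \<Rightarrow> real \<Rightarrow> real"
  assumes s: "- 1 < s" "s < 1" and T: "0 \<le> T"
    and cont_t: "continuous_on ({0..T} \<times> UNIV) (\<lambda>(t, x). \<theta>t t x)"
    and cont_x: "continuous_on ({0..T} \<times> UNIV) (\<lambda>(t, x). \<theta>x t x)"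
    and deriv_t: "t \<in> {0..T} \<Longrightarrow> ((\<lambda>\<tau>. \<theta> \<tau> x) has_real_derivative \<theta>t t x) (at t within {0..T})"
    and deriv_x: "t \<in> {0..T} \<Longrightarrow> (\<theta> t has_real_derivative \<theta>x t x) (at x)"
    and vel: "t \<in> {0..T} \<Longrightarrow> has_Lambda_H s (\<theta> t) x (u t x)"
    and pde: "t \<in> {0..T} \<Longrightarrow> \<theta>t t x + u t x * \<theta>x t x = 0"
    and bound: "t \<in> {0..T} \<Longrightarrow> \<bar>\<theta> t x\<bar> \<le> C" "t \<in> {0..T} \<Longrightarrow> \<bar>\<theta>x t x\<bar> \<le> C"
begin

lemma C_nonneg: "0 \<le> C" using bound(1)[of 0 0] T by auto

lemma lipschitz: "t \<in> {0..T} \<Longrightarrow> \<bar>\<theta> t x - \<theta> t y\<bar> \<le> C * \<bar>x - y\<bar>"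
  using field_differentiable_bound[of UNIV "\<theta> t" "\<theta>x t" C x y] deriv_x bound(2) by auto

lemma continuous_x: "t \<in> {0..T} \<Longrightarrow> continuous_on A (\<theta> t)"
  by (meson DERIV_isCont continuous_at_imp_continuous_on deriv_x)

lemma continuous_\<theta>x: assumes "t \<in> {0..T}" shows "continuous_on A (\<theta>x t)"
proof -
  from assms have "continuous_on A (\<lambda>x. case (t, x) of (t, x) \<Rightarrow> \<theta>x t x)"
    by (intro continuous_on_compose2[OF cont_x]) (auto intro!: continuous_intros)
  then show ?thesis by simp
qed

lemma continuous_\<theta>: "continuous_on ({0..T} \<times> UNIV) (\<lambda>(t, x). \<theta> t x)"
  by (rule continuous_on_Times_Lipschitz[OF DERIV_continuous_on[OF deriv_t] lipschitz])

lemma continuous_comp: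
  assumes "continuous_on A f" "continuous_on A g" "f ` A \<subseteq> {0..T}"
  shows "continuous_on A (\<lambda>p. \<theta> (f p) (g p))" "continuous_on A (\<lambda>p. \<theta>t (f p) (g p))"
    "continuous_on A (\<lambda>p. \<theta>x (f p) (g p))"
  using continuous_on_compose2[OF continuous_\<theta>, of A "\<lambda>p. (f p, g p)"]
    continuous_on_compose2[OF cont_t, of A "\<lambda>p. (f p, g p)"]
    continuous_on_compose2[OF cont_x, of A "\<lambda>p. (f p, g p)"] assms
  by (auto intro!: continuous_intros simp: image_subset_iff)

text \<open>With the velocity frozen at (t, x), the linear part \<theta>t h + \<theta>x h u of the
  increment vanishes by the equation; joint continuity of the two partial derivatives controls the
  remainder.\<close>

lemma shift:
  assumes t: "t \<in> {0..T}" and e: "0 < e"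
  obtains d where "0 < d"
    "\<And>h. \<bar>h\<bar> < d \<Longrightarrow> t + h \<in> {0..T} \<Longrightarrow> \<bar>\<theta> (t + h) (x + h * u t x) - \<theta> t x\<bar> \<le> e * \<bar>h\<bar>"
proof -
  define v where "v = u t x"
  \<comment> \<open>The path has a time leg of length |h| and a space leg of length |h v|. An error
    rate e' on both adds up to e |h|.\<close>
  define e' where "e' = e / (1 + \<bar>v\<bar>)"
  have e': "0 < e'" "e' * (1 + \<bar>v\<bar>) = e" using e unfolding e'_def by (auto simp: field_simps)
  have "(t, x) \<in> {0..T} \<times> UNIV" using t by auto
  then obtain d1 d2 where d: "0 < d1" "0 < d2"
    and d1: "\<And>t' x'. t' \<in> {0..T} \<Longrightarrow> dist (t', x') (t, x) < d1 \<Longrightarrow> \<bar>\<theta>t t' x' - \<theta>t t x\<bar> < e'"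
    and d2: "\<And>t' x'. t' \<in> {0..T} \<Longrightarrow> dist (t', x') (t, x) < d2 \<Longrightarrow> \<bar>\<theta>x t' x' - \<theta>x t x\<bar> < e'"
    using cont_t[unfolded continuous_on_iff, rule_format, of "(t, x)" e']
      cont_x[unfolded continuous_on_iff, rule_format, of "(t, x)" e'] e'(1)
    by (auto simp: dist_real_def)
  define d where "d = min d1 d2 / (1 + \<bar>v\<bar>)"
  have dpos: "0 < d" using d unfolding d_def by auto
  have "\<bar>\<theta> (t + h) (x + h * v) - \<theta> t x\<bar> \<le> e * \<bar>h\<bar>" if h: "\<bar>h\<bar> < d" "t + h \<in> {0..T}" for h
  proof -
    have hd: "\<bar>h\<bar> + \<bar>h * v\<bar> < min d1 d2"
      using h(1) unfolding d_def by (auto simp: field_simps abs_mult)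
    have near: "dist (t', x') (t, x) < min d1 d2" if "\<bar>t' - t\<bar> \<le> \<bar>h\<bar>" "\<bar>x' - x\<bar> \<le> \<bar>h * v\<bar>" for t' x'
    proof -
      have "dist (t', x') (t, x) \<le> \<bar>t' - t\<bar> + \<bar>x' - x\<bar>"
        unfolding dist_prod_def by (auto simp: dist_real_def intro!: order.trans[OF sqrt_sum_squares_le_sum_abs])
      then show ?thesis using that hd by auto
    qed
    have seg: "closed_segment t (t + h) \<subseteq> {0..T}" using t h(2)
      by (auto simp: closed_segment_eq_real_ivl split: if_splits)
    have "\<bar>(\<theta> (t + h) (x + h * v) - \<theta>t t x * (t + h)) - (\<theta> t (x + h * v) - \<theta>t t x * t)\<bar> \<le> e' * \<bar>(t + h) - t\<bar>"
      unfolding real_norm_def[symmetric]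
    proof (rule field_differentiable_bound[where S = "closed_segment t (t + h)" and f' = "\<lambda>\<tau>. \<theta>t \<tau> (x + h * v) - \<theta>t t x"])
      fix \<tau> assume \<tau>: "\<tau> \<in> closed_segment t (t + h)"
      have "((\<lambda>\<tau>. \<theta> \<tau> (x + h * v)) has_real_derivative \<theta>t \<tau> (x + h * v)) (at \<tau> within closed_segment t (t + h))"
        by (rule DERIV_subset[OF deriv_t]) (use \<tau> seg in auto)
      then show "((\<lambda>\<tau>. \<theta> \<tau> (x + h * v) - \<theta>t t x * \<tau>) has_real_derivative \<theta>t \<tau> (x + h * v) - \<theta>t t x) (at \<tau> within closed_segment t (t + h))"
        by (auto intro!: derivative_eq_intros)
      have "\<bar>\<tau> - t\<bar> \<le> \<bar>h\<bar>" using \<tau> by (auto simp: closed_segment_eq_real_ivl split: if_splits)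
      then have "\<bar>\<theta>t \<tau> (x + h * v) - \<theta>t t x\<bar> < e'"
        using d1[of \<tau> "x + h * v"] near[of \<tau> "x + h * v"] \<tau> seg by auto
      then show "norm (\<theta>t \<tau> (x + h * v) - \<theta>t t x) \<le> e'" by simp
    qed auto
    then have 1: "\<bar>\<theta> (t + h) (x + h * v) - \<theta> t (x + h * v) - \<theta>t t x * h\<bar> \<le> e' * \<bar>h\<bar>"
      by (simp add: algebra_simps)
    have "\<bar>(\<theta> t (x + h * v) - \<theta>x t x * (x + h * v)) - (\<theta> t x - \<theta>x t x * x)\<bar> \<le> e' * \<bar>(x + h * v) - x\<bar>"
      unfolding real_norm_def[symmetric]
    proof (rule field_differentiable_bound[where S = "closed_segment x (x + h * v)" and f' = "\<lambda>\<xi>. \<theta>x t \<xi> - \<theta>x t x"])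
      fix \<xi> assume \<xi>: "\<xi> \<in> closed_segment x (x + h * v)"
      have "(\<theta> t has_real_derivative \<theta>x t \<xi>) (at \<xi> within closed_segment x (x + h * v))"
        by (rule has_field_derivative_at_within[OF deriv_x[OF t]])
      then show "((\<lambda>\<xi>. \<theta> t \<xi> - \<theta>x t x * \<xi>) has_real_derivative \<theta>x t \<xi> - \<theta>x t x) (at \<xi> within closed_segment x (x + h * v))"
        by (auto intro!: derivative_eq_intros)
      have "\<bar>\<xi> - x\<bar> \<le> \<bar>h * v\<bar>" using \<xi> by (auto simp: closed_segment_eq_real_ivl split: if_splits)
      then have "\<bar>\<theta>x t \<xi> - \<theta>x t x\<bar> < e'"
        using d2[of t \<xi>] near[of t \<xi>] t by auto
      then show "norm (\<theta>x t \<xi> - \<theta>x t x) \<le> e'" by simp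
    qed auto
    then have 2: "\<bar>\<theta> t (x + h * v) - \<theta> t x - \<theta>x t x * (h * v)\<bar> \<le> e' * \<bar>h * v\<bar>"
      by (simp add: algebra_simps)
    have "\<theta>t t x * h + \<theta>x t x * (h * v) = (\<theta>t t x + v * \<theta>x t x) * h" by (simp add: algebra_simps)
    also have "\<dots> = 0" using pde[OF t] v_def by simp
    finally have 3: "\<theta>t t x * h + \<theta>x t x * (h * v) = 0" .
    have "e * \<bar>h\<bar> = e' * \<bar>h\<bar> + e' * \<bar>h * v\<bar>" by (simp add: e'(2)[symmetric] abs_mult algebra_simps)
    then show ?thesis using 1 2 3 by linarith
  qed
  then show ?thesis using that dpos v_def by blast
qed

text \<open>Positive, as the growth bound for integrals of the kernel requires; below 1, so that the
  velocity grows at most linearly; equal to 1/2 for s \<ge> -1/2, the exponent that is weighed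
  against ker s y \<le> y^(-1/2) later.\<close>

definition "\<beta> = max (1 / 2) (- s)"

lemma velocity_growth:
  obtains A where "0 \<le> A" "\<And>t x. t \<in> {0..T} \<Longrightarrow> \<bar>u t x - u t 0\<bar> \<le> A * (1 + \<bar>x\<bar>) powr \<beta>"
proof -
  define A where "A = kappa s * (4 * C / (1 - s) + 4 * C / \<beta> + 4 * C)"
  have \<beta>: "0 < \<beta>" "- s \<le> \<beta>" unfolding \<beta>_def by auto
  have A: "0 \<le> A" unfolding A_def using C_nonneg \<beta> s kappa_pos[OF s] by (auto intro!: mult_nonneg_nonneg add_nonneg_nonneg divide_nonneg_nonneg)
  have "\<bar>u t x - u t 0\<bar> \<le> A * (1 + \<bar>x\<bar>) powr \<beta>" if t: "t \<in> {0..T}" for t x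
  proof -
    \<comment> \<open>With this choice the tail term |x| ker Y is at most Y^(-s), so it is covered
      by the bound Y^\<beta> of the middle range.\<close>
    define Y where "Y = 1 + \<bar>x\<bar>"
    have Y: "1 \<le> Y" unfolding Y_def by auto
    have P: "1 \<le> Y powr \<beta>" using Y \<beta> by (simp add: ge_one_powr_ge_zero)
    have "\<bar>x - 0\<bar> * ker s Y \<le> Y * ker s Y" unfolding Y_def by (intro mult_right_mono) auto
    also have "Y * ker s Y = Y powr (- s)" unfolding ker_def using Y by (simp add: powr_mult_base)
    also have "\<dots> \<le> Y powr \<beta>" using Y \<beta> by (intro powr_mono) auto
    finally have 1: "\<bar>x - 0\<bar> * ker s Y \<le> Y powr \<beta>" .
    have "\<bar>u t x - u t 0\<bar> \<le> kappa s * (4 * C / (1 - s) + 4 * C * (Y powr \<beta> / \<beta>) + 4 * C * \<bar>x - 0\<bar> * ker s Y)"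
      using Lambda_H_diff_bound[OF s continuous_x[OF t] bound(1)[OF t] lipschitz[OF t] vel[OF t] vel[OF t] \<beta> Y] .
    also have "\<dots> \<le> kappa s * (4 * C / (1 - s) * Y powr \<beta> + 4 * C / \<beta> * Y powr \<beta> + 4 * C * Y powr \<beta>)"
    proof (intro mult_left_mono add_mono)
      show "4 * C / (1 - s) \<le> 4 * C / (1 - s) * Y powr \<beta>"
        using mult_left_mono[OF P, of "4 * C / (1 - s)"] C_nonneg s by simp
      show "4 * C * \<bar>x - 0\<bar> * ker s Y \<le> 4 * C * Y powr \<beta>"
        using 1 C_nonneg mult_left_mono[OF 1, of "4 * C"] by (simp add: mult.assoc)
    qed (use kappa_pos[OF s] in auto)
    also have "\<dots> = A * Y powr \<beta>" unfolding A_def by (simp add: algebra_simps)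
    finally show ?thesis unfolding Y_def .
  qed
  then show ?thesis using that A by blast
qed

lemma velocity_linear_growth:
  assumes "\<And>t. t \<in> {0..T} \<Longrightarrow> \<bar>u t 0\<bar> \<le> A"
  obtains A' where "0 \<le> A'" "\<And>t x. t \<in> {0..T} \<Longrightarrow> \<bar>u t x\<bar> \<le> A' * (1 + \<bar>x\<bar>)"
proof -
  obtain B where B: "0 \<le> B" "\<And>t x. t \<in> {0..T} \<Longrightarrow> \<bar>u t x - u t 0\<bar> \<le> B * (1 + \<bar>x\<bar>) powr \<beta>"
    using velocity_growth by blast
  have "\<beta> \<le> 1" using s by (auto simp: \<beta>_def)
  have "\<bar>u t x\<bar> \<le> (\<bar>A\<bar> + B) * (1 + \<bar>x\<bar>)" if t: "t \<in> {0..T}" for t x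
  proof -
    have "(1 + \<bar>x\<bar>) powr \<beta> \<le> (1 + \<bar>x\<bar>) powr 1" using \<open>\<beta> \<le> 1\<close> by (intro powr_mono) auto
    then have "B * (1 + \<bar>x\<bar>) powr \<beta> \<le> B * (1 + \<bar>x\<bar>)" using B by (intro mult_left_mono) auto
    moreover have "\<bar>A\<bar> \<le> \<bar>A\<bar> * (1 + \<bar>x\<bar>)" by (simp add: algebra_simps)
    ultimately show ?thesis using B(2)[OF t, of x] assms[OF t] unfolding distrib_right by linarith
  qed
  then show ?thesis using that[of "\<bar>A\<bar> + B"] B by auto
qed

end

lemma compact_Collect_le:
  fixes f g :: "'a::t2_space \<Rightarrow> real"
  assumes "compact K" "continuous_on K f" "continuous_on K g"
  shows "compact {p \<in> K. f p \<le> g p}"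
proof -
  have "closed {p \<in> K. f p \<le> g p}"
    by (rule continuous_on_closed_Collect_le) (use assms in \<open>auto intro: compact_imp_closed\<close>)
  from compact_Int_closed[OF assms(1) this] show ?thesis
    by (simp add: Collect_conj_eq Int_absorb1 Int_commute inf.absorb2 Int_left_absorb Collect_mem_eq)
qed

lemma eventually_at_right_0: "0 < d \<Longrightarrow> eventually (\<lambda>r. 0 < r \<and> r < d) (at_right (0::real))"
  using eventually_at_right_field by blast

context transport
begin

lemma shift_back:
  assumes t: "0 < t" "t \<le> T" and e: "0 < e"
  shows "eventually (\<lambda>r. \<bar>\<theta> (t - r) (x - r * u t x) - \<theta> t x\<bar> \<le> e * r) (at_right 0)"
proof -
  obtain d where d: "0 < d"
    "\<And>h. \<bar>h\<bar> < d \<Longrightarrow> t + h \<in> {0..T} \<Longrightarrow> \<bar>\<theta> (t + h) (x + h * u t x) - \<theta> t x\<bar> \<le> e * \<bar>h\<bar>"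
    using shift[of t e x] t e by auto
  show ?thesis using eventually_at_right_0[of "min d t"] d(1) t
  proof (auto elim!: eventually_mono)
    fix r assume "0 < r" "r < d" "r < t"
    then show "\<bar>\<theta> (t - r) (x - r * u t x) - \<theta> t x\<bar> \<le> e * r" using d(2)[of "- r"] t by auto
  qed
qed

lemma shift_forward:
  assumes t: "0 \<le> t" "t < T" and e: "0 < e"
  shows "eventually (\<lambda>r. \<bar>\<theta> (t + r) (x + r * u t x) - \<theta> t x\<bar> \<le> e * r) (at_right 0)"
proof -
  obtain d where d: "0 < d"
    "\<And>h. \<bar>h\<bar> < d \<Longrightarrow> t + h \<in> {0..T} \<Longrightarrow> \<bar>\<theta> (t + h) (x + h * u t x) - \<theta> t x\<bar> \<le> e * \<bar>h\<bar>"
    using shift[of t e x] t e by auto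
  show ?thesis using eventually_at_right_0[of "min d (T - t)"] d(1) t
  proof (auto elim!: eventually_mono)
    fix r assume "0 < r" "r < d" "r < T - t"
    then show "\<bar>\<theta> (t + r) (x + r * u t x) - \<theta> t x\<bar> \<le> e * r" using d(2)[of r] t by auto
  qed
qed

text \<open>Taking \<open>B = 0\<close> gives the maximum principle on the whole line; \<open>B > 0\<close> expresses that the
  support cannot spread faster than exponentially.\<close>

lemma comparison:
  assumes A: "0 \<le> A" and lin: "\<And>t x. t \<in> {0..T} \<Longrightarrow> \<bar>u t x\<bar> \<le> A * (1 + \<bar>x\<bar>)"
    and \<sigma>: "\<sigma> = 1 \<or> \<sigma> = - 1" and B: "0 \<le> B"
    and init: "\<And>x. B \<le> 1 + \<bar>x\<bar> \<Longrightarrow> \<sigma> * \<theta> 0 x \<le> a"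
    and t: "t \<in> {0..T}" and x: "B * exp ((A + 1) * t) \<le> 1 + \<bar>x\<bar>"
  shows "\<sigma> * \<theta> t x \<le> a"
proof (rule field_le_epsilon)
  fix \<epsilon>0 :: real assume \<epsilon>0: "0 < \<epsilon>0"
  \<comment> \<open>One more than the growth constant of u: in a backward step h the factor exp (- K
    h) outweighs the growth 1 + A h of 1 + |y| by at least h / 2, which pays for the transport
    error.\<close>
  define K where "K = A + 1"
  \<comment> \<open>The barrier a + \<epsilon> (1 + |y|) exp (K r) equals a + \<epsilon>0 at the
    given point. Its growth in y confines the bad set to |y| \<le> N because \<theta> is
    bounded.\<close>
  define \<epsilon> where "\<epsilon> = \<epsilon>0 / ((1 + \<bar>x\<bar>) * exp (K * t))"
  have \<epsilon>: "0 < \<epsilon>" using \<epsilon>0 unfolding \<epsilon>_def by (intro divide_pos_pos mult_pos_pos) auto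
  define N where "N = (C + \<bar>a\<bar>) / \<epsilon>"
  define D :: "(real \<times> real) set" where "D = {0..T} \<times> {- N..N}"
  define Bad where "Bad = {p \<in> {p \<in> D. B * exp (K * fst p) \<le> 1 + \<bar>snd p\<bar>}.
    a + \<epsilon> * (1 + \<bar>snd p\<bar>) * exp (K * fst p) \<le> \<sigma> * \<theta> (fst p) (snd p)}"
  have fac: "1 \<le> (1 + \<bar>y\<bar>) * exp (K * r)" if "0 \<le> r" for y r
    using mult_mono[of 1 "1 + \<bar>y\<bar>" 1 "exp (K * r)"] that A by (auto simp: K_def)
  have inD: "(r, y) \<in> D" if "r \<in> {0..T}" "a + \<epsilon> * (1 + \<bar>y\<bar>) * exp (K * r) \<le> \<sigma> * \<theta> r y" for r y
  proof -
    have "\<epsilon> * \<bar>y\<bar> * 1 \<le> \<epsilon> * (1 + \<bar>y\<bar>) * exp (K * r)"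
      using that \<epsilon> A by (intro mult_mono) (auto simp: K_def)
    also have "\<dots> \<le> C + \<bar>a\<bar>" using that(2) bound(1)[OF that(1), of y] \<sigma> by auto
    finally have "\<bar>y\<bar> \<le> N" unfolding N_def using \<epsilon> by (simp add: field_simps)
    then show ?thesis using that unfolding D_def by auto
  qed
  have "compact Bad"
    unfolding Bad_def
  proof (intro compact_Collect_le continuous_intros)
    show "compact D" unfolding D_def by (intro compact_Times) auto
    have "continuous_on D (\<lambda>p. \<theta> (fst p) (snd p))"
      by (rule continuous_comp) (auto simp: D_def intro!: continuous_intros)
    then show "continuous_on {p \<in> D. B * exp (K * fst p) \<le> 1 + \<bar>snd p\<bar>} (\<lambda>p. \<theta> (fst p) (snd p))"
      by (rule continuous_on_subset) auto
  qed
  moreover have "\<exists>q\<in>Bad. fst q < fst p" if "p \<in> Bad" for p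
  proof -
    obtain r y where p: "p = (r, y)" by (cases p)
    have r: "r \<in> {0..T}" "B * exp (K * r) \<le> 1 + \<bar>y\<bar>"
      "a + \<epsilon> * ((1 + \<bar>y\<bar>) * exp (K * r)) \<le> \<sigma> * \<theta> r y"
      using that unfolding Bad_def D_def p by (auto simp: mult.assoc)
    have r0: "0 < r"
    proof (rule ccontr)
      assume "\<not> 0 < r"
      then have "r = 0" using r by auto
      then have "\<sigma> * \<theta> r y \<le> a" using init[of y] r(2) by auto
      moreover have "0 < \<epsilon> * ((1 + \<bar>y\<bar>) * exp (K * r))" using \<epsilon> by (intro mult_pos_pos) auto
      ultimately show False using r(3) by linarith
    qed
    have "eventually (\<lambda>h. (0 < h \<and> h < min r (1 / (2 * ((A + 1) * K)))) \<and>
        \<bar>\<theta> (r - h) (y - h * u r y) - \<theta> r y\<bar> \<le> \<epsilon> / 2 * h) (at_right 0)"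
      using r0 r(1) \<epsilon> A by (intro eventually_conj eventually_at_right_0 shift_back) (auto simp: K_def add_nonneg_pos)
    then obtain h where h: "0 < h" "h < r" "h < 1 / (2 * ((A + 1) * K))"
      "\<bar>\<theta> (r - h) (y - h * u r y) - \<theta> r y\<bar> \<le> \<epsilon> / 2 * h"
      using eventually_happens' trivial_limit_at_right_real by (metis (no_types, lifting) min_less_iff_conj)
    define y' where "y' = y - h * u r y"
    have "0 < 2 * ((A + 1) * K)" using A by (simp add: K_def)
    with h(3) have "h * (2 * ((A + 1) * K)) < 1" by (simp only: pos_less_divide_eq)
    then have hAK: "2 * (h * (A * K)) + 2 * (h * K) < 1" by (simp add: algebra_simps)
    have hK: "2 * (h * K) < 1" "h * (A * K) < 1"
    proof -
      have "0 \<le> h * (A * K)" "0 \<le> h * K" using h(1) A by (simp_all add: K_def)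
      then show "2 * (h * K) < 1" "h * (A * K) < 1" using hAK by linarith+
    qed
    define E where "E = exp (- (K * h))"
    have E: "0 < E" "E * (1 + K * h) \<le> 1"
    proof -
      have "1 + K * h \<le> exp (K * h)" by (rule exp_ge_add_one_self)
      then have "E * (1 + K * h) \<le> E * exp (K * h)" unfolding E_def by (intro mult_left_mono) auto
      also have "\<dots> = 1" unfolding E_def by (simp add: exp_minus)
      finally show "E * (1 + K * h) \<le> 1" .
    qed (simp add: E_def)
    have EE: "exp (K * (r - h)) = exp (K * r) * E" unfolding E_def by (simp add: algebra_simps flip: exp_add)
    have hu: "h * \<bar>u r y\<bar> \<le> h * A * (1 + \<bar>y\<bar>)"
      using mult_left_mono[OF lin[OF r(1), of y], of h] h(1) by (simp add: mult.assoc)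
    have y': "\<bar>\<bar>y'\<bar> - \<bar>y\<bar>\<bar> \<le> h * A * (1 + \<bar>y\<bar>)"
    proof -
      have "\<bar>\<bar>y'\<bar> - \<bar>y\<bar>\<bar> \<le> \<bar>h * u r y\<bar>" unfolding y'_def by linarith
      moreover have "\<bar>h * u r y\<bar> = h * \<bar>u r y\<bar>" using h(1) by (simp add: abs_mult)
      ultimately show ?thesis using hu by linarith
    qed
    \<comment> \<open>This keeps the moved point in the outer region: 1 + |y| keeps at least the
      fraction 1 - A h, while the threshold B exp (K r) shrinks by the factor E.\<close>
    have E1: "E \<le> 1 - A * h"
    proof -
      have "1 \<le> (1 - A * h) * (1 + K * h)"
        using mult_left_mono[of "h * (A * K)" 1 h] hK h(1) by (simp add: K_def algebra_simps)
      then have "E * (1 + K * h) \<le> (1 - A * h) * (1 + K * h)" using E by linarith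
      moreover have "0 < 1 + K * h" using h(1) A by (auto simp: K_def intro!: add_pos_nonneg)
      ultimately show ?thesis by (rule mult_right_le_imp_le)
    qed
    have E2: "(1 + A * h) * E \<le> 1 - h / 2"
    proof -
      have "(1 + A * h) * E = E * (1 + K * h) - h * E" by (simp add: K_def algebra_simps)
      moreover have "1 / 2 \<le> E"
      proof -
        have "1 - K * h \<le> E" unfolding E_def using exp_ge_add_one_self[of "- (K * h)"] by simp
        then show ?thesis using hK by (simp add: mult.commute)
      qed
      ultimately show ?thesis using E h(1) mult_left_mono[of "1/2" E h] by linarith
    qed
    have "(r - h, y') \<in> Bad"
    proof -
      have "B * exp (K * (r - h)) \<le> (1 + \<bar>y\<bar>) * E"
        unfolding EE using mult_right_mono[OF r(2), of E] E by (simp add: mult.assoc)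
      also have "\<dots> \<le> (1 + \<bar>y\<bar>) * (1 - A * h)" by (intro mult_left_mono E1) auto
      also have "\<dots> \<le> 1 + \<bar>y'\<bar>" using y' by (simp add: algebra_simps)
      finally have 1: "B * exp (K * (r - h)) \<le> 1 + \<bar>y'\<bar>" .
      have "(1 + \<bar>y'\<bar>) * exp (K * (r - h)) \<le> ((1 + \<bar>y\<bar>) * (1 + A * h)) * exp (K * (r - h))"
        using y' by (intro mult_right_mono) (auto simp: algebra_simps)
      also have "\<dots> = ((1 + \<bar>y\<bar>) * exp (K * r)) * ((1 + A * h) * E)" unfolding EE by simp
      also have "\<dots> \<le> ((1 + \<bar>y\<bar>) * exp (K * r)) * (1 - h / 2)" by (intro mult_left_mono E2) auto
      also have "\<dots> \<le> (1 + \<bar>y\<bar>) * exp (K * r) - h / 2"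
        using mult_right_mono[OF fac[of r y], of "h / 2"] h(1) r0 by (simp add: algebra_simps)
      finally have "\<epsilon> * ((1 + \<bar>y'\<bar>) * exp (K * (r - h))) \<le> \<epsilon> * ((1 + \<bar>y\<bar>) * exp (K * r) - h / 2)"
        using \<epsilon> by (intro mult_left_mono) auto
      moreover have "\<bar>\<sigma> * \<theta> (r - h) y' - \<sigma> * \<theta> r y\<bar> \<le> \<epsilon> * (h / 2)"
        using h(4) \<sigma> unfolding y'_def by (auto simp: abs_minus_commute)
      ultimately have 2: "a + \<epsilon> * (1 + \<bar>y'\<bar>) * exp (K * (r - h)) \<le> \<sigma> * \<theta> (r - h) y'"
        using r(3) unfolding right_diff_distrib mult.assoc by linarith
      have 3: "r - h \<in> {0..T}" using h r(1) by auto
      show ?thesis using 1 2 3 inD[OF 3 2] unfolding Bad_def by auto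
    qed
    then show ?thesis using h(1) unfolding p by force
  qed
  ultimately have "Bad = {}" by (rule compact_no_earliest)
  then have "(t, x) \<notin> Bad" by auto
  then have "\<sigma> * \<theta> t x < a + \<epsilon> * (1 + \<bar>x\<bar>) * exp (K * t)"
    using inD[OF t, of x] t x unfolding Bad_def K_def by (force simp: not_le)
  also have "\<dots> = a + \<epsilon>0" unfolding \<epsilon>_def by (simp add: mult.assoc)
  finally show "\<sigma> * \<theta> t x \<le> a + \<epsilon>0" by simp
qed

end

lemma ex_at_right_0: "eventually P (at_right (0::real)) \<Longrightarrow> \<exists>h. P h"
  using eventually_happens'[OF trivial_limit_at_right_real] .

text \<open>Distinct points keep their order under a sufficiently short move, whatever their
  velocities. This takes the place of the order preservation of a flow.\<close>

lemma eventually_shift_less: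
  fixes a b p q :: real
  assumes "a < b" shows "eventually (\<lambda>h. a - h * p < b - h * q) (at_right 0)"
proof -
  have "((\<lambda>h. (b - h * q) - (a - h * p)) \<longlongrightarrow> (b - 0 * q) - (a - 0 * p)) (at_right 0)"
    by (intro tendsto_intros)
  from order_tendstoD(1)[OF this, of 0] assms show ?thesis by simp
qed

section \<open>Collapse of the superlevel sets\<close>

locale bump = transport +
  fixes M :: real
  assumes even0: "\<theta> 0 (- x) = \<theta> 0 x"
    and antimono0: "0 \<le> x \<Longrightarrow> x \<le> y \<Longrightarrow> \<theta> 0 y \<le> \<theta> 0 x"
    and nonneg0: "0 \<le> \<theta> 0 x"
    and decay0: "(\<theta> 0 \<longlongrightarrow> 0) at_infinity"
    and M: "\<theta> 0 0 = M" "0 < M"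
begin

lemma abs_antimono0: "\<bar>x\<bar> \<le> \<bar>y\<bar> \<Longrightarrow> \<theta> 0 y \<le> \<theta> 0 x"
  using antimono0[of "\<bar>x\<bar>" "\<bar>y\<bar>"] even0[of x] even0[of y] by (auto simp: abs_if split: if_splits)

lemma decay0_bound: assumes "0 < l" obtains N where "0 \<le> N" "\<And>x. N \<le> \<bar>x\<bar> \<Longrightarrow> \<theta> 0 x < l"
proof -
  have "eventually (\<lambda>x. dist (\<theta> 0 x) 0 < l) at_infinity" using tendstoD[OF decay0 assms] .
  then obtain b where b: "\<And>x. b \<le> \<bar>x\<bar> \<Longrightarrow> dist (\<theta> 0 x) 0 < l" unfolding eventually_at_infinity by auto
  have "\<theta> 0 x < l" if "\<bar>b\<bar> \<le> \<bar>x\<bar>" for x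
  proof -
    have "b \<le> \<bar>x\<bar>" using that by linarith
    from b[OF this] show ?thesis by (auto simp: dist_real_def)
  qed
  from that[OF abs_ge_zero[of b] this] show ?thesis .
qed

end

text \<open>The bound \<open>A\<close> is qualitative. The later results about variation, velocity
  at the origin and collapse are stated with constants free of \<open>A\<close>, so they survive
  when \<open>A\<close> is eliminated by continuation.\<close>

locale bump_bounded = bump +
  fixes A :: real
  assumes u0_bound: "t \<in> {0..T} \<Longrightarrow> \<bar>u t 0\<bar> \<le> A"
begin

lemma nonneg: assumes "t \<in> {0..T}" shows "0 \<le> \<theta> t x"
proof -
  obtain A' where "0 \<le> A'" "\<And>t x. t \<in> {0..T} \<Longrightarrow> \<bar>u t x\<bar> \<le> A' * (1 + \<bar>x\<bar>)"
    using velocity_linear_growth[OF u0_bound] by blast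
  from comparison[OF this, of "- 1" 0 0 t x] show ?thesis using assms nonneg0 by auto
qed

text \<open>Comparison outside an exponentially spreading region, with half the level as bound at
  time 0. As N is the same for all times, it provides the compactness of the sets of configurations
  considered below.\<close>

lemma decay:
  assumes l: "0 < l"
  obtains N where "0 \<le> N" "\<And>t x. t \<in> {0..T} \<Longrightarrow> l \<le> \<theta> t x \<Longrightarrow> \<bar>x\<bar> \<le> N"
proof -
  obtain A' where A': "0 \<le> A'" "\<And>t x. t \<in> {0..T} \<Longrightarrow> \<bar>u t x\<bar> \<le> A' * (1 + \<bar>x\<bar>)"
    using velocity_linear_growth[OF u0_bound] by blast
  obtain b where b: "0 \<le> b" "\<And>x. b \<le> \<bar>x\<bar> \<Longrightarrow> \<theta> 0 x < l / 2" using decay0_bound[of "l / 2"] l by auto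
  define N where "N = (1 + b) * exp ((A' + 1) * T)"
  have "\<bar>x\<bar> \<le> N" if t: "t \<in> {0..T}" and x: "l \<le> \<theta> t x" for t x
  proof (rule ccontr)
    assume "\<not> \<bar>x\<bar> \<le> N"
    moreover have "(1 + b) * exp ((A' + 1) * t) \<le> N"
      unfolding N_def using b t A' by (intro mult_left_mono) auto
    ultimately have far: "(1 + b) * exp ((A' + 1) * t) \<le> 1 + \<bar>x\<bar>" by linarith
    have "1 * \<theta> 0 y \<le> l / 2" if "1 + b \<le> 1 + \<bar>y\<bar>" for y using b(2)[of y] that by simp
    from comparison[OF A'(1) A'(2) _ _ this t far] b(1) have "1 * \<theta> t x \<le> l / 2" by simp
    then show False using x l by simp
  qed
  moreover have "0 \<le> N" unfolding N_def using b by auto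
  ultimately show ?thesis using that by blast
qed

text \<open>A near-maximum is followed forwards: the compact set of points with value at least M - e
  t has a latest time, and a short forward step goes beyond it unless that time is t1. The slope e
  admits the transport error of the step.\<close>

lemma persistence:
  assumes t1: "t1 \<in> {0..T}" and \<eta>: "0 < \<eta>"
  obtains x where "M - \<eta> \<le> \<theta> t1 x"
proof (cases "\<eta> < M")
  case False
  then show ?thesis using that[of 0] nonneg[OF t1, of 0] by auto
next
  case True
  then obtain N where N: "0 \<le> N" "\<And>t x. t \<in> {0..T} \<Longrightarrow> M - \<eta> \<le> \<theta> t x \<Longrightarrow> \<bar>x\<bar> \<le> N"
    using decay[of "M - \<eta>"] by auto
  define e where "e = \<eta> / (t1 + 1)"
  have e: "0 < e" "e * r \<le> \<eta>" if "r \<le> t1" for r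
    using that t1 \<eta> mult_left_mono[of r "t1 + 1" \<eta>] unfolding e_def by (auto simp: field_simps)
  define D :: "(real \<times> real) set" where "D = {0..t1} \<times> {- N..N}"
  define G where "G = {p \<in> D. M - e * fst p \<le> \<theta> (fst p) (snd p)}"
  have "compact G" unfolding G_def
  proof (intro compact_Collect_le continuous_intros)
    show "compact D" unfolding D_def by (intro compact_Times) auto
    show "continuous_on D (\<lambda>p. \<theta> (fst p) (snd p))"
      by (rule continuous_comp) (use t1 in \<open>auto simp: D_def intro!: continuous_intros\<close>)
  qed
  moreover have "(0, 0) \<in> G" unfolding G_def D_def using t1 N M by auto
  moreover have "continuous_on G fst" by (intro continuous_intros)
  ultimately obtain p where p: "p \<in> G" "\<And>q. q \<in> G \<Longrightarrow> fst q \<le> fst p"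
    using continuous_attains_sup[of G fst] by blast
  obtain r y where ry: "p = (r, y)" by (cases p)
  have r: "r \<in> {0..t1}" "M - e * r \<le> \<theta> r y" using p(1) unfolding G_def D_def ry by auto
  have "r = t1"
  proof (rule ccontr)
    assume "r \<noteq> t1"
    then have "r < t1" using r by auto
    then have "eventually (\<lambda>h. (0 < h \<and> h < t1 - r) \<and>
        \<bar>\<theta> (r + h) (y + h * u r y) - \<theta> r y\<bar> \<le> e * h) (at_right 0)"
      using r t1 e(1)[of r] by (intro eventually_conj eventually_at_right_0 shift_forward) auto
    then obtain h where h: "0 < h" "h < t1 - r" "\<bar>\<theta> (r + h) (y + h * u r y) - \<theta> r y\<bar> \<le> e * h"
      using ex_at_right_0 by blast
    have 1: "M - e * (r + h) \<le> \<theta> (r + h) (y + h * u r y)" using r(2) h(3) by (auto simp: algebra_simps)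
    moreover have "\<bar>y + h * u r y\<bar> \<le> N"
      by (rule N(2)[of "r + h"]) (use 1 h r t1 e(2)[of "r + h"] in auto)
    ultimately have "(r + h, y + h * u r y) \<in> G" unfolding G_def D_def using h r by auto
    from p(2)[OF this] show False using h ry by auto
  qed
  then show ?thesis using that[of y] r(2) e(2)[of t1] by auto
qed

text \<open>A triple with a strict dip in the middle can be traced back to time 0, where the even
  profile that decreases away from 0 has none. Together with \<open>decay\<close> this makes each
  superlevel set of a positive level a bounded interval.\<close>

lemma quasiconcave:
  assumes t: "t \<in> {0..T}" and x: "x1 \<le> x2" "x2 \<le> x3"
  shows "min (\<theta> t x1) (\<theta> t x3) \<le> \<theta> t x2"
proof (rule ccontr)
  define m where "m = min (\<theta> t x1) (\<theta> t x3)"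
  assume "\<not> min (\<theta> t x1) (\<theta> t x3) \<le> \<theta> t x2"
  then have m: "\<theta> t x2 < m" by (simp only: m_def not_le)
  define l where "l = (\<theta> t x2 + m) / 2"
  have l: "0 < l" "\<theta> t x2 < l" "l < m" using nonneg[OF t, of x2] m by (auto simp: l_def)
  \<comment> \<open>Going back by h, the outer thresholds drop and the middle one rises by \<eta> h,
    which absorbs the transport error. The extra \<eta> in the middle threshold keeps the points
    distinct at all times, including 0. The total \<eta> (1 + t) fits into m - l = l - \<theta> t
    x2.\<close>
  define \<eta> where "\<eta> = (m - l) / (1 + T)"
  have \<eta>: "0 < \<eta>" unfolding \<eta>_def using l T by auto
  have "\<eta> * t \<le> \<eta> * T" using \<eta> t by auto
  moreover have "\<eta> * (1 + T) = m - l" unfolding \<eta>_def using T by simp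
  then have "\<eta> + \<eta> * T = m - l" by (simp only: distrib_left mult_1_right)
  moreover have "m - l = l - \<theta> t x2" unfolding l_def by (simp add: field_simps)
  ultimately have tm: "l + \<eta> * t \<le> m" "\<theta> t x2 \<le> l - \<eta> - \<eta> * t" using \<eta> by linarith+
  obtain N where N: "0 \<le> N" "\<And>t x. t \<in> {0..T} \<Longrightarrow> l \<le> \<theta> t x \<Longrightarrow> \<bar>x\<bar> \<le> N"
    using decay[OF l(1)] by blast
  define D :: "(real \<times> real \<times> real \<times> real) set" where "D = {0..T} \<times> {- N..N} \<times> {- N..N} \<times> {- N..N}"
  define Bad where "Bad = {p \<in> {p \<in> {p \<in> {p \<in> {p \<in> D. fst (snd p) \<le> fst (snd (snd p))}.
      fst (snd (snd p)) \<le> snd (snd (snd p))}.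
      l + \<eta> * fst p \<le> \<theta> (fst p) (fst (snd p))}.
      l + \<eta> * fst p \<le> \<theta> (fst p) (snd (snd (snd p)))}.
      \<theta> (fst p) (fst (snd (snd p))) \<le> l - \<eta> - \<eta> * fst p}"
  have Bad_iff: "(r, y1, y2, y3) \<in> Bad \<longleftrightarrow> r \<in> {0..T} \<and> y1 \<le> y2 \<and> y2 \<le> y3 \<and> l + \<eta> * r \<le> \<theta> r y1 \<and> l + \<eta> * r \<le> \<theta> r y3
      \<and> \<theta> r y2 \<le> l - \<eta> - \<eta> * r" (is "?L \<longleftrightarrow> ?R") for r y1 y2 y3
  proof
    show ?R if ?L using that unfolding Bad_def D_def by simp
    show ?L if ?R
    proof -
      have "0 \<le> \<eta> * r" using \<eta> that by auto
      then have "\<bar>y1\<bar> \<le> N" "\<bar>y3\<bar> \<le> N" using N(2)[of r y1] N(2)[of r y3] that by auto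
      then have "- N \<le> y1" "y1 \<le> N" "- N \<le> y3" "y3 \<le> N" by linarith+
      moreover have "- N \<le> y2" "y2 \<le> N" using calculation that by linarith+
      ultimately show ?thesis using that unfolding Bad_def D_def by simp
    qed
  qed
  have cont: "continuous_on D (\<lambda>p. \<theta> (fst p) (f p))" if "continuous_on D f" for f
    by (rule continuous_comp) (use that in \<open>auto simp: D_def intro!: continuous_intros\<close>)
  have "compact D" unfolding D_def by (intro compact_Times) auto
  have cc: "compact {p \<in> K. f p \<le> g p}" if "compact K" "K \<subseteq> D" "continuous_on D f" "continuous_on D g"
    for K and f g :: "real \<times> real \<times> real \<times> real \<Rightarrow> real"
    using that by (intro compact_Collect_le) (auto intro: continuous_on_subset)
  have "compact Bad" unfolding Bad_def
    by (intro cc \<open>compact D\<close> cont continuous_intros) auto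
  moreover have "\<exists>q\<in>Bad. fst q < fst p" if "p \<in> Bad" for p
  proof -
    obtain r y1 y2 y3 where p: "p = (r, y1, y2, y3)" by (cases p)
    have r: "r \<in> {0..T}" "y1 \<le> y2" "y2 \<le> y3" "l + \<eta> * r \<le> \<theta> r y1" "l + \<eta> * r \<le> \<theta> r y3" "\<theta> r y2 \<le> l - \<eta> - \<eta> * r"
      using that unfolding p Bad_iff by auto
    have r0: "0 < r"
    proof (rule ccontr)
      assume "\<not> 0 < r"
      then have 0: "r = 0" using r by auto
      have "\<bar>y2\<bar> \<le> \<bar>y1\<bar> \<or> \<bar>y2\<bar> \<le> \<bar>y3\<bar>" using r(2,3) by linarith
      then show False using abs_antimono0[of y2 y1] abs_antimono0[of y2 y3] r(4-6) \<eta> unfolding 0 by auto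
    qed
    have "0 \<le> \<eta> * r" using \<eta> r by auto
    then have "y1 \<noteq> y2" "y2 \<noteq> y3" using r(4-6) \<eta> by auto
    then have ne: "y1 < y2" "y2 < y3" using r(2,3) by auto
    have "eventually (\<lambda>h. (0 < h \<and> h < r) \<and> y1 - h * u r y1 < y2 - h * u r y2 \<and> y2 - h * u r y2 < y3 - h * u r y3 \<and>
        \<bar>\<theta> (r - h) (y1 - h * u r y1) - \<theta> r y1\<bar> \<le> \<eta> * h \<and>
        \<bar>\<theta> (r - h) (y2 - h * u r y2) - \<theta> r y2\<bar> \<le> \<eta> * h \<and>
        \<bar>\<theta> (r - h) (y3 - h * u r y3) - \<theta> r y3\<bar> \<le> \<eta> * h) (at_right 0)"
      using r0 r(1) \<eta> by (intro eventually_conj eventually_at_right_0 shift_back eventually_shift_less ne) auto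
    then obtain h where h: "0 < h" "h < r" "y1 - h * u r y1 < y2 - h * u r y2" "y2 - h * u r y2 < y3 - h * u r y3"
        "\<bar>\<theta> (r - h) (y1 - h * u r y1) - \<theta> r y1\<bar> \<le> \<eta> * h"
        "\<bar>\<theta> (r - h) (y2 - h * u r y2) - \<theta> r y2\<bar> \<le> \<eta> * h"
        "\<bar>\<theta> (r - h) (y3 - h * u r y3) - \<theta> r y3\<bar> \<le> \<eta> * h"
      using ex_at_right_0 by blast
    have "(r - h, y1 - h * u r y1, y2 - h * u r y2, y3 - h * u r y3) \<in> Bad"
      unfolding Bad_iff right_diff_distrib using h r by (auto simp: abs_le_iff)
    then show ?thesis using h(1) p by force
  qed
  ultimately have "Bad = {}" by (rule compact_no_earliest)
  then have "(t, x1, x2, x3) \<notin> Bad" by simp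
  moreover have "(t, x1, x2, x3) \<in> Bad" unfolding Bad_iff using t x tm by (simp add: m_def)
  ultimately show False by simp
qed

text \<open>By quasiconcavity \<theta> increases up to a maximum point m of [a, b] and decreases
  afterwards, so its variation is 2 \<theta>(m) - \<theta>(a) - \<theta>(b).\<close>

lemma total_variation:
  assumes t: "t \<in> {0..T}" and ab: "a \<le> b"
  shows "integral {a..b} (\<lambda>x. \<bar>\<theta>x t x\<bar>) \<le> 4 * C"
proof -
  have "\<exists>m\<in>{a..b}. \<forall>y\<in>{a..b}. \<theta> t y \<le> \<theta> t m"
    using ab continuous_x[OF t] by (intro continuous_attains_sup) auto
  then obtain m where m: "m \<in> {a..b}" "\<And>y. y \<in> {a..b} \<Longrightarrow> \<theta> t y \<le> \<theta> t m" by blast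
  have inc: "\<theta> t y \<le> \<theta> t z" if "a \<le> y" "y \<le> z" "z \<le> m" for y z
    using quasiconcave[OF t that(2,3)] m(2)[of y] m(1) that by auto
  have dec: "\<theta> t z \<le> \<theta> t y" if "m \<le> y" "y \<le> z" "z \<le> b" for y z
    using quasiconcave[OF t that(1,2)] m(2)[of z] m(1) that by auto
  have ftc: "(\<theta>x t has_integral \<theta> t d - \<theta> t c) {c..d}" if "c \<le> d" for c d
    by (rule fundamental_theorem_of_calculus[OF that])
      (use deriv_x[OF t] in \<open>auto simp: has_real_derivative_iff_has_vector_derivative intro: has_vector_derivative_at_within\<close>)
  have lim: "((\<lambda>h. (\<theta> t (y + h) - \<theta> t y) / h) \<longlongrightarrow> \<theta>x t y) (at 0)" for y
    using deriv_x[OF t, of y] unfolding DERIV_def .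
  have pos: "0 \<le> \<theta>x t y" if "y \<in> {a<..<m}" for y
  proof (rule tendsto_lowerbound)
    show "((\<lambda>h. (\<theta> t (y + h) - \<theta> t y) / h) \<longlongrightarrow> \<theta>x t y) (at_right 0)"
      using lim[of y] by (rule tendsto_mono[rotated]) (simp add: at_le)
    show "eventually (\<lambda>h. 0 \<le> (\<theta> t (y + h) - \<theta> t y) / h) (at_right 0)"
      using eventually_at_right_0[of "m - y"] that inc[of y]
      by (auto elim!: eventually_mono intro!: divide_nonneg_pos)
  qed auto
  have neg: "\<theta>x t y \<le> 0" if "y \<in> {m<..<b}" for y
  proof (rule tendsto_upperbound)
    show "((\<lambda>h. (\<theta> t (y + h) - \<theta> t y) / h) \<longlongrightarrow> \<theta>x t y) (at_right 0)"
      using lim[of y] by (rule tendsto_mono[rotated]) (simp add: at_le)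
    show "eventually (\<lambda>h. (\<theta> t (y + h) - \<theta> t y) / h \<le> 0) (at_right 0)"
      using eventually_at_right_0[of "b - y"] that dec[of y]
      by (auto elim!: eventually_mono intro!: divide_nonpos_pos)
  qed auto
  have "((\<lambda>x. \<bar>\<theta>x t x\<bar>) has_integral \<theta> t m - \<theta> t a) {a..m}"
    using ftc[of a m] m(1) pos
    by (intro has_integral_spike_finite[where S = "{a, m}", OF _ _ ftc[of a m]]) auto
  moreover have "((\<lambda>x. \<bar>\<theta>x t x\<bar>) has_integral - (\<theta> t b - \<theta> t m)) {m..b}"
    using m(1) neg
    by (intro has_integral_spike_finite[where S = "{m, b}", OF _ _ has_integral_neg[OF ftc[of m b]]]) auto
  ultimately have "((\<lambda>x. \<bar>\<theta>x t x\<bar>) has_integral \<theta> t m - \<theta> t a + - (\<theta> t b - \<theta> t m)) {a..b}"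
    using m(1) by (intro has_integral_combine) auto
  then have "integral {a..b} (\<lambda>x. \<bar>\<theta>x t x\<bar>) = 2 * \<theta> t m - \<theta> t a - \<theta> t b" by (simp add: integral_unique)
  then show ?thesis using bound(1)[OF t, of m] bound(1)[OF t, of a] bound(1)[OF t, of b] by auto
qed

end

text \<open>Normalised so that the condition "speed of approach times tb - ta is at least W / 2" in
  \<open>width_halving\<close> reads W^(1+s) \<le>
  \<open>rate s * (lb - la) * (tb - ta)\<close>.\<close>

definition rate :: "real \<Rightarrow> real" where "rate s = kappa s * (1 + s) * 3 powr (- 2 - s) / 2"

section \<open>Shrinking of the superlevel sets and the contradiction\<close>

context bump_bounded
begin

text \<open>Where a superlevel set is at least as wide as \<phi>, its ends approach with speed at
  least g, while \<phi> decreases with speed at most g. Hence a violation could be traced back to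
  time ta. Passing from level l0 to l1 > l0 leaves room for the transport error.\<close>

lemma width_barrier:
  assumes l: "0 < l0" "l0 < l1" and ta: "0 \<le> ta" "ta \<le> T"
    and \<phi>: "continuous_on {ta..T} \<phi>" "\<And>t. t \<in> {ta..T} \<Longrightarrow> 0 < \<phi> t"
      "\<And>r t. ta \<le> r \<Longrightarrow> r < t \<Longrightarrow> t \<le> T \<Longrightarrow> \<phi> r \<le> \<phi> t + g * (t - r)"
    and init: "\<And>x z. l0 \<le> \<theta> ta x \<Longrightarrow> l0 \<le> \<theta> ta z \<Longrightarrow> z - x < \<phi> ta"
    and gain: "\<And>t x z l. t \<in> {ta..T} \<Longrightarrow> l0 \<le> l \<Longrightarrow> \<theta> t x = l \<Longrightarrow> \<theta> t z = l \<Longrightarrow> x < z \<Longrightarrow> \<phi> t \<le> z - x \<Longrightarrow>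
       (\<And>y. x \<le> y \<Longrightarrow> y \<le> z \<Longrightarrow> l \<le> \<theta> t y) \<Longrightarrow> (\<And>y. y \<le> x \<Longrightarrow> \<theta> t y \<le> l) \<Longrightarrow>
       (\<And>y. z \<le> y \<Longrightarrow> \<theta> t y \<le> l) \<Longrightarrow> u t z - u t x \<le> - g"
    and t: "t \<in> {ta..T}" and xz: "l1 \<le> \<theta> t x" "l1 \<le> \<theta> t z"
  shows "z - x < \<phi> t"
proof (rule ccontr)
  assume contra: "\<not> z - x < \<phi> t"
  define \<eta> where "\<eta> = (l1 - l0) / (T - ta + 1)"
  have \<eta>: "0 < \<eta>" unfolding \<eta>_def using l ta by auto
  \<comment> \<open>The level rises with slope \<eta> and stays between l0 and l1. A backward step
    lowers it by the admissible error \<eta> h.\<close>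
  define L where "L = (\<lambda>r. l0 + \<eta> * (r - ta))"
  have L0: "l0 \<le> L r" if "ta \<le> r" for r unfolding L_def using that \<eta> by auto
  have L1: "L r \<le> l1" if "r \<le> T" for r
  proof -
    have "\<eta> * (r - ta) \<le> \<eta> * (T - ta + 1)" using \<eta> that by (intro mult_left_mono) auto
    also have "\<dots> = l1 - l0" unfolding \<eta>_def using ta by simp
    finally show ?thesis unfolding L_def by simp
  qed
  have Tta: "{ta..T} \<subseteq> {0..T}" using ta by auto
  obtain N where N: "0 \<le> N" "\<And>t x. t \<in> {0..T} \<Longrightarrow> l0 \<le> \<theta> t x \<Longrightarrow> \<bar>x\<bar> \<le> N"
    using decay[OF l(1)] by blast
  have NL: "\<bar>y\<bar> \<le> N" if "r \<in> {ta..T}" "L r \<le> \<theta> r y" for r y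
    using N(2)[of r y] L0[of r] that Tta by auto
  define D :: "(real \<times> real \<times> real) set" where "D = {ta..T} \<times> {- N..N} \<times> {- N..N}"
  define Bad where "Bad = {p \<in> {p \<in> {p \<in> D. L (fst p) \<le> \<theta> (fst p) (fst (snd p))}.
      L (fst p) \<le> \<theta> (fst p) (snd (snd p))}. \<phi> (fst p) \<le> snd (snd p) - fst (snd p)}"
  have Bad_iff: "(r, y1, y2) \<in> Bad \<longleftrightarrow> r \<in> {ta..T} \<and> L r \<le> \<theta> r y1 \<and> L r \<le> \<theta> r y2 \<and> \<phi> r \<le> y2 - y1" (is "?P \<longleftrightarrow> ?Q")
    for r y1 y2
  proof
    show ?Q if ?P using that unfolding Bad_def D_def by simp
    show ?P if ?Q
    proof -
      have "\<bar>y1\<bar> \<le> N" "\<bar>y2\<bar> \<le> N" using NL[of r y1] NL[of r y2] that by auto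
      then have "- N \<le> y1" "y1 \<le> N" "- N \<le> y2" "y2 \<le> N" by linarith+
      then show ?thesis using that unfolding Bad_def D_def by simp
    qed
  qed
  have cont: "continuous_on D (\<lambda>p. \<theta> (fst p) (f p))" if "continuous_on D f" for f
    by (rule continuous_comp) (use that Tta in \<open>auto simp: D_def intro!: continuous_intros\<close>)
  have cphi: "continuous_on D (\<lambda>p. \<phi> (fst p))"
    by (rule continuous_on_compose2[OF \<phi>(1)]) (auto simp: D_def intro!: continuous_intros)
  have "compact D" unfolding D_def by (intro compact_Times) auto
  have cc: "compact {p \<in> K. f p \<le> g p}" if "compact K" "K \<subseteq> D" "continuous_on D f" "continuous_on D g"
    for K and f g :: "real \<times> real \<times> real \<Rightarrow> real"
    using that by (intro compact_Collect_le) (auto intro: continuous_on_subset)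
  have "compact Bad" unfolding Bad_def L_def
    by (intro cc \<open>compact D\<close> cont cphi continuous_intros) auto
  moreover have "\<exists>q\<in>Bad. fst q < fst p" if "p \<in> Bad" for p
  proof -
    obtain r y1 y2 where p: "p = (r, y1, y2)" by (cases p)
    have r: "r \<in> {ta..T}" "L r \<le> \<theta> r y1" "L r \<le> \<theta> r y2" "\<phi> r \<le> y2 - y1"
      using that unfolding p Bad_iff by auto
    have rT: "r \<in> {0..T}" using r(1) Tta by auto
    have r0: "ta < r"
    proof (rule ccontr)
      assume "\<not> ta < r"
      then have "r = ta" using r by auto
      then show False using init[of y1 y2] r(2-4) by (auto simp: L_def)
    qed
    \<comment> \<open>The hypothesis on the velocities concerns the two ends of a superlevel set.
      The given pair is therefore replaced by the extreme points of S, which are at least as far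
      apart.\<close>
    define S where "S = {y \<in> {- N..N}. L r \<le> \<theta> r y}"
    have "compact S" unfolding S_def
      by (rule compact_Collect_le) (auto intro!: continuous_intros continuous_x[OF rT])
    have inS: "y \<in> S \<longleftrightarrow> L r \<le> \<theta> r y" for y
      using NL[OF r(1), of y] unfolding S_def by (auto simp: abs_le_iff)
    have S: "y1 \<in> S" "y2 \<in> S" using r inS by auto
    have cid: "continuous_on S (\<lambda>y. y)" by (rule continuous_on_id)
    obtain a where a: "a \<in> S" "\<And>y. y \<in> S \<Longrightarrow> a \<le> y"
      using continuous_attains_inf[OF \<open>compact S\<close> _ cid] S by blast
    obtain b where b: "b \<in> S" "\<And>y. y \<in> S \<Longrightarrow> y \<le> b"
      using continuous_attains_sup[OF \<open>compact S\<close> _ cid] S by blast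
    have ct: "isCont (\<theta> r) y" for y using deriv_x[OF rT] DERIV_isCont by blast
    have out: "\<theta> r y < L r" if "y < a \<or> b < y" for y
      using a(2)[of y] b(2)[of y] inS[of y] that by (auto simp: not_le)
    have "\<theta> r a \<le> L r"
    proof (rule tendsto_upperbound)
      show "(\<theta> r \<longlongrightarrow> \<theta> r a) (at_left a)"
        using ct[of a] by (auto simp: isCont_def intro: tendsto_mono[OF at_le])
      show "eventually (\<lambda>y. \<theta> r y \<le> L r) (at_left a)"
        using out by (auto simp: eventually_at_filter intro!: always_eventually less_imp_le)
    qed auto
    then have ea: "\<theta> r a = L r" using a inS by (auto intro: antisym)
    have "\<theta> r b \<le> L r"
    proof (rule tendsto_upperbound)
      show "(\<theta> r \<longlongrightarrow> \<theta> r b) (at_right b)"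
        using ct[of b] by (auto simp: isCont_def intro: tendsto_mono[OF at_le])
      show "eventually (\<lambda>y. \<theta> r y \<le> L r) (at_right b)"
        using out by (auto simp: eventually_at_filter intro!: always_eventually less_imp_le)
    qed auto
    then have eb: "\<theta> r b = L r" using b inS by (auto intro: antisym)
    have w: "\<phi> r \<le> b - a" using a(2)[OF S(1)] b(2)[OF S(2)] r(4) by linarith
    have g: "u r b - u r a \<le> - g"
    proof (rule gain[OF r(1) L0 ea eb _ w])
      show "ta \<le> r" using r by auto
      show "a < b" using w \<phi>(2)[OF r(1)] by linarith
      show "L r \<le> \<theta> r y" if "a \<le> y" "y \<le> b" for y
        using quasiconcave[OF rT that] ea eb by simp
      show "\<theta> r y \<le> L r" if "y \<le> a" for y using out[of y] ea that by (cases "y = a") auto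
      show "\<theta> r y \<le> L r" if "b \<le> y" for y using out[of y] eb that by (cases "y = b") auto
    qed
    have "eventually (\<lambda>h. (0 < h \<and> h < r - ta) \<and>
        \<bar>\<theta> (r - h) (a - h * u r a) - \<theta> r a\<bar> \<le> \<eta> * h \<and>
        \<bar>\<theta> (r - h) (b - h * u r b) - \<theta> r b\<bar> \<le> \<eta> * h) (at_right 0)"
      using r0 r(1) ta \<eta> by (intro eventually_conj eventually_at_right_0 shift_back) auto
    then obtain h where h: "0 < h" "h < r - ta"
        "\<bar>\<theta> (r - h) (a - h * u r a) - \<theta> r a\<bar> \<le> \<eta> * h"
        "\<bar>\<theta> (r - h) (b - h * u r b) - \<theta> r b\<bar> \<le> \<eta> * h"
      using ex_at_right_0 by blast
    have Lh: "L (r - h) = L r - \<eta> * h" unfolding L_def by (simp add: algebra_simps)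
    have "\<phi> (r - h) \<le> \<phi> r + g * h" using \<phi>(3)[of "r - h" r] h r by auto
    moreover have "h * (u r b - u r a) \<le> h * - g" using g h by (intro mult_left_mono) auto
    ultimately have "\<phi> (r - h) \<le> (b - h * u r b) - (a - h * u r a)" using w by (simp add: algebra_simps)
    then have "(r - h, a - h * u r a, b - h * u r b) \<in> Bad"
      unfolding Bad_iff Lh using h r ea eb by (auto simp: abs_le_iff)
    then show ?thesis using h(1) p by force
  qed
  ultimately have "Bad = {}" by (rule compact_no_earliest)
  then have "(t, x, z) \<notin> Bad" by simp
  moreover have "(t, x, z) \<in> Bad" unfolding Bad_iff using t xz L1[of t] contra by auto
  ultimately show False by simp
qed

text \<open>The ends of a superlevel set never separate, by the estimate for its ends with \<Delta>
  = 0; so g = 0 and \<phi> is constant. The summand 1 makes \<phi> positive even if b = 0.\<close>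

lemma width_initial:
  assumes l: "0 < l0" "l0 < l1" and b: "0 \<le> b" "\<And>x. b \<le> \<bar>x\<bar> \<Longrightarrow> \<theta> 0 x < l0"
    and t: "t \<in> {0..T}" and xz: "l1 \<le> \<theta> t x" "l1 \<le> \<theta> t z"
  shows "z - x < 2 * b + 1"
proof (rule width_barrier[OF l, where ta = 0 and g = 0 and \<phi> = "\<lambda>_. 2 * b + 1"])
  show "z - x < 2 * b + 1" if "l0 \<le> \<theta> 0 x" "l0 \<le> \<theta> 0 z" for x z
    using b(2)[of x] b(2)[of z] that by linarith
next
  fix t x z l
  assume h: "t \<in> {0..T}" "\<theta> t x = l" "\<theta> t z = l" "x < z" "\<And>y. x \<le> y \<Longrightarrow> y \<le> z \<Longrightarrow> l \<le> \<theta> t y"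
    "\<And>y. y \<le> x \<Longrightarrow> \<theta> t y \<le> l" "\<And>y. z \<le> y \<Longrightarrow> \<theta> t y \<le> l"
  have "u t z - u t x \<le> - kappa s * (0 * (z - x) * ((1 + s) * (z - x) * (3 * (z - x)) powr (- 2 - s)))"
    by (rule Lambda_H_superlevel_ends[OF s continuous_x[OF h(1)] bound(1)[OF h(1)] vel[OF h(1)] vel[OF h(1)] refl _ order.refl])
      (use h in auto)
  then show "u t z - u t x \<le> - 0" by simp
qed (use assms T in auto)

lemma width_halving:
  assumes l: "0 < la" "la < lb" and ta: "0 \<le> ta" "ta \<le> tb" "tb \<le> T" and W: "0 < W"
    and width: "\<And>t x z. t \<in> {ta..T} \<Longrightarrow> la \<le> \<theta> t x \<Longrightarrow> la \<le> \<theta> t z \<Longrightarrow> z - x < W"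
    and time: "W powr (1 + s) \<le> rate s * (lb - la) * (tb - ta)"
    and t: "t \<in> {tb..T}" and xz: "lb \<le> \<theta> t x" "lb \<le> \<theta> t z"
  shows "z - x < W / 2"
proof -
  \<comment> \<open>Half of the gap between the levels is the drop \<Delta> that drives the
    contraction, the other half is spent on the transport error in
    \<open>width_barrier\<close>.\<close>
  define l0 where "l0 = (la + lb) / 2"
  define \<Delta> where "\<Delta> = (lb - la) / 2"
  \<comment> \<open>The speed of approach that is guaranteed while the width lies between W / 2 and
    W.\<close>
  define g where "g = kappa s * (\<Delta> * W * ((1 + s) * (W / 2) * (3 * W) powr (- 2 - s)))"
  have \<Delta>: "0 < \<Delta>" "l0 - \<Delta> = la" unfolding \<Delta>_def l0_def using l by (auto simp: field_simps)
  have g: "0 \<le> g" unfolding g_def using kappa_pos[OF s] \<Delta> W s by auto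
  have "W / 2 \<le> g * (tb - ta)"
  proof -
    have "W * (W * W powr (- 2 - s)) = W powr (1 + (1 + (- 2 - s)))"
      using W by (simp only: powr_mult_base less_imp_le)
    then have "W powr (- s) = W * W * W powr (- 2 - s)" by simp
    then have "g = rate s * (lb - la) * W powr (- s) / 2"
      unfolding g_def rate_def \<Delta>_def using W by (simp add: powr_mult field_simps)
    then have "g * (tb - ta) = (rate s * (lb - la) * (tb - ta)) * W powr (- s) / 2" by simp
    also have "\<dots> \<ge> W powr (1 + s) * W powr (- s) / 2"
      using time by (intro divide_right_mono mult_right_mono) auto
    also have "W powr (1 + s) * W powr (- s) = W" using W by (simp flip: powr_add)
    finally show ?thesis .
  qed
  \<comment> \<open>Cut off at W / 2 because the speed g is guaranteed for widths from W / 2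
    on.\<close>
  define \<phi> where "\<phi> = (\<lambda>r. max (W - g * (r - ta)) (W / 2))"
  have "z - x < \<phi> t"
  proof (rule width_barrier[where ?l0.0 = l0 and ?l1.0 = lb and ta = ta and g = g and \<phi> = \<phi> and t = t])
    show "continuous_on {ta..T} \<phi>" unfolding \<phi>_def by (intro continuous_intros)
    show "0 < \<phi> t" for t unfolding \<phi>_def using W by auto
    show "\<phi> r \<le> \<phi> t + g * (t - r)" if "r < t" for r t
    proof -
      have "0 \<le> g * (t - r)" using g that by auto
      moreover have "g * (t - r) = g * (t - ta) - g * (r - ta)" by (simp add: algebra_simps)
      moreover have "W - g * (t - ta) \<le> \<phi> t" "W / 2 \<le> \<phi> t" unfolding \<phi>_def by auto
      ultimately have "W - g * (r - ta) \<le> \<phi> t + g * (t - r)" "W / 2 \<le> \<phi> t + g * (t - r)" by linarith+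
      moreover have "\<phi> r = max (W - g * (r - ta)) (W / 2)" unfolding \<phi>_def ..
      ultimately show ?thesis by (simp only: max.bounded_iff)
    qed
    show "z - x < \<phi> ta" if "l0 \<le> \<theta> ta x" "l0 \<le> \<theta> ta z" for x z
      using width[of ta x z] that \<Delta> ta unfolding \<phi>_def by auto
  next
    fix t x z l
    assume h: "t \<in> {ta..T}" "l0 \<le> l" "\<theta> t x = l" "\<theta> t z = l" "x < z" "\<phi> t \<le> z - x"
      "\<And>y. x \<le> y \<Longrightarrow> y \<le> z \<Longrightarrow> l \<le> \<theta> t y" "\<And>y. y \<le> x \<Longrightarrow> \<theta> t y \<le> l" "\<And>y. z \<le> y \<Longrightarrow> \<theta> t y \<le> l"
    have t: "t \<in> {0..T}" using h(1) ta by auto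
    have w: "W / 2 \<le> z - x" using h(6) unfolding \<phi>_def by auto
    have wW: "z - x < W" using width[OF h(1), of x z] h \<Delta> by auto
    \<comment> \<open>The superlevel set of la has width below W, so beyond z + W the values lie
      below la, hence below l - \<Delta>.\<close>
    have far: "\<theta> t y \<le> l - \<Delta>" if "z + W \<le> y" for y
    proof (rule ccontr)
      assume "\<not> \<theta> t y \<le> l - \<Delta>"
      then have "la \<le> \<theta> t y" using h(2) \<Delta> by auto
      then have "y - x < W" using width[OF h(1), of x y] h(2,3) \<Delta> by auto
      then show False using that h(5) by auto
    qed
    have "u t z - u t x \<le> - kappa s * (\<Delta> * W * ((1 + s) * (z - x) * (3 * W) powr (- 2 - s)))"
      by (rule Lambda_H_superlevel_ends[OF s continuous_x[OF t] bound(1)[OF t] vel[OF t] vel[OF t] refl])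
        (use h wW \<Delta> far in auto)
    also have "\<dots> \<le> - g"
    proof -
      have "g \<le> kappa s * (\<Delta> * W * ((1 + s) * (z - x) * (3 * W) powr (- 2 - s)))"
        unfolding g_def using kappa_pos[OF s] \<Delta> W s w by (intro mult_left_mono mult_right_mono) auto
      then show ?thesis by simp
    qed
    finally show "u t z - u t x \<le> - g" .
  qed (use l ta t xz in \<open>auto simp: l0_def\<close>)
  moreover have "\<phi> t = W / 2"
  proof -
    have "g * (tb - ta) \<le> g * (t - ta)" using g t by (intro mult_left_mono) auto
    then show ?thesis unfolding \<phi>_def using \<open>W / 2 \<le> g * (tb - ta)\<close> by auto
  qed
  ultimately show ?thesis by simp
qed

text \<open>Halving the width W 2^(-n) needs (level gap) times (time gap) of order W^(1+s) q^(2n),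
  as q^2 = 2^(-(1+s)). One factor q^n is given to each gap, so levels and times are both convergent
  geometric sequences and all scales are reached by time T. The two increments produce the factor (1
  - q)^2.\<close>

lemma blow_up:
  defines "q \<equiv> (1 / 2) powr ((1 + s) / 2)"
  assumes b: "0 \<le> b" "\<And>x. b \<le> \<bar>x\<bar> \<Longrightarrow> \<theta> 0 x < M / 8"
    and long: "(2 * b + 1) powr (1 + s) \<le> rate s * (M / 4) * (1 - q)\<^sup>2 * T"
  shows False
proof -
  have q: "0 < q" "q < 1" unfolding q_def using s powr_less_mono2[of "(1 + s) / 2" "1 / 2" 1] by auto
  define W where "W = 2 * b + 1"
  have W: "0 < W" using b by (simp add: W_def)
  \<comment> \<open>Increases from M / 4 towards M / 2. It starts above M / 8, the level whose
    initial width is controlled by b, as \<open>width_initial\<close> demands.\<close>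
  define l where "l = (\<lambda>n. M / 2 - M / 4 * q ^ n)"
  define \<tau> where "\<tau> = (\<lambda>n. T * (1 - q ^ n))"
  have qn: "0 < q ^ n" "q ^ n \<le> 1" "q ^ Suc n < q ^ n" for n
    using q by (auto simp: power_le_one)
  have Wp: "(W * (1 / 2) ^ n) powr (1 + s) = W powr (1 + s) * (q ^ n * q ^ n)" for n
  proof (induction n)
    case (Suc n)
    have "(W * (1 / 2) ^ Suc n) powr (1 + s) = ((W * (1 / 2) ^ n) * (1 / 2)) powr (1 + s)"
      by (simp add: algebra_simps)
    also have "\<dots> = (W * (1 / 2) ^ n) powr (1 + s) * (1 / 2) powr (1 + s)"
      by (rule powr_mult)
    also have "(1 / 2) powr (1 + s) = q * q" unfolding q_def by (simp flip: powr_add)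
    finally show ?case unfolding Suc by simp
  qed simp
  have main: "\<forall>t\<in>{\<tau> n..T}. \<forall>x z. l n \<le> \<theta> t x \<longrightarrow> l n \<le> \<theta> t z \<longrightarrow> z - x < W * (1 / 2) ^ n" for n
  proof (induction n)
    case 0
    show ?case unfolding \<tau>_def l_def W_def
      using width_initial[of "M / 8" "M / 4" b] b M by auto
  next
    case (Suc n)
    have "z - x < W * (1 / 2) ^ n / 2"
      if "t \<in> {\<tau> (Suc n)..T}" "l (Suc n) \<le> \<theta> t x" "l (Suc n) \<le> \<theta> t z" for t x z
    proof (rule width_halving[where la = "l n" and lb = "l (Suc n)" and ta = "\<tau> n" and tb = "\<tau> (Suc n)" and t = t])
      have "M / 4 * q ^ n \<le> M / 4 * 1" using qn[of n] M by (intro mult_left_mono) auto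
      then show "0 < l n" using M unfolding l_def by linarith
      have "M / 4 * q ^ Suc n < M / 4 * q ^ n" using qn[of n] M by (intro mult_strict_left_mono) auto
      then show "l n < l (Suc n)" unfolding l_def by linarith
      show "0 \<le> \<tau> n" "\<tau> (Suc n) \<le> T" unfolding \<tau>_def using T qn[of n] qn[of "Suc n"]
        by (auto simp: mult_left_le)
      show "\<tau> n \<le> \<tau> (Suc n)" unfolding \<tau>_def using T qn[of n] by (intro mult_left_mono) auto
      show "0 < W * (1 / 2) ^ n" using W by auto
      show "(W * (1 / 2) ^ n) powr (1 + s) \<le> rate s * (l (Suc n) - l n) * (\<tau> (Suc n) - \<tau> n)"
      proof -
        have "rate s * (l (Suc n) - l n) * (\<tau> (Suc n) - \<tau> n) = (rate s * (M / 4) * (1 - q)\<^sup>2 * T) * (q ^ n * q ^ n)"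
        proof -
          have "l (Suc n) - l n = M / 4 * ((1 - q) * q ^ n)" "\<tau> (Suc n) - \<tau> n = T * ((1 - q) * q ^ n)"
            unfolding l_def \<tau>_def by (simp_all add: algebra_simps)
          then show ?thesis by (simp add: power2_eq_square)
        qed
        also have "\<dots> \<ge> W powr (1 + s) * (q ^ n * q ^ n)"
          using long qn(1)[of n] unfolding W_def by (intro mult_right_mono) auto
        finally show ?thesis unfolding Wp .
      qed
      show "z - x < W * (1 / 2) ^ n" if "t \<in> {\<tau> n..T}" "l n \<le> \<theta> t x" "l n \<le> \<theta> t z" for t x z
        using Suc that by blast
    qed (fact that)+
    then show ?case by auto
  qed
  obtain x where x: "M - M / 4 \<le> \<theta> T x" using persistence[of T "M / 4"] T M by auto
  \<comment> \<open>Over this distance from a point of height at least 3 M / 4 the Lipschitz bound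
    loses at most M / 4, so \<theta> stays above all levels \<open>l n\<close>.\<close>
  define \<delta> where "\<delta> = M / 4 / (C + 1)"
  have \<delta>: "0 < \<delta>" unfolding \<delta>_def using M C_nonneg by auto
  have "C * \<delta> \<le> (C + 1) * \<delta>" using \<delta> by auto
  also have "\<dots> = M / 4"
  proof -
    have "C + 1 \<noteq> 0" using C_nonneg by linarith
    from iffD1[OF nonzero_eq_divide_eq[OF this] \<delta>_def] show ?thesis by (subst mult.commute)
  qed
  finally have "C * \<delta> \<le> M / 4" .
  then have z: "M / 2 \<le> \<theta> T (x + \<delta>)" using lipschitz[of T "x + \<delta>" x] T x \<delta> by auto
  have ln: "l n \<le> M / 2" for n unfolding l_def using M qn[of n] by auto
  have "\<delta> \<le> W * (1 / 2) ^ n" for n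
  proof -
    have "T \<in> {\<tau> n..T}" unfolding \<tau>_def using T qn[of n] by (auto simp: mult_left_le)
    moreover have "l n \<le> \<theta> T x" "l n \<le> \<theta> T (x + \<delta>)" using ln[of n] x z M by linarith+
    ultimately have "x + \<delta> - x < W * (1 / 2) ^ n" using main[of n] by blast
    then show ?thesis by simp
  qed
  moreover have "(\<lambda>n. W * (1 / 2) ^ n) \<longlonglongrightarrow> W * 0" by (intro tendsto_intros) auto
  ultimately have "\<delta> \<le> W * 0" by (intro LIMSEQ_le_const) auto
  then show False using \<delta> by simp
qed

end

section \<open>The velocity at the origin for s > -1/2\<close>

lemma (in transport) transport_restrict:
  assumes "0 \<le> \<tau>" "\<tau> \<le> T"
  shows "transport s \<tau> C \<theta> \<theta>t \<theta>x u"
proof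
  show "((\<lambda>\<tau>. \<theta> \<tau> x) has_real_derivative \<theta>t t x) (at t within {0..\<tau>})" if "t \<in> {0..\<tau>}" for t x
    by (rule DERIV_subset[OF deriv_t]) (use that assms in auto)
  show "continuous_on ({0..\<tau>} \<times> UNIV) (\<lambda>(t, x). \<theta>t t x)" "continuous_on ({0..\<tau>} \<times> UNIV) (\<lambda>(t, x). \<theta>x t x)"
    by (rule continuous_on_subset[OF cont_t] continuous_on_subset[OF cont_x]; use assms in auto)+
qed (use s assms deriv_x vel pde bound in auto)

lemma (in bump) bump_restrict:
  assumes "0 \<le> \<tau>" "\<tau> \<le> T"
  shows "bump s \<tau> C \<theta> \<theta>t \<theta>x u M"
proof -
  interpret r: transport s \<tau> C \<theta> \<theta>t \<theta>x u using transport_restrict[OF assms] .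
  show ?thesis by unfold_locales (use even0 antimono0 nonneg0 decay0 M in auto)
qed

lemma (in bump) bump_bounded_restrict:
  assumes "0 \<le> \<tau>" "\<tau> \<le> T" "\<And>t. t \<in> {0..\<tau>} \<Longrightarrow> \<bar>u t 0\<bar> \<le> A"
  shows "bump_bounded s \<tau> C \<theta> \<theta>t \<theta>x u M A"
  using bump_restrict[OF assms(1,2)] assms(3) by (simp add: bump_bounded_def bump_bounded_axioms_def)

text \<open>The equation gives information on u only where the x-derivative of \<theta> does not
  vanish; this provides such a point at every time.\<close>

lemma (in bump_bounded) nonconstant:
  assumes t: "t \<in> {0..T}"
  obtains x where "\<theta>x t x \<noteq> 0"
proof -
  obtain y where y: "M - M / 2 \<le> \<theta> t y" using persistence[OF t, of "M / 2"] M by auto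
  obtain N where N: "0 \<le> N" "\<And>t x. t \<in> {0..T} \<Longrightarrow> M / 2 \<le> \<theta> t x \<Longrightarrow> \<bar>x\<bar> \<le> N"
    using decay[of "M / 2"] M by auto
  have "\<not> M / 2 \<le> \<theta> t (N + 1)" using N(1) N(2)[OF t, of "N + 1"] by auto
  then have ne: "\<theta> t y \<noteq> \<theta> t (N + 1)" using y by auto
  have "\<exists>x. \<theta>x t x \<noteq> 0"
  proof (rule ccontr)
    assume "\<nexists>x. \<theta>x t x \<noteq> 0"
    then have "\<And>x. (\<theta> t has_real_derivative 0) (at x)" using deriv_x[OF t] by metis
    then show False using DERIV_isconst_all[of "\<theta> t" y "N + 1"] ne by blast
  qed
  then show ?thesis using that by blast
qed

text \<open>Where \<theta>x does not vanish, u = - \<theta>t / \<theta>x is bounded for nearby times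
  by continuity of the two derivatives. The growth estimate for differences carries this bound from
  x to the origin.\<close>

lemma (in transport) velocity_locally_bounded:
  assumes t: "t \<in> {0..T}" and x: "\<theta>x t x \<noteq> 0"
  obtains d A where "0 < d" "\<And>r. r \<in> {0..T} \<Longrightarrow> \<bar>r - t\<bar> < d \<Longrightarrow> \<bar>u r 0\<bar> \<le> A"
proof -
  obtain B where B: "0 \<le> B" "\<And>t x. t \<in> {0..T} \<Longrightarrow> \<bar>u t x - u t 0\<bar> \<le> B * (1 + \<bar>x\<bar>) powr \<beta>"
    using velocity_growth by blast
  define m where "m = \<bar>\<theta>x t x\<bar> / 2"
  have m: "0 < m" using x by (simp add: m_def)
  have "continuous_on {0..T} (\<lambda>r. \<theta>x r x)" "continuous_on {0..T} (\<lambda>r. \<theta>t r x)"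
    by (rule continuous_comp; auto intro!: continuous_intros)+
  note cont = this[unfolded continuous_on_iff, rule_format, OF t]
  obtain d1 d2 where d: "0 < d1" "0 < d2"
    "\<And>r. r \<in> {0..T} \<Longrightarrow> dist r t < d1 \<Longrightarrow> dist (\<theta>x r x) (\<theta>x t x) < m"
    "\<And>r. r \<in> {0..T} \<Longrightarrow> dist r t < d2 \<Longrightarrow> dist (\<theta>t r x) (\<theta>t t x) < 1"
    using cont(1)[OF m] cont(2)[OF zero_less_one] by blast
  define A where "A = (\<bar>\<theta>t t x\<bar> + 1) / m + B * (1 + \<bar>x\<bar>) powr \<beta>"
  have "\<bar>u r 0\<bar> \<le> A" if r: "r \<in> {0..T}" "\<bar>r - t\<bar> < min d1 d2" for r
  proof -
    have 1: "m \<le> \<bar>\<theta>x r x\<bar>" "\<bar>\<theta>t r x\<bar> \<le> \<bar>\<theta>t t x\<bar> + 1"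
      using d(3)[of r] d(4)[of r] r unfolding m_def dist_real_def by linarith+
    have "u r x * \<theta>x r x = - \<theta>t r x" using pde[OF r(1), of x] by linarith
    then have "\<bar>u r x\<bar> * \<bar>\<theta>x r x\<bar> = \<bar>\<theta>t r x\<bar>" by (metis abs_minus_cancel abs_mult)
    moreover have "\<bar>u r x\<bar> * m \<le> \<bar>u r x\<bar> * \<bar>\<theta>x r x\<bar>" using 1 by (intro mult_left_mono) auto
    ultimately have "\<bar>u r x\<bar> * m \<le> \<bar>\<theta>t t x\<bar> + 1" using 1 by linarith
    then have "\<bar>u r x\<bar> \<le> (\<bar>\<theta>t t x\<bar> + 1) / m" using m by (simp add: pos_le_divide_eq)
    then show ?thesis using B(2)[OF r(1), of x] unfolding A_def by linarith
  qed
  then show ?thesis using that[of "min d1 d2" A] d(1,2) by auto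
qed

text \<open>Continuation in time: an a priori bound of the velocity at the origin, uniform in the
  interval on which it is already known to be bounded, is enough.\<close>

lemma (in bump) velocity_bounded_by_continuation:
  assumes apriori: "\<And>\<tau> A t. 0 \<le> \<tau> \<Longrightarrow> \<tau> \<le> T \<Longrightarrow> bump_bounded s \<tau> C \<theta> \<theta>t \<theta>x u M A \<Longrightarrow> t \<in> {0..\<tau>} \<Longrightarrow> \<bar>u t 0\<bar> \<le> K"
  obtains A where "bump_bounded s T C \<theta> \<theta>t \<theta>x u M A"
proof -
  define S where "S = {\<tau> \<in> {0..T}. \<exists>A. \<forall>t\<in>{0..\<tau>}. \<bar>u t 0\<bar> \<le> A}"
  have inS: "\<bar>u t 0\<bar> \<le> K" if \<tau>: "\<tau> \<in> S" and t: "t \<in> {0..\<tau>}" for \<tau> t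
  proof -
    obtain A where A: "\<forall>t\<in>{0..\<tau>}. \<bar>u t 0\<bar> \<le> A" "\<tau> \<in> {0..T}" using \<tau> unfolding S_def by blast
    then have "bump_bounded s \<tau> C \<theta> \<theta>t \<theta>x u M A" by (intro bump_bounded_restrict) auto
    then show ?thesis using apriori[of \<tau> A t] t A(2) by auto
  qed
  have S0: "0 \<in> S" unfolding S_def using T by auto
  have bdd: "bdd_above S" unfolding S_def by (rule bdd_aboveI[of _ T]) auto
  define \<sigma> where "\<sigma> = Sup S"
  have \<sigma>: "0 \<le> \<sigma>" "\<sigma> \<le> T"
  proof -
    show "0 \<le> \<sigma>" unfolding \<sigma>_def by (rule cSup_upper[OF S0 bdd])
    have "\<tau> \<le> T" if "\<tau> \<in> S" for \<tau> using that unfolding S_def by auto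
    then show "\<sigma> \<le> T" unfolding \<sigma>_def using S0 by (intro cSup_least) auto
  qed
  have before: "\<bar>u t 0\<bar> \<le> K" if "0 \<le> t" "t < \<sigma>" for t
  proof -
    have "\<exists>\<tau>\<in>S. t < \<tau>" using that(2) S0 bdd less_cSup_iff[of S t] unfolding \<sigma>_def by blast
    then show ?thesis using inS[of _ t] that(1) by force
  qed
  \<comment> \<open>The single value at \<sigma> is finite, so the velocity is bounded on the closed
    interval and the consequences of boundedness apply at \<sigma> itself.\<close>
  have upto: "\<bar>u t 0\<bar> \<le> max K \<bar>u \<sigma> 0\<bar>" if "t \<in> {0..\<sigma>}" for t
    using before[of t] that by (cases "t = \<sigma>") (auto simp: le_max_iff_disj)
  have "\<sigma> = T"
  proof (rule ccontr)
    assume "\<sigma> \<noteq> T"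
    then have lt: "\<sigma> < T" using \<sigma> by auto
    interpret b: bump_bounded s \<sigma> C \<theta> \<theta>t \<theta>x u M "max K \<bar>u \<sigma> 0\<bar>"
      by (rule bump_bounded_restrict) (use \<sigma> upto in auto)
    obtain x where "\<theta>x \<sigma> x \<noteq> 0" using b.nonconstant[of \<sigma>] \<sigma> by auto
    then obtain d A where d: "0 < d" "\<And>r. r \<in> {0..T} \<Longrightarrow> \<bar>r - \<sigma>\<bar> < d \<Longrightarrow> \<bar>u r 0\<bar> \<le> A"
      using velocity_locally_bounded[of \<sigma> x] \<sigma> by auto
    define \<tau> where "\<tau> = min T (\<sigma> + d / 2)"
    have \<tau>: "\<sigma> < \<tau>" "\<tau> \<le> T" using lt d(1) unfolding \<tau>_def by auto
    have "\<bar>u t 0\<bar> \<le> max A (max K \<bar>u \<sigma> 0\<bar>)" if "t \<in> {0..\<tau>}" for t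
    proof (cases "t \<le> \<sigma>")
      case True then show ?thesis using upto[of t] that by auto
    next
      case False
      then have "\<bar>t - \<sigma>\<bar> < d" using that d(1) unfolding \<tau>_def by auto
      then show ?thesis using d(2)[of t] that \<tau> by auto
    qed
    then have "\<forall>t\<in>{0..\<tau>}. \<bar>u t 0\<bar> \<le> max A (max K \<bar>u \<sigma> 0\<bar>)" by blast
    then have "\<exists>A. \<forall>t\<in>{0..\<tau>}. \<bar>u t 0\<bar> \<le> A" by blast
    then have "\<tau> \<in> S" unfolding S_def using \<tau> \<sigma> by auto
    then have "\<tau> \<le> \<sigma>" unfolding \<sigma>_def using bdd by (rule cSup_upper)
    then show False using \<tau> by simp
  qed
  then have "bump_bounded s T C \<theta> \<theta>t \<theta>x u M (max K \<bar>u T 0\<bar>)"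
    using upto T by (intro bump_bounded_restrict) auto
  then show ?thesis using that by blast
qed

text \<open>For \<open>s > - 1 / 2\<close> the odd part of \<open>\<theta>\<close> far away, which may produce a large velocity near the
  origin, obeys a linear differential inequality thanks to the bound on the total variation.\<close>

lemma (in bump_bounded) apriori_velocity_bound:
  assumes s2: "- 1 / 2 < s" and Tm: "T \<le> Tm" and B: "0 \<le> B"
    "\<And>t x. t \<in> {0..T} \<Longrightarrow> \<bar>u t x - u t 0\<bar> \<le> B * (1 + \<bar>x\<bar>) powr (1 / 2)"
    and t: "t \<in> {0..T}"
  shows "\<bar>u t 0\<bar> \<le> 2 * (kappa s * (2 * C / (1 - s) + 16 * C * B * Tm)) * exp ((16 * C * kappa s + 1) * Tm)"
proof -
  define k where "k = kappa s"
  have k: "0 < k" unfolding k_def by (rule kappa_pos[OF s])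
  \<comment> \<open>Chosen so that 8 C k / L \<le> 1/2: the contribution of earlier times to the
    weighted supremum S is then at most S / 2 and can be absorbed. The qualitative bound
    \<open>A\<close> guarantees that S is finite.\<close>
  define L where "L = 16 * C * k + 1"
  have L: "1 \<le> L" using k C_nonneg unfolding L_def by auto
  \<comment> \<open>Formed with \<open>Tm\<close>, the full length of time, so that the resulting
    bound is the same for all intervals [0, T] met during the continuation.\<close>
  define K0 where "K0 = k * (2 * C / (1 - s) + 16 * C * B * Tm)"
  have K0: "0 \<le> K0" unfolding K0_def using k C_nonneg s B T Tm by auto
  define S where "S = (SUP r\<in>{0..T}. \<bar>u r 0\<bar> * exp (- L * r))"
  have bdd: "bdd_above ((\<lambda>r. \<bar>u r 0\<bar> * exp (- L * r)) ` {0..T})"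
  proof (rule bdd_aboveI2)
    fix r assume r: "r \<in> {0..T}"
    have "exp (- L * r) \<le> 1" using L r by (auto simp: mult_nonneg_nonneg)
    then show "\<bar>u r 0\<bar> * exp (- L * r) \<le> \<bar>A\<bar>"
      using mult_mono[of "\<bar>u r 0\<bar>" "\<bar>A\<bar>" "exp (- L * r)" 1] u0_bound[OF r] by auto
  qed
  have US: "\<bar>u r 0\<bar> \<le> S * exp (L * r)" if r: "r \<in> {0..T}" for r
  proof -
    have "\<bar>u r 0\<bar> * exp (- L * r) \<le> S" unfolding S_def by (rule cSUP_upper[OF r bdd])
    then have "\<bar>u r 0\<bar> * exp (- L * r) * exp (L * r) \<le> S * exp (L * r)" by (rule mult_right_mono) auto
    then show ?thesis by (simp add: mult.assoc flip: exp_add)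
  qed
  have S: "0 \<le> S" using US[of 0] T by auto
  have main: "\<bar>u r 0\<bar> * exp (- L * r) \<le> K0 + S / 2" if r: "r \<in> {0..T}" for r
  proof -
    have tail: "\<bar>integral {1..R} (\<lambda>y. odd_diff (\<theta> r) 0 y * ker s y)\<bar> \<le> 8 * C * (2 * B * r + S * exp (L * r) / L)"
      if R: "1 \<le> R" for R
    proof -
      define \<Psi> where "\<Psi> = (\<lambda>\<tau>. integral {1..R} (\<lambda>y. odd_diff (\<theta> \<tau>) 0 y * ker s y))"
      define \<Psi>' where "\<Psi>' = (\<lambda>\<tau>. integral {1..R} (\<lambda>y. (\<theta>t \<tau> y - \<theta>t \<tau> (- y)) * ker s y))"
      have der: "(\<Psi> has_vector_derivative \<Psi>' \<tau>) (at \<tau> within {0..T})" if \<tau>: "\<tau> \<in> {0..T}" for \<tau>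
      proof -
        have "((\<lambda>\<tau>. integral (cbox 1 R) (\<lambda>y. odd_diff (\<theta> \<tau>) 0 y * ker s y)) has_vector_derivative
            integral (cbox 1 R) (\<lambda>y. (\<theta>t \<tau> y - \<theta>t \<tau> (- y)) * ker s y)) (at \<tau> within {0..T})"
        proof (rule leibniz_rule_vector_derivative[where fx = "\<lambda>\<tau> y. (\<theta>t \<tau> y - \<theta>t \<tau> (- y)) * ker s y"])
          show "((\<lambda>\<tau>. odd_diff (\<theta> \<tau>) 0 y * ker s y) has_vector_derivative (\<theta>t x y - \<theta>t x (- y)) * ker s y) (at x within {0..T})"
            if "x \<in> {0..T}" for x y
            unfolding has_real_derivative_iff_has_vector_derivative[symmetric] odd_diff_def
            using deriv_t[OF that] by (auto intro!: derivative_eq_intros)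
          show "(\<lambda>y. odd_diff (\<theta> x) 0 y * ker s y) integrable_on cbox 1 R" if "x \<in> {0..T}" for x
            unfolding cbox_interval by (rule odd_diff_ker_integrable[OF continuous_x[OF that]]) simp
          show "continuous_on ({0..T} \<times> cbox 1 R) (\<lambda>(\<tau>, y). (\<theta>t \<tau> y - \<theta>t \<tau> (- y)) * ker s y)"
            unfolding case_prod_unfold by (intro continuous_intros continuous_comp) auto
        qed (use \<tau> in auto)
        then show ?thesis by (simp add: \<Psi>_def \<Psi>'_def)
      qed
      \<comment> \<open>Here s > -1/2 enters: the part of u that grows like |y|^(1/2) is compensated
        by ker s |y| \<le> |y|^(-1/2) for |y| \<ge> 1.\<close>
      have tb: "\<bar>\<theta>t \<tau> y\<bar> * ker s \<bar>y\<bar> \<le> (\<bar>u \<tau> 0\<bar> + 2 * B) * \<bar>\<theta>x \<tau> y\<bar>" if \<tau>: "\<tau> \<in> {0..T}" and y: "1 \<le> \<bar>y\<bar>" for \<tau> y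
      proof -
        have kb: "ker s \<bar>y\<bar> \<le> \<bar>y\<bar> powr (- 1 / 2)" unfolding ker_def using y s2 by (intro powr_mono) auto
        also have "\<dots> \<le> 1" using y by (simp add: powr_le1 powr_minus inverse_le_1_iff ge_one_powr_ge_zero)
        finally have k1: "ker s \<bar>y\<bar> \<le> 1" .
        have "(1 + \<bar>y\<bar>) powr (1 / 2) \<le> (4 * \<bar>y\<bar>) powr (1 / 2)" using y by (intro powr_mono2) auto
        also have "\<dots> = 2 * \<bar>y\<bar> powr (1 / 2)" using y by (simp add: powr_mult powr_half_sqrt)
        finally have "(1 + \<bar>y\<bar>) powr (1 / 2) * ker s \<bar>y\<bar> \<le> 2 * \<bar>y\<bar> powr (1 / 2) * \<bar>y\<bar> powr (- 1 / 2)"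
          using kb by (intro mult_mono) auto
        also have "\<dots> = 2" using y by (simp add: mult.assoc flip: powr_add)
        finally have "B * ((1 + \<bar>y\<bar>) powr (1 / 2) * ker s \<bar>y\<bar>) \<le> B * 2" using B by (intro mult_left_mono)
        moreover have "\<bar>u \<tau> 0\<bar> * ker s \<bar>y\<bar> \<le> \<bar>u \<tau> 0\<bar> * 1" using k1 by (intro mult_left_mono) auto
        moreover have "\<bar>u \<tau> y\<bar> * ker s \<bar>y\<bar> \<le> (\<bar>u \<tau> 0\<bar> + B * (1 + \<bar>y\<bar>) powr (1 / 2)) * ker s \<bar>y\<bar>"
          using B(2)[OF \<tau>, of y] by (intro mult_right_mono) auto
        ultimately have "\<bar>u \<tau> y\<bar> * ker s \<bar>y\<bar> \<le> \<bar>u \<tau> 0\<bar> + 2 * B" unfolding distrib_right mult.assoc by linarith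
        then have "\<bar>u \<tau> y\<bar> * ker s \<bar>y\<bar> * \<bar>\<theta>x \<tau> y\<bar> \<le> (\<bar>u \<tau> 0\<bar> + 2 * B) * \<bar>\<theta>x \<tau> y\<bar>" by (rule mult_right_mono) auto
        moreover have "\<theta>t \<tau> y = - (u \<tau> y * \<theta>x \<tau> y)" using pde[OF \<tau>, of y] by linarith
        ultimately show ?thesis by (simp add: abs_mult mult.commute mult.left_commute)
      qed
      have ix: "(\<lambda>y. \<bar>\<theta>x \<tau> y\<bar>) integrable_on {a..b}" if "\<tau> \<in> {0..T}" for \<tau> a b
        by (intro integrable_continuous_interval continuous_intros continuous_\<theta>x that)
      \<comment> \<open>The integrand is dominated by |\<theta>x| on [1, R] and on its reflection.
        Each has total variation at most 4 C, together 8 C.\<close>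
      have bnd: "\<bar>\<Psi>' \<tau>\<bar> \<le> 8 * C * (2 * B + S * exp (L * \<tau>))" if \<tau>: "\<tau> \<in> {0..T}" for \<tau>
      proof -
        have ir: "((\<lambda>y. \<bar>\<theta>x \<tau> (- y)\<bar>) has_integral integral {- R..- 1} (\<lambda>y. \<bar>\<theta>x \<tau> y\<bar>)) {1..R}"
          using integrable_integral[OF ix[OF \<tau>, of "- R" "- 1"]]
            has_integral_reflect_real[of "\<lambda>y. \<bar>\<theta>x \<tau> (- y)\<bar>" _ R 1] by simp
        have "\<bar>\<Psi>' \<tau>\<bar> \<le> integral {1..R} (\<lambda>y. (\<bar>u \<tau> 0\<bar> + 2 * B) * (\<bar>\<theta>x \<tau> y\<bar> + \<bar>\<theta>x \<tau> (- y)\<bar>))"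
          unfolding \<Psi>'_def
        proof (rule abs_integral_le_integral)
          show "(\<lambda>y. (\<theta>t \<tau> y - \<theta>t \<tau> (- y)) * ker s y) integrable_on {1..R}"
            by (intro integrable_continuous_interval continuous_intros continuous_comp) (use \<tau> in auto)
          show "(\<lambda>y. (\<bar>u \<tau> 0\<bar> + 2 * B) * (\<bar>\<theta>x \<tau> y\<bar> + \<bar>\<theta>x \<tau> (- y)\<bar>)) integrable_on {1..R}"
            by (intro integrable_continuous_interval continuous_intros continuous_comp) (use \<tau> in auto)
          show "\<bar>(\<theta>t \<tau> y - \<theta>t \<tau> (- y)) * ker s y\<bar> \<le> (\<bar>u \<tau> 0\<bar> + 2 * B) * (\<bar>\<theta>x \<tau> y\<bar> + \<bar>\<theta>x \<tau> (- y)\<bar>)" if y: "y \<in> {1..R}" for y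
          proof -
            have "\<bar>(\<theta>t \<tau> y - \<theta>t \<tau> (- y)) * ker s y\<bar> \<le> (\<bar>\<theta>t \<tau> y\<bar> + \<bar>\<theta>t \<tau> (- y)\<bar>) * ker s y"
              unfolding abs_mult by (intro mult_mono) auto
            then show ?thesis using tb[OF \<tau>, of y] tb[OF \<tau>, of "- y"] y by (simp add: distrib_left distrib_right)
          qed
        qed
        also have "\<dots> = (\<bar>u \<tau> 0\<bar> + 2 * B) * (integral {1..R} (\<lambda>y. \<bar>\<theta>x \<tau> y\<bar>) + integral {- R..- 1} (\<lambda>y. \<bar>\<theta>x \<tau> y\<bar>))"
          using integral_add[OF ix[OF \<tau>, of 1 R] has_integral_integrable[OF ir]] integral_unique[OF ir] by simp
        also have "\<dots> \<le> (\<bar>u \<tau> 0\<bar> + 2 * B) * (4 * C + 4 * C)"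
          using total_variation[OF \<tau>, of 1 R] total_variation[OF \<tau>, of "- R" "- 1"] R B by (intro mult_left_mono add_mono) auto
        also have "\<dots> = 8 * C * (2 * B + \<bar>u \<tau> 0\<bar>)" by simp
        also have "\<dots> \<le> 8 * C * (2 * B + S * exp (L * \<tau>))"
          using US[OF \<tau>] C_nonneg by (intro mult_left_mono) auto
        finally show ?thesis .
      qed
      have \<Psi>0: "\<Psi> 0 = 0" unfolding \<Psi>_def odd_diff_def by (simp add: even0)
      define G where "G = (\<lambda>\<tau>. 8 * C * (2 * B * \<tau> + S * exp (L * \<tau>) / L))"
      have Gd: "(G has_vector_derivative 8 * C * (2 * B + S * exp (L * \<tau>))) (at \<tau>)" for \<tau>
        unfolding G_def has_real_derivative_iff_has_vector_derivative[symmetric]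
        using L by (auto intro!: derivative_eq_intros simp: field_simps)
      have "norm (\<Psi> r - \<Psi> 0) \<le> G r - G 0"
      proof (cases "r = 0")
        case False
        then have "0 < r" using r by auto
        then show ?thesis
        proof (rule differentiable_bound_general[where f' = \<Psi>' and \<phi>' = "\<lambda>\<tau>. 8 * C * (2 * B + S * exp (L * \<tau>))"])
          have "continuous_on {0..T} \<Psi>"
            using der by (intro continuous_on_vector_derivative) auto
          then show "continuous_on {0..r} \<Psi>" by (rule continuous_on_subset) (use r in auto)
          show "continuous_on {0..r} G" unfolding G_def using L by (intro continuous_intros) auto
          show "(\<Psi> has_vector_derivative \<Psi>' x) (at x)" if "0 < x" "x < r" for x
          proof -
            have "at x within {0..T} = at x" using that r by (intro at_within_Icc_at) auto
            then show ?thesis using der[of x] that r by auto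
          qed
        qed (use Gd bnd r in auto)
      qed simp
      moreover have "0 \<le> G 0" unfolding G_def using C_nonneg S L by auto
      ultimately show ?thesis using \<Psi>0 by (simp add: \<Psi>_def G_def)
    qed
    have "\<bar>u r 0\<bar> \<le> k * (2 * C / (1 - s) + 8 * C * (2 * B * r + S * exp (L * r) / L))" (is "_ \<le> k * ?b")
    proof (rule tendsto_upperbound[OF tendsto_rabs[OF has_Lambda_H_limit[OF vel[OF r] continuous_x[OF r]]]])
      show "eventually (\<lambda>R. \<bar>kappa s * integral {1/R..R} (\<lambda>y. odd_diff (\<theta> r) 0 y * ker s y)\<bar> \<le> k * ?b) at_top"
        using eventually_gt_at_top[of 1]
      proof eventually_elim
        case (elim R)
        then have R: "0 < 1 / R" "1 / R \<le> 1" "1 \<le> R" by auto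
        have "integral {1/R..R} (\<lambda>y. odd_diff (\<theta> r) 0 y * ker s y)
          = integral {1/R..1} (\<lambda>y. odd_diff (\<theta> r) 0 y * ker s y) + integral {1..R} (\<lambda>y. odd_diff (\<theta> r) 0 y * ker s y)"
          by (rule Henstock_Kurzweil_Integration.integral_combine[symmetric])
            (use R odd_diff_ker_integrable[OF continuous_x[OF r]] in auto)
        then have "\<bar>integral {1/R..R} (\<lambda>y. odd_diff (\<theta> r) 0 y * ker s y)\<bar> \<le> ?b"
          using odd_diff_near_bound[OF continuous_x[OF r] lipschitz[OF r] s(2) R(1,2), of 0] tail[OF R(3)] by linarith
        then show ?case using k unfolding k_def abs_mult by (simp add: mult_left_mono)
      qed
    qed auto
    also have "\<dots> \<le> K0 + (S / 2) * exp (L * r)"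
    proof -
      have 1: "8 * C * (2 * B * r) \<le> 16 * C * B * Tm"
        using r Tm C_nonneg B mult_left_mono[of r Tm "16 * C * B"] by auto
      have "k * (8 * C * (S * exp (L * r) / L)) = (8 * C * k / L) * (S * exp (L * r))" by simp
      also have "\<dots> \<le> (1 / 2) * (S * exp (L * r))"
        using L S by (intro mult_right_mono) (auto simp: L_def field_simps)
      finally have 2: "k * (8 * C * (S * exp (L * r) / L)) \<le> (S / 2) * exp (L * r)" by simp
      have "k * ?b = k * (2 * C / (1 - s) + 8 * C * (2 * B * r)) + k * (8 * C * (S * exp (L * r) / L))"
        by (simp add: algebra_simps)
      also have "k * (2 * C / (1 - s) + 8 * C * (2 * B * r)) \<le> K0"
        unfolding K0_def using 1 k by (intro mult_left_mono add_mono) auto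
      finally show ?thesis using 2 by linarith
    qed
    finally have "\<bar>u r 0\<bar> * exp (- L * r) \<le> (K0 + (S / 2) * exp (L * r)) * exp (- L * r)"
      by (rule mult_right_mono) auto
    also have "\<dots> = K0 * exp (- L * r) + S / 2" by (simp add: distrib_right mult.assoc flip: exp_add)
    also have "K0 * exp (- L * r) \<le> K0 * 1" using K0 L r by (intro mult_left_mono) auto
    finally show ?thesis by simp
  qed
  have "(SUP r\<in>{0..T}. \<bar>u r 0\<bar> * exp (- L * r)) \<le> K0 + S / 2"
    by (rule cSUP_least) (use T main in auto)
  then have "S \<le> K0 + S / 2" unfolding S_def[symmetric] .
  then have "S \<le> 2 * K0" by simp
  have "\<bar>u t 0\<bar> \<le> S * exp (L * t)" using US[OF t] .
  also have "\<dots> \<le> (2 * K0) * exp (L * Tm)"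
    using \<open>S \<le> 2 * K0\<close> S t Tm L by (intro mult_mono) auto
  finally show ?thesis unfolding K0_def L_def k_def .
qed

section \<open>Trajectories for s < 0\<close>

lemma integral_ker_le_powr:
  assumes s: "s < 0" and a: "0 < a" "a \<le> b"
  shows "integral {a..b} (ker s) \<le> b powr (- s) / (- s)"
proof -
  have "(ker s has_integral b powr (- s) / (- s) - a powr (- s) / (- s)) {a..b}"
  proof (rule fundamental_theorem_of_calculus)
    fix y assume y: "y \<in> {a..b}"
    have "((\<lambda>y. y powr (- s) / (- s)) has_real_derivative (- s) * y powr (- s - 1) / (- s)) (at y)"
      using y a by (intro DERIV_cdivide has_real_derivative_powr) auto
    moreover have "(- s) * y powr (- s - 1) / (- s) = ker s y"
      using s unfolding ker_def by (subst nonzero_mult_div_cancel_left) (auto intro: arg_cong[where f = "\<lambda>p. y powr p"])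
    ultimately show "((\<lambda>y. y powr (- s) / (- s)) has_vector_derivative ker s y) (at y within {a..b})"
      by (simp add: has_real_derivative_iff_has_vector_derivative has_vector_derivative_at_within)
  qed (use a in auto)
  moreover have "0 \<le> a powr (- s) / (- s)" using s by (intro divide_nonneg_nonneg) auto
  ultimately show ?thesis by (simp add: integral_unique)
qed

text \<open>For s < 0 the kernel is integrable at 0, so each of the two discarded ranges costs a
  multiple of |x1 - x2| that depends on f through C alone. With r = R = 1 the kept integral is void
  and a Lipschitz bound for u results; with r = 1/R and R tending to infinity the approximation is
  uniform in time.\<close>

lemma Lambda_H_truncation:
  assumes s: "- 1 < s" "s < 0"
    and f: "continuous_on UNIV f" "\<And>x. \<bar>f x\<bar> \<le> C" "\<And>x y. \<bar>f x - f y\<bar> \<le> C * \<bar>x - y\<bar>"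
    and v: "has_Lambda_H s f x1 v1" "has_Lambda_H s f x2 v2"
    and r: "0 < r" "r \<le> R"
  shows "\<bar>v1 - v2 - kappa s * integral {r..R} (\<lambda>y. (odd_diff f x1 y - odd_diff f x2 y) * ker s y)\<bar>
    \<le> kappa s * ((2 * C * (r powr (- s) / (- s)) + 4 * C * ker s R) * \<bar>x1 - x2\<bar>)"
    (is "_ \<le> kappa s * ?B")
proof -
  have C: "0 \<le> C" using f(2)[of 0] by auto
  define D where "D = (\<lambda>y. (odd_diff f x1 y - odd_diff f x2 y) * ker s y)"
  note lim = tendsto_diff[OF tendsto_diff[OF has_Lambda_H_limit[OF v(1) f(1)] has_Lambda_H_limit[OF v(2) f(1)]]
      tendsto_const[of "kappa s * integral {r..R} D"]]
  have "\<bar>v1 - v2 - kappa s * integral {r..R} D\<bar> \<le> kappa s * ?B"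
  proof (rule tendsto_upperbound[OF tendsto_rabs[OF lim]])
    show "eventually (\<lambda>Q. \<bar>kappa s * integral {1/Q..Q} (\<lambda>y. odd_diff f x1 y * ker s y) -
          kappa s * integral {1/Q..Q} (\<lambda>y. odd_diff f x2 y * ker s y) - kappa s * integral {r..R} D\<bar> \<le> kappa s * ?B) at_top"
      using eventually_gt_at_top[of "max R (1 / r)"]
    proof eventually_elim
      case (elim Q)
      then have "1 / r < Q" "0 < Q" "R < Q" using r by auto
      then have Q: "0 < 1 / Q" "1 / Q \<le> r" "R \<le> Q" using r by (auto simp: field_simps)
      have int: "(\<lambda>y. odd_diff f x y * ker s y) integrable_on {a..b}" if "0 < a" for a b x
        using odd_diff_ker_integrable[OF f(1) that] .
      have intD: "D integrable_on {a..b}" if "0 < a" for a b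
        using integrable_diff[OF int[OF that, of x1] int[OF that, of x2]] by (simp add: D_def left_diff_distrib)
      have "integral {1/Q..Q} (\<lambda>y. odd_diff f x1 y * ker s y) - integral {1/Q..Q} (\<lambda>y. odd_diff f x2 y * ker s y)
          = integral {1/Q..Q} D"
        unfolding D_def left_diff_distrib by (rule integral_diff[symmetric]) (use Q int in auto)
      also have "\<dots> = integral {1/Q..r} D + integral {r..R} D + integral {R..Q} D"
        using Henstock_Kurzweil_Integration.integral_combine[of "1/Q" r Q D]
          Henstock_Kurzweil_Integration.integral_combine[of r R Q D] Q r intD by auto
      finally have eq: "kappa s * integral {1/Q..Q} (\<lambda>y. odd_diff f x1 y * ker s y) -
          kappa s * integral {1/Q..Q} (\<lambda>y. odd_diff f x2 y * ker s y) - kappa s * integral {r..R} D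
          = kappa s * (integral {1/Q..r} D + integral {R..Q} D)"
        by (simp add: algebra_simps flip: right_diff_distrib)
      have "\<bar>integral {1/Q..r} D\<bar> \<le> integral {1/Q..r} (\<lambda>y. 2 * C * \<bar>x1 - x2\<bar> * ker s y)"
      proof (rule abs_integral_le_integral)
        show "(\<lambda>y. 2 * C * \<bar>x1 - x2\<bar> * ker s y) integrable_on {1/Q..r}"
          by (intro integrable_continuous_interval continuous_intros) (auto intro: less_le_trans[OF Q(1)])
        show "\<bar>D y\<bar> \<le> 2 * C * \<bar>x1 - x2\<bar> * ker s y" for y
        proof -
          have "\<bar>odd_diff f x1 y - odd_diff f x2 y\<bar> \<le> 2 * C * \<bar>x1 - x2\<bar>"
            unfolding odd_diff_def using f(3)[of "x1 + y" "x2 + y"] f(3)[of "x1 - y" "x2 - y"] by auto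
          then show ?thesis unfolding D_def abs_mult by (intro mult_mono) auto
        qed
      qed (use intD Q in auto)
      also have "\<dots> = 2 * C * \<bar>x1 - x2\<bar> * integral {1/Q..r} (ker s)" by simp
      also have "\<dots> \<le> 2 * C * \<bar>x1 - x2\<bar> * (r powr (- s) / (- s))"
        using integral_ker_le_powr[OF s(2) Q(1,2)] C by (intro mult_left_mono) auto
      finally have b1: "\<bar>integral {1/Q..r} D\<bar> \<le> 2 * C * (r powr (- s) / (- s)) * \<bar>x1 - x2\<bar>" by (simp add: mult_ac)
      have b2: "\<bar>integral {R..Q} D\<bar> \<le> 4 * C * ker s R * \<bar>x1 - x2\<bar>"
        unfolding D_def using odd_diff_tail_bound[OF s(1) f(1,2), of R Q x1 x2] Q r by (simp add: mult_ac)
      have "\<bar>integral {1/Q..r} D + integral {R..Q} D\<bar> \<le> ?B"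
        using b1 b2 unfolding distrib_right by linarith
      then show ?case unfolding eq abs_mult using kappa_pos[of s] s by (simp add: mult_left_mono)
    qed
  qed auto
  then show ?thesis unfolding D_def .
qed

text \<open>With the weight exp (- K t), K > 2 L, the integral operator contracts by 1/2 on the
  whole interval at once. The fixed point is exp (- K t) c(t); times are clamped to [0, T] by
  \<open>pr\<close> so that it becomes a bounded continuous function on the line.\<close>

lemma Picard_Lindeloef:
  fixes v :: "real \<Rightarrow> real \<Rightarrow> real"
  assumes T: "0 \<le> T" and cont: "continuous_on ({0..T} \<times> UNIV) (\<lambda>(t, x). v t x)"
    and L: "0 \<le> L" and lip: "\<And>t x y. t \<in> {0..T} \<Longrightarrow> \<bar>v t x - v t y\<bar> \<le> L * \<bar>x - y\<bar>"
  obtains c where "c 0 = 0" "\<And>t. t \<in> {0..T} \<Longrightarrow> (c has_real_derivative v t (c t)) (at t within {0..T})"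
proof -
  define K where "K = 2 * L + 1"
  have K: "0 < K" "L / K \<le> 1 / 2" using L by (auto simp: K_def field_simps)
  define pr where "pr = (\<lambda>t. max 0 (min T t))"
  have pr: "pr t \<in> {0..T}" "t \<in> {0..T} \<Longrightarrow> pr t = t" for t using T by (auto simp: pr_def)
  have prc: "continuous_on A pr" for A unfolding pr_def by (intro continuous_intros)
  define I where "I = (\<lambda>g t. integral {0..t} (\<lambda>\<tau>. v \<tau> (exp (K * \<tau>) * g \<tau>)))"
  define F where "F = (\<lambda>g t. exp (- K * pr t) * I g (pr t))"
  have vc: "continuous_on {0..T} (\<lambda>\<tau>. v \<tau> (exp (K * \<tau>) * g \<tau>))" if "continuous_on UNIV g" for g
  proof -
    have "continuous_on {0..T} (\<lambda>\<tau>. (\<tau>, exp (K * \<tau>) * g \<tau>))"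
      by (intro continuous_intros continuous_on_subset[OF that]) auto
    from continuous_on_compose2[OF cont this] show ?thesis by auto
  qed
  have Ic: "continuous_on {0..T} (I g)" if "continuous_on UNIV g" for g
    unfolding I_def by (intro indefinite_integral_continuous_1 integrable_continuous_interval vc that)
  have Fb: "F g \<in> bcontfun" if g: "continuous_on UNIV g" for g
  proof -
    have c: "continuous_on UNIV (F g)" unfolding F_def
      by (intro continuous_intros prc continuous_on_compose2[OF Ic[OF g] prc]) (use pr in auto)
    have "F g t \<in> F g ` {0..T}" for t
    proof -
      have "pr (pr t) = pr t" using pr by blast
      then have "F g t = F g (pr t)" unfolding F_def by simp
      then show ?thesis using pr(1)[of t] by blast
    qed
    then have "range (F g) \<subseteq> F g ` {0..T}" by blast
    moreover have "bounded (F g ` {0..T})"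
      by (intro compact_imp_bounded compact_continuous_image continuous_on_subset[OF c]) auto
    ultimately show ?thesis using c bounded_subset unfolding bcontfun_def by blast
  qed
  define P :: "(real \<Rightarrow>\<^sub>C real) \<Rightarrow> (real \<Rightarrow>\<^sub>C real)" where "P = (\<lambda>g. Bcontfun (F (apply_bcontfun g)))"
  have P: "apply_bcontfun (P g) = F (apply_bcontfun g)" for g
    unfolding P_def by (rule Bcontfun_inverse[OF Fb]) auto
  have "\<exists>!g\<in>UNIV. P g = g"
  proof (rule Banach_fix)
    show "complete (UNIV :: (real \<Rightarrow>\<^sub>C real) set)" by (rule complete_UNIV)
    show "dist (P g) (P h) \<le> 1 / 2 * dist g h" for g h
    proof (rule dist_bound)
      fix t
      let ?d = "dist g h"
      define r where "r = pr t"
      have r: "0 \<le> r" "r \<le> T" using pr(1)[of t] by (auto simp: r_def)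
      have ig: "(\<lambda>\<tau>. v \<tau> (exp (K * \<tau>) * apply_bcontfun g \<tau>)) integrable_on {0..r}" for g
        by (rule integrable_continuous_interval, rule continuous_on_subset[OF vc]) (use r in auto)
      have ex: "((\<lambda>\<tau>. L * ?d * exp (K * \<tau>)) has_integral L * ?d * exp (K * r) / K - L * ?d * exp (K * 0) / K) {0..r}"
        by (rule fundamental_theorem_of_calculus[OF r(1)])
          (use K in \<open>auto intro!: derivative_eq_intros simp: has_real_derivative_iff_has_vector_derivative[symmetric]\<close>)
      have "\<bar>I g r - I h r\<bar> = \<bar>integral {0..r} (\<lambda>\<tau>. v \<tau> (exp (K * \<tau>) * g \<tau>) - v \<tau> (exp (K * \<tau>) * h \<tau>))\<bar>"
        unfolding I_def using integral_diff[OF ig[of g] ig[of h]] by simp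
      also have "\<dots> \<le> integral {0..r} (\<lambda>\<tau>. L * ?d * exp (K * \<tau>))"
      proof (rule abs_integral_le_integral)
        show "(\<lambda>\<tau>. v \<tau> (exp (K * \<tau>) * g \<tau>) - v \<tau> (exp (K * \<tau>) * h \<tau>)) integrable_on {0..r}"
          by (rule integrable_diff[OF ig ig])
        show "(\<lambda>\<tau>. L * ?d * exp (K * \<tau>)) integrable_on {0..r}" using ex by blast
        fix \<tau> assume \<tau>: "\<tau> \<in> {0..r}"
        have "\<bar>v \<tau> (exp (K * \<tau>) * g \<tau>) - v \<tau> (exp (K * \<tau>) * h \<tau>)\<bar> \<le> L * \<bar>exp (K * \<tau>) * g \<tau> - exp (K * \<tau>) * h \<tau>\<bar>"
          using \<tau> r by (intro lip) auto
        also have "\<bar>exp (K * \<tau>) * g \<tau> - exp (K * \<tau>) * h \<tau>\<bar> = exp (K * \<tau>) * \<bar>g \<tau> - h \<tau>\<bar>"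
          by (simp add: abs_mult flip: right_diff_distrib)
        also have "L * (exp (K * \<tau>) * \<bar>g \<tau> - h \<tau>\<bar>) \<le> L * (exp (K * \<tau>) * ?d)"
          using dist_bounded[of g \<tau> h] L by (intro mult_left_mono) (auto simp: dist_real_def)
        finally show "\<bar>v \<tau> (exp (K * \<tau>) * g \<tau>) - v \<tau> (exp (K * \<tau>) * h \<tau>)\<bar> \<le> L * ?d * exp (K * \<tau>)" by (simp add: mult_ac)
      qed
      also have "\<dots> = L * ?d * exp (K * r) / K - L * ?d * exp (K * 0) / K" by (rule integral_unique[OF ex])
      also have "\<dots> \<le> L / K * ?d * exp (K * r)" using L K by simp
      also have "\<dots> \<le> 1 / 2 * ?d * exp (K * r)" using K by (intro mult_right_mono) auto
      finally have "exp (- K * r) * \<bar>I g r - I h r\<bar> \<le> exp (- K * r) * (1 / 2 * ?d * exp (K * r))"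
        by (intro mult_left_mono) auto
      also have "\<dots> = 1 / 2 * ?d" by (simp flip: exp_add)
      finally show "dist (P g t) (P h t) \<le> 1 / 2 * ?d"
        unfolding P F_def r_def[symmetric] dist_real_def by (simp add: abs_mult flip: right_diff_distrib)
    qed
  qed auto
  then obtain g where g: "P g = g" by blast
  define c where "c = (\<lambda>t. exp (K * t) * apply_bcontfun g t)"
  have c: "c t = integral {0..t} (\<lambda>\<tau>. v \<tau> (c \<tau>))" if "t \<in> {0..T}" for t
  proof -
    have "apply_bcontfun g t = F (apply_bcontfun g) t" using P[of g] g by simp
    then have "c t = exp (K * t) * (exp (- K * t) * I g t)" unfolding c_def F_def using pr(2)[OF that] by simp
    also have "\<dots> = I g t" by (simp flip: exp_add mult.assoc)
    finally show ?thesis unfolding I_def c_def .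
  qed
  have "(c has_real_derivative v t (c t)) (at t within {0..T})" if t: "t \<in> {0..T}" for t
  proof -
    have "((\<lambda>t. integral {0..t} (\<lambda>\<tau>. v \<tau> (c \<tau>))) has_vector_derivative v t (c t)) (at t within {0..T})"
      unfolding c_def by (rule integral_has_vector_derivative[OF vc t]) auto
    from has_vector_derivative_transform[OF t c this]
    have "(c has_vector_derivative v t (c t)) (at t within {0..T})" .
    then show ?thesis by (simp add: has_real_derivative_iff_has_vector_derivative)
  qed
  moreover have "c 0 = 0" using c[of 0] T by simp
  ultimately show ?thesis using that by blast
qed

context bump_bounded
begin

text \<open>The constant of \<open>Lambda_H_truncation\<close> at r = R = 1, where the powers are
  1.\<close>

definition "Lip = kappa s * (2 * C / (- s) + 4 * C)"

lemma Lip_nonneg: "s < 0 \<Longrightarrow> 0 \<le> Lip"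
  unfolding Lip_def using kappa_pos[OF s] C_nonneg
  by (intro mult_nonneg_nonneg add_nonneg_nonneg divide_nonneg_pos) auto

lemma velocity_Lipschitz:
  assumes "s < 0" "t \<in> {0..T}"
  shows "\<bar>u t x - u t y\<bar> \<le> Lip * \<bar>x - y\<bar>"
  using Lambda_H_truncation[OF s(1) assms(1) continuous_x[OF assms(2)] bound(1)[OF assms(2)] lipschitz[OF assms(2)]
      vel[OF assms(2), of x] vel[OF assms(2), of y], of 1 1]
  unfolding Lip_def by (simp add: ker_def mult.assoc)

text \<open>Differences of velocities are limits of truncated integrals, uniformly in t. The missing
  value of u at one point y comes from the equation, as u = - \<theta>t / \<theta>x near a time at
  which \<theta>x does not vanish at y.\<close>

lemma velocity_continuous_t:
  assumes s0: "s < 0"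
  shows "continuous_on {0..T} (\<lambda>t. u t x)"
proof -
  have diff: "continuous_on {0..T} (\<lambda>t. u t x - u t y)" for y
  proof (rule uniform_limit_theorem)
    define J where "J = (\<lambda>R t. kappa s * integral {1/R..R} (\<lambda>z. (odd_diff (\<theta> t) x z - odd_diff (\<theta> t) y z) * ker s z))"
    define E where "E = (\<lambda>R. kappa s * ((2 * C * ((1/R) powr (- s) / (- s)) + 4 * C * ker s R) * \<bar>x - y\<bar>))"
    show "eventually (\<lambda>R. continuous_on {0..T} (J R)) at_top"
      using eventually_gt_at_top[of 0]
    proof eventually_elim
      case (elim R)
      have "continuous_on ({0..T} \<times> cbox (1/R) R) (\<lambda>(t, z). (odd_diff (\<theta> t) x z - odd_diff (\<theta> t) y z) * ker s z)"
        unfolding case_prod_unfold odd_diff_def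
        by (intro continuous_intros continuous_comp) (use elim in \<open>auto intro: less_le_trans[of 0 "1 / R"]\<close>)
      from integral_continuous_on_param[OF this] show ?case
        unfolding J_def by (intro continuous_intros) simp
    qed
    have EL: "(E \<longlongrightarrow> 0) at_top"
    proof -
      have "((\<lambda>R. (1/R) powr (- s)) \<longlongrightarrow> 0) at_top"
      proof -
        have "((\<lambda>R. R powr s) \<longlongrightarrow> 0) at_top" using s0 by (intro tendsto_neg_powr filterlim_ident) auto
        moreover have "eventually (\<lambda>R. R powr s = (1/R) powr (- s)) at_top"
          using eventually_gt_at_top[of 0] by eventually_elim (simp add: powr_minus powr_divide)
        ultimately show ?thesis by (rule Lim_transform_eventually)
      qed
      moreover have "(ker s \<longlongrightarrow> 0) at_top"
        unfolding ker_def[abs_def] using s by (intro tendsto_neg_powr filterlim_ident) auto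
      ultimately have "(E \<longlongrightarrow> kappa s * ((2 * C * (0 / (- s)) + 4 * C * 0) * \<bar>x - y\<bar>)) at_top"
        unfolding E_def using s0 by (intro tendsto_intros) auto
      then show ?thesis by simp
    qed
    show "uniform_limit {0..T} J (\<lambda>t. u t x - u t y) at_top"
    proof (rule uniform_limitI)
      fix e :: real assume "0 < e"
      then have "eventually (\<lambda>R. E R < e) at_top" using order_tendstoD(2)[OF EL] by auto
      then show "eventually (\<lambda>R. \<forall>t\<in>{0..T}. dist (J R t) (u t x - u t y) < e) at_top"
        using eventually_ge_at_top[of 1]
      proof eventually_elim
        case (elim R)
        have R: "0 < 1 / R" "1 / R \<le> R"
          using elim(2) by (auto simp: field_simps) (metis mult_mono' mult_1 zero_le_one)
        show ?case
        proof
          fix t assume t: "t \<in> {0..T}"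
          have "\<bar>u t x - u t y - J R t\<bar> \<le> E R" unfolding J_def E_def
            by (rule Lambda_H_truncation[OF s(1) s0 continuous_x[OF t] bound(1)[OF t] lipschitz[OF t] vel[OF t] vel[OF t] R])
          then show "dist (J R t) (u t x - u t y) < e" using elim(1) by (simp add: dist_real_def abs_minus_commute)
        qed
      qed
    qed
  qed auto
  have cth: "continuous_on {0..T} (\<lambda>r. \<theta>x r z)" "continuous_on {0..T} (\<lambda>r. \<theta>t r z)" for z
    by (rule continuous_comp; auto intro!: continuous_intros)+
  show ?thesis
    unfolding continuous_on_eq_continuous_within
  proof
    fix t assume t: "t \<in> {0..T}"
    obtain y where y: "\<theta>x t y \<noteq> 0" using nonconstant[OF t] by blast
    have lx: "((\<lambda>r. \<theta>x r y) \<longlongrightarrow> \<theta>x t y) (at t within {0..T})" and lt: "((\<lambda>r. \<theta>t r y) \<longlongrightarrow> \<theta>t t y) (at t within {0..T})"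
      using cth[of y] t by (auto simp: continuous_on_def)
    have ev: "eventually (\<lambda>r. \<theta>x r y \<noteq> 0 \<and> r \<in> {0..T}) (at t within {0..T})"
      using tendsto_imp_eventually_ne[OF lx y] by (auto simp: eventually_at_filter elim: eventually_mono)
    have "((\<lambda>r. - \<theta>t r y / \<theta>x r y) \<longlongrightarrow> - \<theta>t t y / \<theta>x t y) (at t within {0..T})"
      by (intro tendsto_intros lx lt y)
    then have "((\<lambda>r. u r y) \<longlongrightarrow> - \<theta>t t y / \<theta>x t y) (at t within {0..T})"
    proof (rule Lim_transform_eventually)
      show "eventually (\<lambda>r. - \<theta>t r y / \<theta>x r y = u r y) (at t within {0..T})"
        using ev
      proof eventually_elim
        case (elim r)
        then have "u r y * \<theta>x r y = - \<theta>t r y" using pde[of r y] by linarith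
        then show ?case using elim by (auto simp: field_simps)
      qed
    qed
    moreover have "- \<theta>t t y / \<theta>x t y = u t y"
    proof -
      have "u t y * \<theta>x t y = - \<theta>t t y" using pde[OF t, of y] by linarith
      then show ?thesis using y by (auto simp: field_simps)
    qed
    ultimately have "((\<lambda>r. u r y) \<longlongrightarrow> u t y) (at t within {0..T})" by simp
    moreover have "((\<lambda>r. u r x - u r y) \<longlongrightarrow> u t x - u t y) (at t within {0..T})"
      using diff[of y] t by (auto simp: continuous_on_def)
    ultimately have "((\<lambda>r. u r y + (u r x - u r y)) \<longlongrightarrow> u t y + (u t x - u t y)) (at t within {0..T})"
      by (rule tendsto_add)
    then show "continuous (at t within {0..T}) (\<lambda>t. u t x)" by (simp add: continuous_within)
  qed
qed

lemma velocity_continuous: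
  assumes "s < 0"
  shows "continuous_on ({0..T} \<times> UNIV) (\<lambda>(t, x). u t x)"
  by (rule continuous_on_Times_Lipschitz[OF velocity_continuous_t[OF assms] velocity_Lipschitz[OF assms]])

lemma trajectory:
  assumes "s < 0"
  obtains c where "c 0 = 0" "\<And>t. t \<in> {0..T} \<Longrightarrow> (c has_real_derivative u t (c t)) (at t within {0..T})"
  using Picard_Lindeloef[OF T velocity_continuous[OF assms] Lip_nonneg[OF assms] velocity_Lipschitz[OF assms]] that
  by blast

end

section \<open>Estimates for the odd part\<close>

text \<open>Cutting [a, b] into N equal pieces turns the quadratic errors into a total of K (b -
  a)^2 / N.\<close>

lemma le_of_quadratic_lower_bound:
  fixes G :: "real \<Rightarrow> real"
  assumes ab: "a \<le> b" and G: "\<And>x y. a \<le> x \<Longrightarrow> x \<le> y \<Longrightarrow> y \<le> b \<Longrightarrow> - (K * (y - x)\<^sup>2) \<le> G y - G x"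
  shows "G a \<le> G b"
proof -
  have "- (K * (b - a)\<^sup>2) * (1 / real (Suc n)) \<le> G b - G a" for n
  proof -
    define N where "N = real (Suc n)"
    define x where "x = (\<lambda>i. a + real i * ((b - a) / N))"
    have N: "0 < N" by (simp add: N_def)
    have step: "x (Suc i) - x i = (b - a) / N" for i
      unfolding x_def of_nat_Suc distrib_right by simp
    have "(\<Sum>i<Suc n. - (K * ((b - a) / N)\<^sup>2)) \<le> (\<Sum>i<Suc n. G (x (Suc i)) - G (x i))"
    proof (rule sum_mono)
      fix i assume i: "i \<in> {..<Suc n}"
      have "real (Suc i) * ((b - a) / N) \<le> N * ((b - a) / N)"
        using i ab N by (intro mult_right_mono) (auto simp: N_def)
      then have "x (Suc i) \<le> b" using N by (simp add: x_def)
      moreover have "a \<le> x i" using ab N by (simp add: x_def)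
      moreover have "x i \<le> x (Suc i)" using ab N step[of i] divide_nonneg_pos[of "b - a" N] by linarith
      ultimately show "- (K * ((b - a) / N)\<^sup>2) \<le> G (x (Suc i)) - G (x i)"
        using G[of "x i" "x (Suc i)"] step[of i] by simp
    qed
    also have "\<dots> = G (x (Suc n)) - G (x 0)" by (rule sum_lessThan_telescope)
    also have "\<dots> = G b - G a" using N by (simp add: x_def N_def)
    also have "(\<Sum>i<Suc n. - (K * ((b - a) / N)\<^sup>2)) = N * - (K * ((b - a) / N)\<^sup>2)" by (simp add: N_def)
    also have "\<dots> = - (K * (b - a)\<^sup>2) * (1 / N)" using N by (simp add: power_divide power2_eq_square[of N])
    finally show ?thesis by (simp add: N_def)
  qed
  moreover have "(\<lambda>n. - (K * (b - a)\<^sup>2) * (1 / real (Suc n))) \<longlonglongrightarrow> - (K * (b - a)\<^sup>2) * 0"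
    by (intro tendsto_intros LIMSEQ_Suc lim_1_over_n)
  ultimately have "- (K * (b - a)\<^sup>2) * 0 \<le> G b - G a" by (intro LIMSEQ_le_const2) auto
  then show ?thesis by simp
qed

text \<open>As \<open>p\<close> need not be differentiable, the increments of the two sides are compared up to an
  error that is quadratic in the length of the interval.\<close>

lemma integral_Lipschitz_by_parts:
  fixes p f f' :: "real \<Rightarrow> real"
  assumes ab: "a \<le> b" and L: "0 \<le> L"
    and f: "\<And>x. x \<in> {a..b} \<Longrightarrow> (f has_real_derivative f' x) (at x)" "continuous_on {a..b} f'"
      "\<And>x. x \<in> {a..b} \<Longrightarrow> 0 \<le> f x"
    and p: "\<And>x y. x \<in> {a..b} \<Longrightarrow> y \<in> {a..b} \<Longrightarrow> \<bar>p x - p y\<bar> \<le> L * \<bar>x - y\<bar>"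
  shows "- integral {a..b} (\<lambda>x. p x * f' x) \<le> p a * f a - p b * f b + L * integral {a..b} f"
proof -
  have pc: "continuous_on {a..b} p"
    unfolding continuous_on_iff
  proof (intro ballI allI impI)
    fix x and e :: real assume "x \<in> {a..b}" "0 < e"
    then show "\<exists>d>0. \<forall>x'\<in>{a..b}. dist x' x < d \<longrightarrow> dist (p x') (p x) < e"
    proof (intro exI[of _ "e / (L + 1)"] conjI ballI impI)
      fix x' assume x': "x' \<in> {a..b}" "dist x' x < e / (L + 1)"
      have "dist (p x') (p x) \<le> L * \<bar>x' - x\<bar>" using p[of x' x] x' \<open>x \<in> {a..b}\<close> by (simp add: dist_real_def)
      also have "\<dots> \<le> (L + 1) * \<bar>x' - x\<bar>" by (intro mult_right_mono) auto
      also have "\<dots> < e" using x'(2) L by (simp add: dist_real_def field_simps)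
      finally show "dist (p x') (p x) < e" .
    qed (use L in auto)
  qed
  have fc: "continuous_on {a..b} f"
    using f(1) by (meson DERIV_isCont continuous_at_imp_continuous_on)
  have fv: "(f has_vector_derivative f' z) (at z within S)" if "z \<in> {a..b}" for z S
    using has_field_derivative_at_within[OF f(1)[OF that]] unfolding has_real_derivative_iff_has_vector_derivative .
  have "bounded (f' ` {a..b})"
    by (intro compact_imp_bounded compact_continuous_image f(2)) auto
  then obtain D where D: "0 < D" "\<And>x. x \<in> {a..b} \<Longrightarrow> \<bar>f' x\<bar> \<le> D"
    unfolding bounded_pos by auto
  have i1: "f integrable_on {x..y}" and i2: "f' integrable_on {x..y}" and i3: "(\<lambda>x. p x * f' x) integrable_on {x..y}"
    if "a \<le> x" "y \<le> b" for x y
    by (rule integrable_continuous_interval; intro continuous_intros continuous_on_subset[OF fc]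
        continuous_on_subset[OF f(2)] continuous_on_subset[OF pc]; use that in auto)+
  \<comment> \<open>\<open>G b - G a\<close> is the right-hand side of the claim minus its left-hand
    side.\<close>
  define G where "G = (\<lambda>y. L * integral {a..y} f - p y * f y + integral {a..y} (\<lambda>x. p x * f' x))"
  have "G a \<le> G b"
  proof (rule le_of_quadratic_lower_bound[OF ab, of "2 * L * D"])
    fix x y assume xy: "a \<le> x" "x \<le> y" "y \<le> b"
    have Df: "\<bar>f z - f y\<bar> \<le> D * (y - x)" if "z \<in> {x..y}" for z
    proof -
      have "norm (f z - f y) \<le> D * norm (z - y)"
        by (rule field_differentiable_bound[where S = "{x..y}" and f' = f'])
          (use xy that D(2) in \<open>auto intro!: has_field_derivative_at_within[OF f(1)]\<close>)
      also have "\<dots> \<le> D * (y - x)" using that D by (intro mult_left_mono) auto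
      finally show ?thesis by simp
    qed
    have s1: "integral {a..y} f = integral {a..x} f + integral {x..y} f"
      using Henstock_Kurzweil_Integration.integral_combine[of a x y f] xy i1 by auto
    have s2: "integral {a..y} (\<lambda>x. p x * f' x) = integral {a..x} (\<lambda>x. p x * f' x) + integral {x..y} (\<lambda>x. p x * f' x)"
      using Henstock_Kurzweil_Integration.integral_combine[of a x y "\<lambda>x. p x * f' x"] xy i3 by auto
    have "(f' has_integral f y - f x) {x..y}"
      by (rule fundamental_theorem_of_calculus[OF xy(2) fv]) (use xy in auto)
    then have s3: "integral {x..y} (\<lambda>z. p x * f' z) = p x * (f y - f x)" by (simp add: integral_unique)
    have i4: "(\<lambda>z. p x * f' z) integrable_on {x..y}"
      by (rule integrable_on_mult_right[OF i2[OF xy(1,3)]])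
    \<comment> \<open>On a short interval p is replaced by \<open>p x\<close> and f by
      \<open>f y\<close>. Each replacement costs at most L D (y - x)^2.\<close>
    have "\<bar>integral {x..y} (\<lambda>z. p z * f' z) - integral {x..y} (\<lambda>z. p x * f' z)\<bar>
      = \<bar>integral {x..y} (\<lambda>z. p z * f' z - p x * f' z)\<bar>"
      by (rule arg_cong[where f = abs], rule integral_diff[symmetric, OF i3[OF xy(1,3)] i4])
    also have "\<dots> \<le> integral {x..y} (\<lambda>z. L * (y - x) * D)"
    proof (rule abs_integral_le_integral)
      show "(\<lambda>z. p z * f' z - p x * f' z) integrable_on {x..y}"
        by (rule integrable_diff[OF i3[OF xy(1,3)] i4])
      fix z assume z: "z \<in> {x..y}"
      have "\<bar>p z - p x\<bar> \<le> L * \<bar>z - x\<bar>" using p[of z x] z xy by auto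
      also have "\<dots> \<le> L * (y - x)" using z L by (intro mult_left_mono) auto
      finally have "\<bar>(p z - p x) * f' z\<bar> \<le> L * (y - x) * D"
        unfolding abs_mult using D(2)[of z] z xy L by (intro mult_mono) auto
      then show "\<bar>p z * f' z - p x * f' z\<bar> \<le> L * (y - x) * D" by (simp add: left_diff_distrib)
    qed auto
    also have "\<dots> = L * D * (y - x)\<^sup>2" using xy by (simp add: power2_eq_square)
    finally have r1: "\<bar>integral {x..y} (\<lambda>z. p z * f' z) - p x * (f y - f x)\<bar> \<le> L * D * (y - x)\<^sup>2" unfolding s3 .
    have "integral {x..y} (\<lambda>z. f y - D * (y - x)) \<le> integral {x..y} f"
    proof (rule integral_le)
      show "f y - D * (y - x) \<le> f z" if "z \<in> {x..y}" for z using Df[OF that] by auto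
    qed (use i1 xy in auto)
    then have "(f y - D * (y - x)) * (y - x) \<le> integral {x..y} f" using xy by (simp add: mult.commute)
    then have "L * ((f y - D * (y - x)) * (y - x)) \<le> L * integral {x..y} f" using L by (rule mult_left_mono)
    moreover have "(p y - p x) * f y \<le> L * (y - x) * f y"
      using p[of y x] f(3)[of y] xy by (intro mult_right_mono) auto
    ultimately show "- (2 * L * D * (y - x)\<^sup>2) \<le> G y - G x"
      using r1 unfolding G_def s1 s2 by (simp add: algebra_simps power2_eq_square abs_le_iff)
  qed
  then show ?thesis unfolding G_def by simp
qed

section \<open>Second differences of the velocity in terms of the odd part\<close>

lemma borel_measurable_ker [measurable]: "ker s \<in> borel_measurable borel"
  unfolding ker_def[abs_def] by measurable

lemma ennreal_abs_integral_le:
  fixes g :: "real \<Rightarrow> real"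
  assumes "continuous_on {a..b} g"
  shows "ennreal \<bar>integral {a..b} g\<bar> \<le> (\<integral>\<^sup>+ x. ennreal \<bar>g x\<bar> * indicator {a..b} x \<partial>lborel)"
proof -
  have int: "set_integrable lborel {a..b} g" using assms by (rule borel_integrable_atLeastAtMost')
  have "ennreal \<bar>integral {a..b} g\<bar> = ennreal (norm (LINT x|lborel. indicator {a..b} x *\<^sub>R g x))"
    using set_borel_integral_eq_integral(2)[OF int] by (simp add: set_lebesgue_integral_def)
  also have "\<dots> \<le> (\<integral>\<^sup>+ x. norm (indicator {a..b} x *\<^sub>R g x) \<partial>lborel)"
    using int unfolding set_integrable_def by (rule integral_norm_bound_ennreal)
  also have "\<dots> = (\<integral>\<^sup>+ x. ennreal \<bar>g x\<bar> * indicator {a..b} x \<partial>lborel)"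
    by (rule nn_integral_cong) (auto simp: indicator_def)
  finally show ?thesis .
qed

text \<open>The majorant of the kernel of \<open>u(c + x) + u(c - x) - 2 u(c)\<close> acting on the odd function
  \<open>y \<mapsto> \<theta>(c + y) - \<theta>(c - y)\<close>.\<close>

definition maj :: "real \<Rightarrow> real \<Rightarrow> real \<Rightarrow> real" where
  "maj s x y = (if y \<le> 2 * x then ker s \<bar>y - x\<bar> else 0) + 13 * ker s y * (x / (x + y))"

lemma borel_measurable_maj [measurable]: "(\<lambda>(x, y). maj s x y) \<in> borel_measurable (borel \<Otimes>\<^sub>M borel)"
  unfolding maj_def case_prod_unfold by measurable

text \<open>The factor x / (x + y) expresses two facts at once: a difference of kernels at distance
  x gains x / y when y is large, and for y \<le> 2 x the factor is at least 1/3. The constants 2, 8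
  and 3 add up to the 13 in \<open>maj\<close>.\<close>

lemma ker_difference_le:
  assumes s: "- 1 < s" "s < 0" and xy: "0 < x" "0 < y"
  shows "ker s y - ker s (y + x) \<le> 2 * ker s y * (x / (x + y))"
    and "2 * x \<le> y \<Longrightarrow> ker s (y - x) - ker s y \<le> 8 * ker s y * (x / (x + y))"
    and "y \<le> 2 * x \<Longrightarrow> ker s y \<le> 3 * ker s y * (x / (x + y))"
proof -
  have mvt: "ker s a - ker s b \<le> (b - a) * a powr (- 2 - s)" if "0 < a" "a < b" for a b
  proof -
    have "\<exists>z. a < z \<and> z < b \<and> ker s b - ker s a = (b - a) * (- (1 + s) * z powr (- 2 - s))"
      using that by (intro MVT2 ker_has_derivative) auto
    then obtain z where z: "a < z" "z < b" "ker s b - ker s a = (b - a) * (- (1 + s) * z powr (- 2 - s))" by blast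
    have "(1 + s) * z powr (- 2 - s) \<le> 1 * a powr (- 2 - s)"
      using z that s by (intro mult_mono powr_mono2') auto
    then have "(b - a) * ((1 + s) * z powr (- 2 - s)) \<le> (b - a) * a powr (- 2 - s)"
      using that by (intro mult_left_mono) auto
    moreover have "ker s b - ker s a = - ((b - a) * ((1 + s) * z powr (- 2 - s)))"
      unfolding z(3) by (simp only: mult_minus_left mult_minus_right)
    ultimately show ?thesis by linarith
  qed
  have k2: "y * y powr (- 2 - s) = ker s y"
    using xy unfolding ker_def by (subst powr_mult_base) (auto intro: arg_cong[where f = "\<lambda>p. y powr p"])
  have kp: "0 < ker s y" using xy by (intro ker_pos)
  show "ker s y - ker s (y + x) \<le> 2 * ker s y * (x / (x + y))"
  proof (cases "x \<le> y")
    case True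
    have "ker s y - ker s (y + x) \<le> (x / y) * (y * y powr (- 2 - s))" using mvt[of y "y + x"] xy by simp
    also have "\<dots> = ker s y * (x / y)" unfolding k2 by simp
    also have "\<dots> \<le> ker s y * (2 * (x / (x + y)))"
      using kp True xy by (intro mult_left_mono) (auto simp: field_simps)
    finally show ?thesis by (simp only: mult_ac)
  next
    case False
    have "ker s y - ker s (y + x) \<le> ker s y * 1" by simp
    also have "\<dots> \<le> ker s y * (2 * (x / (x + y)))"
      using kp False xy by (intro mult_left_mono) (auto simp: field_simps)
    finally show ?thesis by (simp only: mult_ac)
  qed
  show "ker s (y - x) - ker s y \<le> 8 * ker s y * (x / (x + y))" if "2 * x \<le> y"
  proof -
    have "ker s (y - x) - ker s y \<le> x * (y - x) powr (- 2 - s)" using mvt[of "y - x" y] xy that by simp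
    also have "\<dots> \<le> x * (y / 2) powr (- 2 - s)"
      using xy that s by (intro mult_left_mono powr_mono2') auto
    also have "(y / 2) powr (- 2 - s) = (1 / 2) powr (- 2 - s) * y powr (- 2 - s)"
      using powr_mult[of "1 / 2" y "- 2 - s"] by simp
    also have "(1 / 2 :: real) powr (- 2 - s) \<le> 4"
    proof -
      have "(1 / 2 :: real) powr (- 2 - s) = 2 powr (2 + s)"
        using powr_minus_divide[of "2::real" "2 + s"] by (simp add: powr_divide)
      also have "\<dots> \<le> 2 powr 2" using s by (intro powr_mono) auto
      finally show ?thesis by simp
    qed
    finally have "ker s (y - x) - ker s y \<le> x * (4 * y powr (- 2 - s))"
      using xy by (simp add: mult_left_mono mult_right_mono)
    also have "\<dots> = ker s y * (4 * (x / y))" using k2 xy by (simp add: field_simps)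
    also have "\<dots> \<le> ker s y * (8 * (x / (x + y)))"
      using kp that xy by (intro mult_left_mono) (auto simp: field_simps)
    finally show ?thesis by (simp only: mult_ac)
  qed
  show "ker s y \<le> 3 * ker s y * (x / (x + y))" if "y \<le> 2 * x"
  proof -
    have "ker s y * 1 \<le> ker s y * (3 * (x / (x + y)))"
      using kp that xy by (intro mult_left_mono) (auto simp: field_simps)
    then show ?thesis by (simp only: mult_1_right mult_1_left mult_ac)
  qed
qed

text \<open>The left-hand side collects the kernels that multiply w once the second difference is
  written over y > 0. All three bounds with constants 2, 8 and 3 are used together at y = 2
  x.\<close>

lemma maj_ge:
  assumes s: "- 1 < s" "s < 0" and xy: "0 < x" "0 < y"
  shows "(if x < y \<and> y \<le> 2 * x then ker s (y - x) else 0) + (if y < x then ker s (x - y) else 0)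
    + (if 2 * x \<le> y then ker s (y - x) - ker s y else 0) + (ker s y - ker s (y + x))
    + (if y \<le> 2 * x then ker s y else 0) \<le> maj s x y"
proof -
  define Q where "Q = ker s y * (x / (x + y))"
  have q: "0 \<le> Q" unfolding Q_def using xy by auto
  note b = ker_difference_le[OF s xy, unfolded mult.assoc, folded Q_def]
  have m: "maj s x y = (if y \<le> 2 * x then ker s \<bar>y - x\<bar> else 0) + 13 * Q"
    unfolding maj_def Q_def by simp
  consider "y < x" | "y = x" | "x < y" "y < 2 * x" | "y = 2 * x" | "2 * x < y" by linarith
  then show ?thesis
  proof cases
    case 1 then show ?thesis unfolding m using b(1,3) q xy by simp
  next
    case 2
    moreover have "13 * Q \<le> maj s x y" unfolding m by simp
    ultimately show ?thesis using b(1,3) q xy by simp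
  next
    case 3 then show ?thesis unfolding m using b(1,3) q by simp
  next
    case 4 then show ?thesis unfolding m using b q xy by simp
  next
    case 5 then show ?thesis unfolding m using b(1,2) q xy by simp
  qed
qed

text \<open>Shifting moves the increments of w onto the kernel, and oddness folds negative arguments
  back to positive ones. The term - 2 w is split so that each shifted kernel is paired with one copy
  of ker y, which gains decay at infinity. Next to the singularity y = x this pairing is pointless,
  so one copy is left over on \<open>{e..2 * x}\<close>. The last three terms are truncation
  errors.\<close>

lemma integral_ker_shift_reflect:
  fixes w :: "real \<Rightarrow> real"
  assumes w: "continuous_on UNIV w" "\<And>y. w (- y) = - w y"
    and e: "0 < e" "e < x" "3 * x < R"
  shows "integral {e..R} (\<lambda>y. (w (y + x) + w (y - x) - 2 * w y) * ker s y) =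
      integral {x + e..2 * x} (\<lambda>y. w y * ker s (y - x)) - integral {0..x - e} (\<lambda>y. w y * ker s (x - y))
      + integral {2 * x..R - x} (\<lambda>y. w y * (ker s (y - x) - ker s y))
      + integral {e..R - x} (\<lambda>y. w y * (ker s (y + x) - ker s y)) - integral {e..2 * x} (\<lambda>y. w y * ker s y)
      + integral {R - x..R + x} (\<lambda>y. w y * ker s (y - x)) + integral {0..e} (\<lambda>y. w y * ker s (y + x))
      - 2 * integral {R - x..R} (\<lambda>y. w y * ker s y)"
proof -
  have wc: "continuous_on A (\<lambda>y. w (h y))" if "continuous_on A h" for A and h :: "real \<Rightarrow> real"
    using that by (intro continuous_on_compose2[OF w(1)]) auto
  have ik: "(\<lambda>y. w (h y) * ker s (g y)) integrable_on {a..b}"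
    if "continuous_on {a..b} h" "continuous_on {a..b} g" "\<And>y. y \<in> {a..b} \<Longrightarrow> 0 < g y" for a b and g h :: "real \<Rightarrow> real"
    using that by (intro integrable_continuous_interval continuous_intros wc) auto
  have i0: "(\<lambda>y. w y * ker s y) integrable_on {a..b}" if "0 < a" for a b
    by (rule ik) (use that in \<open>auto intro: continuous_intros\<close>)
  have im: "(\<lambda>y. w y * ker s (y - x)) integrable_on {a..b}" if "x < a" for a b
    by (rule ik) (use that in \<open>auto intro!: continuous_intros\<close>)
  have ip: "(\<lambda>y. w y * ker s (y + x)) integrable_on {a..b}" if "0 \<le> a" for a b
    by (rule ik) (use that e in \<open>auto intro!: continuous_intros\<close>)
  have j1: "(\<lambda>y. w (y + x) * ker s y) integrable_on {a..b}" "(\<lambda>y. w (y - x) * ker s y) integrable_on {a..b}" if "0 < a" for a b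
    by (rule ik; use that in \<open>auto intro!: continuous_intros\<close>)+
  note comb = Henstock_Kurzweil_Integration.integral_combine[symmetric]
  have "integral {e..R} (\<lambda>y. (w (y + x) + w (y - x) - 2 * w y) * ker s y)
    = integral {e..R} (\<lambda>y. w (y + x) * ker s y + w (y - x) * ker s y - 2 * (w y * ker s y))"
    by (simp add: algebra_simps)
  also have "\<dots> = integral {e..R} (\<lambda>y. w (y + x) * ker s y) + integral {e..R} (\<lambda>y. w (y - x) * ker s y)
      - 2 * integral {e..R} (\<lambda>y. w y * ker s y)"
    using integral_diff[OF integrable_add[OF j1[OF e(1), of R]] integrable_on_mult_right[OF i0[OF e(1)], of 2]]
      integral_add[OF j1[OF e(1), of R]] by simp
  finally have 1: "integral {e..R} (\<lambda>y. (w (y + x) + w (y - x) - 2 * w y) * ker s y)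
    = integral {e..R} (\<lambda>y. w (y + x) * ker s y) + integral {e..R} (\<lambda>y. w (y - x) * ker s y)
      - 2 * integral {e..R} (\<lambda>y. w y * ker s y)" .
  have 2: "integral {e..R} (\<lambda>y. w (y + x) * ker s y) = integral {x + e..R + x} (\<lambda>y. w y * ker s (y - x))"
    using integral_shift_real_ivl[of "x + e" x "R + x" "\<lambda>y. w y * ker s (y - x)"] by simp
  have 3: "\<dots> = integral {x + e..2 * x} (\<lambda>y. w y * ker s (y - x)) + integral {2 * x..R - x} (\<lambda>y. w y * ker s (y - x))
      + integral {R - x..R + x} (\<lambda>y. w y * ker s (y - x))"
    using comb[of "x + e" "2 * x" "R + x", OF _ _ im] comb[of "2 * x" "R - x" "R + x", OF _ _ im] e by simp
  have 4: "integral {e..R} (\<lambda>y. w (y - x) * ker s y)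
    = integral {e..x} (\<lambda>y. w (y - x) * ker s y) + integral {x..R} (\<lambda>y. w (y - x) * ker s y)"
    using comb[of e x R, OF _ _ j1(2)] e by simp
  have 5: "integral {x..R} (\<lambda>y. w (y - x) * ker s y) = integral {0..R - x} (\<lambda>y. w y * ker s (y + x))"
    using integral_shift_real_ivl[of x x R "\<lambda>y. w (y - x) * ker s y"] by simp
  have 6: "\<dots> = integral {0..e} (\<lambda>y. w y * ker s (y + x)) + integral {e..R - x} (\<lambda>y. w y * ker s (y + x))"
    using comb[of 0 e "R - x", OF _ _ ip] e by simp
  have 7: "integral {e..x} (\<lambda>y. w (y - x) * ker s y) = - integral {0..x - e} (\<lambda>y. w y * ker s (x - y))"
  proof -
    have "integral {e..x} (\<lambda>y. w (y - x) * ker s y) = integral {- x..- e} (\<lambda>y. w (- y - x) * ker s (- y))"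
      using Henstock_Kurzweil_Integration.integral_reflect_real[of x e "\<lambda>y. w (y - x) * ker s y"] by simp
    also have "\<dots> = integral {0..x - e} (\<lambda>y. w (- (y + - x) - x) * ker s (- (y + - x)))"
      using integral_shift_real_ivl[of "- x" "- x" "- e" "\<lambda>y. w (- y - x) * ker s (- y)"] by simp
    also have "\<dots> = integral {0..x - e} (\<lambda>y. - (w y * ker s (x - y)))"
      using w(2) by (simp add: algebra_simps)
    finally show ?thesis by simp
  qed
  have 8: "integral {e..R} (\<lambda>y. w y * ker s y)
    = integral {e..2 * x} (\<lambda>y. w y * ker s y) + integral {2 * x..R - x} (\<lambda>y. w y * ker s y) + integral {R - x..R} (\<lambda>y. w y * ker s y)"
    using comb[of e "2 * x" R, OF _ _ i0] comb[of "2 * x" "R - x" R, OF _ _ i0] e by simp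
  have 9: "integral {e..R} (\<lambda>y. w y * ker s y) = integral {e..R - x} (\<lambda>y. w y * ker s y) + integral {R - x..R} (\<lambda>y. w y * ker s y)"
    using comb[of e "R - x" R, OF _ _ i0] e by simp
  have 10: "integral {2 * x..R - x} (\<lambda>y. w y * (ker s (y - x) - ker s y))
    = integral {2 * x..R - x} (\<lambda>y. w y * ker s (y - x)) - integral {2 * x..R - x} (\<lambda>y. w y * ker s y)"
    unfolding right_diff_distrib by (rule integral_diff[OF im i0]) (use e in auto)
  have 11: "integral {e..R - x} (\<lambda>y. w y * (ker s (y + x) - ker s y))
    = integral {e..R - x} (\<lambda>y. w y * ker s (y + x)) - integral {e..R - x} (\<lambda>y. w y * ker s y)"
    unfolding right_diff_distrib by (rule integral_diff[OF ip i0]) (use e in auto)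
  show ?thesis using 1 2 3 4 5 6 7 8 9 10 11 by linarith
qed

text \<open>The bound is an extended nonnegative integral, because finiteness is obtained only after
  a further integration in x.\<close>

lemma second_difference_bound:
  fixes w :: "real \<Rightarrow> real"
  assumes s: "- 1 < s" "s < 0" and w: "continuous_on UNIV w" "\<And>y. w (- y) = - w y" "\<And>y. \<bar>w y\<bar> \<le> B"
    and e: "0 < e" "e < x" "3 * x < R"
  shows "ennreal \<bar>integral {e..R} (\<lambda>y. (w (y + x) + w (y - x) - 2 * w y) * ker s y)\<bar>
    \<le> (\<integral>\<^sup>+ y. ennreal (\<bar>w y\<bar> * maj s x y) * indicator {0<..} y \<partial>lborel)
      + ennreal (4 * B * x * ker s (R - 2 * x) + B * e * ker s x)"
proof -
  have B: "0 \<le> B" using w(3)[of 0] by linarith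
  have x: "0 < x" using e by auto
  have wc: "continuous_on A w" for A using w(1) by (rule continuous_on_subset) auto
  have [measurable]: "w \<in> borel_measurable borel" using w(1) by (rule borel_measurable_continuous_onI)
  define k1 k2 k3 k4 k5 where "k1 = (\<lambda>y. ker s (y - x))" and "k2 = (\<lambda>y. ker s (x - y))"
    and "k3 = (\<lambda>y. ker s (y - x) - ker s y)" and "k4 = (\<lambda>y. ker s (y + x) - ker s y)" and "k5 = ker s"
  have [measurable]: "k1 \<in> borel_measurable borel" "k2 \<in> borel_measurable borel" "k3 \<in> borel_measurable borel"
    "k4 \<in> borel_measurable borel" "k5 \<in> borel_measurable borel"
    unfolding k1_def k2_def k3_def k4_def k5_def by measurable
  define A1 A2 A3 A4 A5 where "A1 = integral {x + e..2 * x} (\<lambda>y. w y * k1 y)" and "A2 = integral {0..x - e} (\<lambda>y. w y * k2 y)"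
    and "A3 = integral {2 * x..R - x} (\<lambda>y. w y * k3 y)" and "A4 = integral {e..R - x} (\<lambda>y. w y * k4 y)"
    and "A5 = integral {e..2 * x} (\<lambda>y. w y * k5 y)"
  note A_defs = A1_def A2_def A3_def A4_def A5_def k1_def k2_def k3_def k4_def k5_def
  define B1 B2 B3 where "B1 = integral {R - x..R + x} (\<lambda>y. w y * ker s (y - x))"
    and "B2 = integral {0..e} (\<lambda>y. w y * ker s (y + x))" and "B3 = integral {R - x..R} (\<lambda>y. w y * ker s y)"
  have eb: "\<bar>integral {a..b} (\<lambda>y. w y * ker s (g y))\<bar> \<le> B * (b - a) * ker s d"
    if "a \<le> b" "0 < d" "continuous_on {a..b} g" "\<And>y. y \<in> {a..b} \<Longrightarrow> d \<le> g y" for a b d and g :: "real \<Rightarrow> real"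
  proof -
    have "\<bar>integral {a..b} (\<lambda>y. w y * ker s (g y))\<bar> \<le> integral {a..b} (\<lambda>y. B * ker s d)"
    proof (rule abs_integral_le_integral)
      show "(\<lambda>y. w y * ker s (g y)) integrable_on {a..b}"
        by (intro integrable_continuous_interval continuous_intros wc that(3)) (use that in \<open>auto intro: less_le_trans\<close>)
      show "\<bar>w y * ker s (g y)\<bar> \<le> B * ker s d" if "y \<in> {a..b}" for y
        unfolding abs_mult using w(3)[of y] ker_antimono[OF s(1) \<open>0 < d\<close>, of "g y"] \<open>\<And>y. y \<in> {a..b} \<Longrightarrow> d \<le> g y\<close>[OF that] B
        by (intro mult_mono) auto
    qed auto
    then show ?thesis using that(1) by (simp add: mult_ac)
  qed
  have cc: "continuous_on A (\<lambda>y. y - x)" "continuous_on A (\<lambda>y. y + x)" for A :: "real set"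
    by (intro continuous_intros)+
  have errs: "\<bar>B1\<bar> \<le> B * (2 * x) * ker s (R - 2 * x)" "\<bar>B2\<bar> \<le> B * e * ker s x" "\<bar>B3\<bar> \<le> B * x * ker s (R - 2 * x)"
    unfolding B1_def B2_def B3_def
    using eb[of "R - x" "R + x" "R - 2 * x" "\<lambda>y. y - x", OF _ _ cc(1)] eb[of 0 e x "\<lambda>y. y + x", OF _ _ cc(2)]
      eb[of "R - x" R "R - 2 * x" "\<lambda>y. y"] e x by auto
  have "\<bar>integral {e..R} (\<lambda>y. (w (y + x) + w (y - x) - 2 * w y) * ker s y)\<bar>
      \<le> (\<bar>A1\<bar> + \<bar>A2\<bar> + \<bar>A3\<bar> + \<bar>A4\<bar> + \<bar>A5\<bar>) + (4 * B * x * ker s (R - 2 * x) + B * e * ker s x)"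
  proof -
    have "integral {e..R} (\<lambda>y. (w (y + x) + w (y - x) - 2 * w y) * ker s y) = A1 - A2 + A3 + A4 - A5 + B1 + B2 - 2 * B3"
      unfolding A_defs B1_def B2_def B3_def by (rule integral_ker_shift_reflect[OF w(1,2) e])
    moreover define n1 n2 n3 n4 n5 where "n1 = \<bar>A1\<bar>" "n2 = \<bar>A2\<bar>" "n3 = \<bar>A3\<bar>" "n4 = \<bar>A4\<bar>" "n5 = \<bar>A5\<bar>"
    have "A1 \<le> n1" "- n1 \<le> A1" "A2 \<le> n2" "- n2 \<le> A2" "A3 \<le> n3" "- n3 \<le> A3" "A4 \<le> n4" "- n4 \<le> A4"
      "A5 \<le> n5" "- n5 \<le> A5"
      unfolding n1_n2_n3_n4_n5_def by auto
    moreover note errs[unfolded abs_le_iff]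
    ultimately show ?thesis unfolding n1_n2_n3_n4_n5_def[symmetric] by (intro abs_leI) linarith+
  qed
  then have le: "ennreal \<bar>integral {e..R} (\<lambda>y. (w (y + x) + w (y - x) - 2 * w y) * ker s y)\<bar>
      \<le> ennreal (\<bar>A1\<bar> + \<bar>A2\<bar> + \<bar>A3\<bar> + \<bar>A4\<bar> + \<bar>A5\<bar>) + ennreal (4 * B * x * ker s (R - 2 * x) + B * e * ker s x)"
    using B x e by (intro order.trans[OF ennreal_leI eq_refl[OF ennreal_plus]]) simp_all
  have m1: "ennreal (\<bar>A1\<bar> + \<bar>A2\<bar> + \<bar>A3\<bar> + \<bar>A4\<bar> + \<bar>A5\<bar>) = ennreal \<bar>A1\<bar> + ennreal \<bar>A2\<bar> + ennreal \<bar>A3\<bar> + ennreal \<bar>A4\<bar> + ennreal \<bar>A5\<bar>"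
    by simp
  have m2: "ennreal \<bar>A1\<bar> + ennreal \<bar>A2\<bar> + ennreal \<bar>A3\<bar> + ennreal \<bar>A4\<bar> + ennreal \<bar>A5\<bar>
    \<le> (\<integral>\<^sup>+ y. ennreal \<bar>w y * k1 y\<bar> * indicator {x + e..2 * x} y \<partial>lborel)
     + (\<integral>\<^sup>+ y. ennreal \<bar>w y * k2 y\<bar> * indicator {0..x - e} y \<partial>lborel)
     + (\<integral>\<^sup>+ y. ennreal \<bar>w y * k3 y\<bar> * indicator {2 * x..R - x} y \<partial>lborel)
     + (\<integral>\<^sup>+ y. ennreal \<bar>w y * k4 y\<bar> * indicator {e..R - x} y \<partial>lborel)
     + (\<integral>\<^sup>+ y. ennreal \<bar>w y * k5 y\<bar> * indicator {e..2 * x} y \<partial>lborel)" (is "_ \<le> ?S")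
    unfolding A_defs using e x
    by (intro add_mono ennreal_abs_integral_le continuous_intros wc) auto
  have m3: "?S = (\<integral>\<^sup>+ y. ennreal \<bar>w y * k1 y\<bar> * indicator {x + e..2 * x} y + ennreal \<bar>w y * k2 y\<bar> * indicator {0..x - e} y
      + ennreal \<bar>w y * k3 y\<bar> * indicator {2 * x..R - x} y + ennreal \<bar>w y * k4 y\<bar> * indicator {e..R - x} y
      + ennreal \<bar>w y * k5 y\<bar> * indicator {e..2 * x} y \<partial>lborel)" (is "_ = ?Z")
    by (simp add: nn_integral_add)
  have ep: "ennreal b1 + ennreal b2 + ennreal b3 + ennreal b4 + ennreal b5 = ennreal (b1 + b2 + b3 + b4 + b5)"
    if "0 \<le> b1" "0 \<le> b2" "0 \<le> b3" "0 \<le> b4" "0 \<le> b5" for b1 b2 b3 b4 b5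
    using that by simp
  have m4: "?Z \<le> (\<integral>\<^sup>+ y. ennreal (\<bar>w y\<bar> * maj s x y) * indicator {0<..} y \<partial>lborel)"
  proof (rule nn_integral_mono_AE)
    \<comment> \<open>The point 0 lies in \<open>{0..x - e}\<close> but outside the range of the
      majorant integral.\<close>
    have "AE y in lborel. y \<noteq> (0::real)" by (rule AE_lborel_singleton)
    then show "AE y in lborel. ennreal \<bar>w y * k1 y\<bar> * indicator {x + e..2 * x} y + ennreal \<bar>w y * k2 y\<bar> * indicator {0..x - e} y
      + ennreal \<bar>w y * k3 y\<bar> * indicator {2 * x..R - x} y + ennreal \<bar>w y * k4 y\<bar> * indicator {e..R - x} y
      + ennreal \<bar>w y * k5 y\<bar> * indicator {e..2 * x} y \<le> ennreal (\<bar>w y\<bar> * maj s x y) * indicator {0<..} y"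
    proof eventually_elim
      case (elim y)
      show ?case
      proof (cases "0 < y")
        case False
        then show ?thesis using elim e x by (auto simp: indicator_def)
      next
        case y: True
        have k3': "\<bar>k3 y\<bar> = ker s (y - x) - ker s y" if "2 * x \<le> y"
          unfolding k3_def using ker_antimono[OF s(1), of "y - x" y] x that by auto
        have k4': "\<bar>k4 y\<bar> = ker s y - ker s (y + x)"
          unfolding k4_def using ker_antimono[OF s(1), of y "y + x"] x y by auto
        have i: "ennreal \<bar>w y * k\<bar> * indicator S y = ennreal (\<bar>w y\<bar> * (if y \<in> S then \<bar>k\<bar> else 0))" for k S
          by (auto simp: indicator_def abs_mult)
        have "(if y \<in> {x + e..2 * x} then \<bar>k1 y\<bar> else 0) + (if y \<in> {0..x - e} then \<bar>k2 y\<bar> else 0)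
          + (if y \<in> {2 * x..R - x} then \<bar>k3 y\<bar> else 0) + (if y \<in> {e..R - x} then \<bar>k4 y\<bar> else 0)
          + (if y \<in> {e..2 * x} then \<bar>k5 y\<bar> else 0) \<le>
          (if x < y \<and> y \<le> 2 * x then ker s (y - x) else 0) + (if y < x then ker s (x - y) else 0)
          + (if 2 * x \<le> y then ker s (y - x) - ker s y else 0) + (ker s y - ker s (y + x))
          + (if y \<le> 2 * x then ker s y else 0)"
        proof (intro add_mono)
          show "(if y \<in> {2 * x..R - x} then \<bar>k3 y\<bar> else 0) \<le> (if 2 * x \<le> y then ker s (y - x) - ker s y else 0)"
            using k3' ker_antimono[OF s(1), of "y - x" y] x by auto
          show "(if y \<in> {e..R - x} then \<bar>k4 y\<bar> else 0) \<le> ker s y - ker s (y + x)"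
            using k4' abs_ge_zero[of "k4 y"] by auto
        qed (use e in \<open>auto simp: k1_def k2_def k5_def\<close>)
        also have "\<dots> \<le> maj s x y" by (rule maj_ge[OF s x y])
        finally have "\<bar>w y\<bar> * ((if y \<in> {x + e..2 * x} then \<bar>k1 y\<bar> else 0) + (if y \<in> {0..x - e} then \<bar>k2 y\<bar> else 0)
          + (if y \<in> {2 * x..R - x} then \<bar>k3 y\<bar> else 0) + (if y \<in> {e..R - x} then \<bar>k4 y\<bar> else 0)
          + (if y \<in> {e..2 * x} then \<bar>k5 y\<bar> else 0)) \<le> \<bar>w y\<bar> * maj s x y" by (intro mult_left_mono) auto
        from ennreal_leI[OF this[unfolded distrib_left]]
        have "ennreal (\<bar>w y\<bar> * (if y \<in> {x + e..2 * x} then \<bar>k1 y\<bar> else 0)) + ennreal (\<bar>w y\<bar> * (if y \<in> {0..x - e} then \<bar>k2 y\<bar> else 0))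
          + ennreal (\<bar>w y\<bar> * (if y \<in> {2 * x..R - x} then \<bar>k3 y\<bar> else 0)) + ennreal (\<bar>w y\<bar> * (if y \<in> {e..R - x} then \<bar>k4 y\<bar> else 0))
          + ennreal (\<bar>w y\<bar> * (if y \<in> {e..2 * x} then \<bar>k5 y\<bar> else 0)) \<le> ennreal (\<bar>w y\<bar> * maj s x y)"
          by (subst ep) simp_all
        moreover have "indicator {0<..} y = (1 :: ennreal)" using y by simp
        ultimately show ?thesis unfolding i by (simp only: mult_1_right)
      qed
    qed
  qed
  from order.trans[OF m2 order.trans[OF eq_refl[OF m3] m4]]
  show ?thesis unfolding m1[symmetric] by (rule order.trans[OF le add_right_mono])
qed

text \<open>The combination of velocities at c + x, c - x and c sees f only through its odd part
  about c. If the majorant integral is infinite the claim is trivial as kappa s > 0; otherwise the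
  truncation errors vanish in the limit.\<close>

lemma Lambda_H_second_difference:
  assumes s: "- 1 < s" "s < 0"
    and f: "continuous_on UNIV f" "\<And>x. \<bar>f x\<bar> \<le> C"
    and v: "has_Lambda_H s f (c + x) v1" "has_Lambda_H s f (c - x) v2" "has_Lambda_H s f c v0"
    and x: "0 < x"
  shows "ennreal \<bar>v1 + v2 - 2 * v0\<bar>
    \<le> ennreal (kappa s) * (\<integral>\<^sup>+ y. ennreal (\<bar>f (c + y) - f (c - y)\<bar> * maj s x y) * indicator {0<..} y \<partial>lborel)"
proof -
  define w where "w = (\<lambda>y. f (c + y) - f (c - y))"
  have wc: "continuous_on UNIV w" unfolding w_def
    by (intro continuous_intros continuous_on_compose2[OF f(1)]) auto
  have wo: "w (- y) = - w y" for y unfolding w_def by simp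
  have wb: "\<bar>w y\<bar> \<le> 2 * C" for y unfolding w_def using f(2)[of "c + y"] f(2)[of "c - y"] by linarith
  have k: "0 < kappa s" using s by (intro kappa_pos) auto
  define I where "I = (\<lambda>R. integral {1/R..R} (\<lambda>y. (w (y + x) + w (y - x) - 2 * w y) * ker s y))"
  define P where "P = (\<integral>\<^sup>+ y. ennreal (\<bar>w y\<bar> * maj s x y) * indicator {0<..} y \<partial>lborel)"
  have lim: "((\<lambda>R. kappa s * I R) \<longlongrightarrow> v1 + v2 - 2 * v0) at_top"
  proof -
    have "((\<lambda>R. kappa s * integral {1/R..R} (\<lambda>y. odd_diff f (c + x) y * ker s y)
      + kappa s * integral {1/R..R} (\<lambda>y. odd_diff f (c - x) y * ker s y)
      - 2 * (kappa s * integral {1/R..R} (\<lambda>y. odd_diff f c y * ker s y))) \<longlongrightarrow> v1 + v2 - 2 * v0) at_top"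
      by (intro tendsto_intros has_Lambda_H_limit v f)
    moreover have "eventually (\<lambda>R. kappa s * integral {1/R..R} (\<lambda>y. odd_diff f (c + x) y * ker s y)
      + kappa s * integral {1/R..R} (\<lambda>y. odd_diff f (c - x) y * ker s y)
      - 2 * (kappa s * integral {1/R..R} (\<lambda>y. odd_diff f c y * ker s y)) = kappa s * I R) at_top"
      using eventually_gt_at_top[of 0]
    proof eventually_elim
      case (elim R)
      have int: "(\<lambda>y. odd_diff f z y * ker s y) integrable_on {1/R..R}" for z
        using odd_diff_ker_integrable[OF f(1)] elim by simp
      have "I R = integral {1/R..R} (\<lambda>y. odd_diff f (c + x) y * ker s y + odd_diff f (c - x) y * ker s y - 2 * (odd_diff f c y * ker s y))"
        unfolding I_def w_def odd_diff_def by (simp add: algebra_simps)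
      also have "\<dots> = integral {1/R..R} (\<lambda>y. odd_diff f (c + x) y * ker s y)
         + integral {1/R..R} (\<lambda>y. odd_diff f (c - x) y * ker s y) - 2 * integral {1/R..R} (\<lambda>y. odd_diff f c y * ker s y)"
        using integral_diff[OF integrable_add[OF int int] integrable_on_mult_right[OF int, of 2], of "c + x" "c - x" c]
          integral_add[OF int[of "c + x"] int[of "c - x"]] by simp
      finally have IR: "I R = integral {1/R..R} (\<lambda>y. odd_diff f (c + x) y * ker s y)
         + integral {1/R..R} (\<lambda>y. odd_diff f (c - x) y * ker s y) - 2 * integral {1/R..R} (\<lambda>y. odd_diff f c y * ker s y)" .
      show ?case unfolding IR by (simp add: algebra_simps)
    qed
    ultimately show ?thesis by (rule Lim_transform_eventually)
  qed
  show ?thesis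
  proof (cases P)
    case top
    then show ?thesis using k by (simp add: P_def w_def ennreal_mult_top)
  next
    case (real r)
    define err where "err = (\<lambda>R. 4 * (2 * C) * x * ker s (R - 2 * x) + 2 * C * (1/R) * ker s x)"
    have err: "(err \<longlongrightarrow> 0) at_top"
    proof -
      have "(ker s \<longlongrightarrow> 0) at_top"
        unfolding ker_def[abs_def] using s by (intro tendsto_neg_powr filterlim_ident) auto
      moreover have "filterlim (\<lambda>R. R - 2 * x) at_top at_top"
        using filterlim_tendsto_add_at_top[OF tendsto_const[of "- 2 * x"] filterlim_ident] by simp
      ultimately have 1: "((\<lambda>R. ker s (R - 2 * x)) \<longlongrightarrow> 0) at_top" by (rule filterlim_compose)
      have 2: "((\<lambda>R. 1 / R :: real) \<longlongrightarrow> 0) at_top"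
        using tendsto_inverse_0_at_top[OF filterlim_ident[of at_top]] by (simp add: inverse_eq_divide)
      have "(err \<longlongrightarrow> 4 * (2 * C) * x * 0 + 2 * C * 0 * ker s x) at_top"
        unfolding err_def by (intro tendsto_intros 1 2)
      then show ?thesis by simp
    qed
    have "\<bar>v1 + v2 - 2 * v0\<bar> \<le> kappa s * (r + 0)"
    proof (rule tendsto_le[OF _ _ tendsto_rabs[OF lim]])
      show "((\<lambda>R. kappa s * (r + err R)) \<longlongrightarrow> kappa s * (r + 0)) at_top" by (intro tendsto_intros err)
      show "eventually (\<lambda>R. \<bar>kappa s * I R\<bar> \<le> kappa s * (r + err R)) at_top"
        using eventually_gt_at_top[of "max (3 * x) (1 / x)"]
      proof eventually_elim
        case (elim R)
        then have R: "3 * x < R" "1 / x < R" "0 < R" using x by auto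
        then have R': "0 < 1 / R" "1 / R < x" using x by (auto simp: field_simps)
        have C: "0 \<le> C" using f(2)[of 0] by linarith
        have e0: "0 \<le> err R" unfolding err_def using C x R by auto
        have "ennreal \<bar>I R\<bar> \<le> P + ennreal (err R)"
          using second_difference_bound[OF s wc wo wb R' R(1)] unfolding I_def P_def err_def by simp
        also have "\<dots> = ennreal (r + err R)" using real e0 by simp
        finally have "\<bar>I R\<bar> \<le> r + err R" using real e0 by (subst (asm) ennreal_le_iff) auto
        then show ?case unfolding abs_mult using k by simp
      qed
    qed simp
    then have "ennreal \<bar>v1 + v2 - 2 * v0\<bar> \<le> ennreal (kappa s * r)" by (simp add: ennreal_leI)
    also have "\<dots> = ennreal (kappa s) * P" using real k by (simp add: ennreal_mult)
    finally show ?thesis unfolding P_def w_def .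
  qed
qed

section \<open>The weight and a Schur test for the majorant\<close>

lemma nn_integral_ker_unit:
  assumes "s < 0"
  shows "(\<integral>\<^sup>+ x. ennreal (ker s x) * indicator {0..1} x \<partial>lborel) = ennreal (1 / (- s))"
proof -
  have "((\<lambda>x. x powr (- 1 - s)) has_integral 1 powr (- 1 - s + 1) / (- 1 - s + 1)) {0..1}"
    using assms by (intro has_integral_powr_from_0) auto
  from nn_integral_has_integral_lebesgue'[OF _ this] show ?thesis by (simp add: ker_def)
qed

lemma nn_integral_ker_dist_le:
  assumes "s < 0"
  shows "(\<integral>\<^sup>+ x. ennreal (ker s \<bar>x - z\<bar>) * indicator {z - 1..z + 1} x \<partial>lborel) \<le> ennreal (2 / (- s))"
proof -
  have "(\<integral>\<^sup>+ x. ennreal (ker s \<bar>x - z\<bar>) * indicator {z - 1..z + 1} x \<partial>lborel)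
    = (\<integral>\<^sup>+ x. ennreal (ker s \<bar>z + 1 * x - z\<bar>) * indicator {z - 1..z + 1} (z + 1 * x) \<partial>lborel)"
    by (subst nn_integral_real_affine[where t = z and c = 1]) auto
  also have "\<dots> \<le> (\<integral>\<^sup>+ x. ennreal (ker s x) * indicator {0..1} x + ennreal (ker s (- x)) * indicator {0..1} (- x) \<partial>lborel)"
    by (rule nn_integral_mono) (auto simp: indicator_def)
  also have "\<dots> = (\<integral>\<^sup>+ x. ennreal (ker s x) * indicator {0..1} x \<partial>lborel)
    + (\<integral>\<^sup>+ x. ennreal (ker s (- x)) * indicator {0..1} (- x) \<partial>lborel)"
    by (rule nn_integral_add) auto
  also have "(\<integral>\<^sup>+ x. ennreal (ker s (- x)) * indicator {0..1} (- x) \<partial>lborel) = (\<integral>\<^sup>+ x. ennreal (ker s x) * indicator {0..1} x \<partial>lborel)"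
    using nn_integral_real_affine[where t = 0 and c = "- 1" and f = "\<lambda>x. ennreal (ker s x) * indicator {0..1} x"] by simp
  also have "(\<integral>\<^sup>+ x. ennreal (ker s x) * indicator {0..1} x \<partial>lborel) + (\<integral>\<^sup>+ x. ennreal (ker s x) * indicator {0..1} x \<partial>lborel)
    = ennreal (1 / (- s) + 1 / (- s))"
    unfolding nn_integral_ker_unit[OF assms] using assms by (intro ennreal_plus[symmetric]) (auto simp: divide_nonpos_neg)
  finally show ?thesis by simp
qed

text \<open>Within distance 1 of z the bound h \<le> C is used, beyond it ker \<le> 1 and the
  integral of h. The two hypotheses on h are those satisfied by |\<theta>x|: its supremum and its
  total variation.\<close>

lemma nn_integral_mult_ker_le:
  assumes s: "- 1 < s" "s < 0" and [measurable]: "h \<in> borel_measurable borel"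
    and h: "\<And>x. 0 \<le> h x" "\<And>x. h x \<le> C" "(\<integral>\<^sup>+ x. ennreal (h x) \<partial>lborel) \<le> ennreal (4 * C)"
  shows "(\<integral>\<^sup>+ x. ennreal (h x * ker s \<bar>x - z\<bar>) \<partial>lborel) \<le> ennreal (2 * C / (- s) + 4 * C)"
proof -
  have C: "0 \<le> C" using h(1,2) order.trans by blast
  have pt: "ennreal (h x * ker s \<bar>x - z\<bar>) \<le> ennreal C * (ennreal (ker s \<bar>x - z\<bar>) * indicator {z - 1..z + 1} x) + ennreal (h x)" for x
  proof (cases "x \<in> {z - 1..z + 1}")
    case True
    have "ennreal (h x * ker s \<bar>x - z\<bar>) \<le> ennreal (C * ker s \<bar>x - z\<bar>)"
      using h by (intro ennreal_leI mult_right_mono) auto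
    also have "\<dots> = ennreal C * (ennreal (ker s \<bar>x - z\<bar>) * indicator {z - 1..z + 1} x)" using True C by (simp add: ennreal_mult)
    finally show ?thesis by (rule order.trans) simp
  next
    case False
    then have "1 \<le> \<bar>x - z\<bar>" by auto
    then have "ker s \<bar>x - z\<bar> \<le> ker s 1" using s by (intro ker_antimono) auto
    then have "h x * ker s \<bar>x - z\<bar> \<le> h x * 1" using h by (intro mult_left_mono) (auto simp: ker_def)
    then show ?thesis using False by (simp add: ennreal_leI)
  qed
  have "(\<integral>\<^sup>+ x. ennreal (h x * ker s \<bar>x - z\<bar>) \<partial>lborel) \<le> (\<integral>\<^sup>+ x. ennreal C * (ennreal (ker s \<bar>x - z\<bar>) * indicator {z - 1..z + 1} x) + ennreal (h x) \<partial>lborel)"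
    by (rule nn_integral_mono) (rule pt)
  also have "\<dots> = ennreal C * (\<integral>\<^sup>+ x. ennreal (ker s \<bar>x - z\<bar>) * indicator {z - 1..z + 1} x \<partial>lborel) + (\<integral>\<^sup>+ x. ennreal (h x) \<partial>lborel)"
    by (subst nn_integral_add) (auto intro!: nn_integral_cmult)
  also have "\<dots> \<le> ennreal C * ennreal (2 / (- s)) + ennreal (4 * C)"
    by (intro add_mono mult_left_mono nn_integral_ker_dist_le s h) auto
  also have "\<dots> = ennreal (C * (2 / (- s)) + 4 * C)"
  proof -
    have q: "0 \<le> 2 / (- s)" using s by (intro divide_nonneg_pos) auto
    have "ennreal C * ennreal (2 / (- s)) = ennreal (C * (2 / (- s)))" by (rule ennreal_mult[symmetric, OF C q])
    moreover have "ennreal (C * (2 / (- s))) + ennreal (4 * C) = ennreal (C * (2 / (- s)) + 4 * C)"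
      by (rule ennreal_plus[symmetric, OF mult_nonneg_nonneg[OF C q]]) (use C in simp)
    ultimately show ?thesis by (simp only:)
  qed
  finally show ?thesis by (simp add: mult.commute)
qed

text \<open>A weight that behaves like x^(-1-s) at 0 and x^(-2-s) at infinity. It is integrable for
  -1 < s < 0, x rho(x) tends to 0 at both ends, and integration against the majorant reproduces it
  up to a constant.\<close>

definition rho :: "real \<Rightarrow> real \<Rightarrow> real" where "rho s x = ker s x / (1 + x)"

lemma borel_measurable_rho [measurable]: "rho s \<in> borel_measurable borel"
  unfolding rho_def[abs_def] by measurable

lemma rho_nonneg: "0 \<le> x \<Longrightarrow> 0 \<le> rho s x" unfolding rho_def by simp

lemma rho_antimono:
  assumes s: "- 1 < s" "s < 0" and xy: "0 < y" "y \<le> 2 * x"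
  shows "rho s x \<le> 4 * rho s y"
proof -
  have "ker s x \<le> ker s (y / 2)" using s xy by (intro ker_antimono) auto
  also have "\<dots> = (1 / 2) powr (- 1 - s) * ker s y"
    unfolding ker_def using powr_mult[of "1 / 2" y "- 1 - s"] by simp
  also have "\<dots> \<le> 2 * ker s y"
  proof (intro mult_right_mono)
    have "(1 / 2 :: real) powr (- 1 - s) = 2 powr (1 + s)"
      using powr_minus_divide[of "2::real" "1 + s"] by (simp add: powr_divide)
    also have "\<dots> \<le> 2 powr 1" using s by (intro powr_mono) auto
    finally show "(1 / 2 :: real) powr (- 1 - s) \<le> 2" by simp
  qed simp
  finally have "ker s x * (1 / (1 + x)) \<le> (2 * ker s y) * (2 * (1 / (1 + y)))"
    using xy by (intro mult_mono) (auto simp: field_simps)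
  then show ?thesis by (simp add: rho_def)
qed

text \<open>As x (1 + y) \<le> (1 + x) (x + y), the factor x / (x + y) allows the denominator 1 + x
  of the weight to be exchanged for 1 + y, so the second part of \<open>maj\<close> becomes
  \<open>rho s y\<close> times a kernel in x alone. The first part lives on y \<le> 2 x, where
  \<open>rho_antimono\<close> compares the weights.\<close>

lemma rho_mult_maj_le:
  assumes s: "- 1 < s" "s < 0" and xy: "0 < x" "0 < y"
  shows "rho s x * maj s x y \<le> rho s y * (4 * ker s \<bar>x - y\<bar> + 13 * ker s \<bar>x - 0\<bar>)"
proof -
  have "rho s x * (if y \<le> 2 * x then ker s \<bar>y - x\<bar> else 0) \<le> 4 * rho s y * ker s \<bar>x - y\<bar>"
    using rho_antimono[OF s xy(2), of x] rho_nonneg[of y s] xy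
    by (auto simp: abs_minus_commute intro: mult_right_mono)
  moreover have "rho s x * (13 * ker s y * (x / (x + y))) \<le> 13 * rho s y * ker s \<bar>x - 0\<bar>"
  proof -
    have "x / ((1 + x) * (x + y)) \<le> 1 / (1 + y)"
      using xy by (simp add: divide_simps) (simp add: algebra_simps)
    then have "(13 * ker s x * ker s y) * (x / ((1 + x) * (x + y))) \<le> (13 * ker s x * ker s y) * (1 / (1 + y))"
      by (intro mult_left_mono) auto
    then show ?thesis unfolding rho_def using xy by (simp add: mult_ac)
  qed
  ultimately show ?thesis unfolding maj_def distrib_left by simp
qed

text \<open>The pointwise exchange of weights leaves kernels centred at y and at 0, each integrated
  against h; 17 = 4 + 13.\<close>

lemma schur_weight:
  assumes s: "- 1 < s" "s < 0" and [measurable]: "h \<in> borel_measurable borel"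
    and h: "\<And>x. 0 \<le> h x" "\<And>x. h x \<le> C" "(\<integral>\<^sup>+ x. ennreal (h x) \<partial>lborel) \<le> ennreal (4 * C)"
    and y: "0 < y"
  shows "(\<integral>\<^sup>+ x. ennreal (rho s x * h x * maj s x y) * indicator {0<..} x \<partial>lborel)
    \<le> ennreal (17 * (2 * C / (- s) + 4 * C) * rho s y)"
proof -
  define D where "D = 2 * C / (- s) + 4 * C"
  have C: "0 \<le> C" using h(1,2) order.trans by blast
  have D: "0 \<le> D" unfolding D_def using C s by (intro add_nonneg_nonneg divide_nonneg_pos) auto
  have r: "0 \<le> rho s y" using y by (intro rho_nonneg) auto
  have "(\<integral>\<^sup>+ x. ennreal (rho s x * h x * maj s x y) * indicator {0<..} x \<partial>lborel)
    \<le> (\<integral>\<^sup>+ x. ennreal (4 * rho s y) * ennreal (h x * ker s \<bar>x - y\<bar>) + ennreal (13 * rho s y) * ennreal (h x * ker s \<bar>x - 0\<bar>) \<partial>lborel)"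
  proof (rule nn_integral_mono)
    fix x
    show "ennreal (rho s x * h x * maj s x y) * indicator {0<..} x
      \<le> ennreal (4 * rho s y) * ennreal (h x * ker s \<bar>x - y\<bar>) + ennreal (13 * rho s y) * ennreal (h x * ker s \<bar>x - 0\<bar>)"
    proof (cases "0 < x")
      case True
      have "h x * (rho s x * maj s x y) \<le> h x * (rho s y * (4 * ker s \<bar>x - y\<bar> + 13 * ker s \<bar>x - 0\<bar>))"
        by (intro mult_left_mono rho_mult_maj_le s True y h)
      then have "rho s x * h x * maj s x y \<le> 4 * rho s y * (h x * ker s \<bar>x - y\<bar>) + 13 * rho s y * (h x * ker s \<bar>x - 0\<bar>)"
        by (simp add: algebra_simps)
      then have "ennreal (rho s x * h x * maj s x y) \<le> ennreal (4 * rho s y * (h x * ker s \<bar>x - y\<bar>) + 13 * rho s y * (h x * ker s \<bar>x - 0\<bar>))"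
        by (rule ennreal_leI)
      also have "\<dots> = ennreal (4 * rho s y) * ennreal (h x * ker s \<bar>x - y\<bar>) + ennreal (13 * rho s y) * ennreal (h x * ker s \<bar>x - 0\<bar>)"
        using r h(1)[of x] by (subst ennreal_plus) (auto simp: ennreal_mult simp del: ennreal_plus)
      finally show ?thesis using True by simp
    qed simp
  qed
  also have "\<dots> = ennreal (4 * rho s y) * (\<integral>\<^sup>+ x. ennreal (h x * ker s \<bar>x - y\<bar>) \<partial>lborel)
      + ennreal (13 * rho s y) * (\<integral>\<^sup>+ x. ennreal (h x * ker s \<bar>x - 0\<bar>) \<partial>lborel)"
    by (subst nn_integral_add) (auto simp: nn_integral_cmult)
  also have "\<dots> \<le> ennreal (4 * rho s y) * ennreal D + ennreal (13 * rho s y) * ennreal D"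
    unfolding D_def by (intro add_mono mult_left_mono nn_integral_mult_ker_le s h assms(3)) auto
  also have "\<dots> = ennreal (17 * D * rho s y)"
    using r D by (simp add: distrib_right mult_ac flip: ennreal_mult ennreal_plus)
  finally show ?thesis unfolding D_def .
qed

text \<open>By Tonelli the integration in x is done first, for fixed y, where
  \<open>schur_weight\<close> applies. In the application W is |w|, and the left-hand side dominates
  the source term in the weighted norm.\<close>

lemma schur_test:
  assumes s: "- 1 < s" "s < 0" and [measurable]: "h \<in> borel_measurable borel" "W \<in> borel_measurable borel"
    and h: "\<And>x. 0 \<le> h x" "\<And>x. h x \<le> C" "(\<integral>\<^sup>+ x. ennreal (h x) \<partial>lborel) \<le> ennreal (4 * C)"
    and W: "\<And>y. 0 \<le> W y"
  shows "(\<integral>\<^sup>+ x. ennreal (rho s x * h x) * indicator {0<..} x * (\<integral>\<^sup>+ y. ennreal (W y * maj s x y) * indicator {0<..} y \<partial>lborel) \<partial>lborel)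
    \<le> ennreal (17 * (2 * C / (- s) + 4 * C)) * (\<integral>\<^sup>+ y. ennreal (W y * rho s y) * indicator {0<..} y \<partial>lborel)"
proof -
  define D where "D = 17 * (2 * C / (- s) + 4 * C)"
  have C: "0 \<le> C" using h(1,2) order.trans by blast
  have D: "0 \<le> D" unfolding D_def using C s by (intro mult_nonneg_nonneg add_nonneg_nonneg divide_nonneg_pos) auto
  have [measurable]: "(\<lambda>y. maj s x y) \<in> borel_measurable borel" "(\<lambda>x. maj s x y) \<in> borel_measurable borel" for x y
    by measurable
  have maj0: "0 \<le> maj s x y" if "0 < x" "0 < y" for x y unfolding maj_def using that by simp
  have "(\<integral>\<^sup>+ x. ennreal (rho s x * h x) * indicator {0<..} x * (\<integral>\<^sup>+ y. ennreal (W y * maj s x y) * indicator {0<..} y \<partial>lborel) \<partial>lborel)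
    = (\<integral>\<^sup>+ x. (\<integral>\<^sup>+ y. (ennreal (rho s x * h x) * indicator {0<..} x) * (ennreal (W y * maj s x y) * indicator {0<..} y) \<partial>lborel) \<partial>lborel)"
    by (subst nn_integral_cmult) auto
  also have "\<dots> = (\<integral>\<^sup>+ y. (\<integral>\<^sup>+ x. (ennreal (rho s x * h x) * indicator {0<..} x) * (ennreal (W y * maj s x y) * indicator {0<..} y) \<partial>lborel) \<partial>lborel)"
    by (rule lborel_pair.Fubini'[symmetric]) measurable
  also have "\<dots> \<le> (\<integral>\<^sup>+ y. ennreal D * (ennreal (W y * rho s y) * indicator {0<..} y) \<partial>lborel)"
  proof (rule nn_integral_mono)
    fix y
    show "(\<integral>\<^sup>+ x. (ennreal (rho s x * h x) * indicator {0<..} x) * (ennreal (W y * maj s x y) * indicator {0<..} y) \<partial>lborel)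
      \<le> ennreal D * (ennreal (W y * rho s y) * indicator {0<..} y)"
    proof (cases "0 < y")
      case True
      have "(\<integral>\<^sup>+ x. (ennreal (rho s x * h x) * indicator {0<..} x) * (ennreal (W y * maj s x y) * indicator {0<..} y) \<partial>lborel)
        = (\<integral>\<^sup>+ x. ennreal (W y) * (ennreal (rho s x * h x * maj s x y) * indicator {0<..} x) \<partial>lborel)"
      proof (rule nn_integral_cong)
        fix x :: real
        show "(ennreal (rho s x * h x) * indicator {0<..} x) * (ennreal (W y * maj s x y) * indicator {0<..} y)
          = ennreal (W y) * (ennreal (rho s x * h x * maj s x y) * indicator {0<..} x)"
          using True W[of y] h(1)[of x] maj0[of x y] rho_nonneg[of x s]
          by (cases "0 < x") (auto simp: mult_ac simp flip: ennreal_mult)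
      qed
      also have "\<dots> = ennreal (W y) * (\<integral>\<^sup>+ x. ennreal (rho s x * h x * maj s x y) * indicator {0<..} x \<partial>lborel)"
        by (rule nn_integral_cmult) auto
      also have "\<dots> \<le> ennreal (W y) * ennreal (D * rho s y)"
        unfolding D_def by (intro mult_left_mono schur_weight s h True assms(3)) auto
      also have "\<dots> = ennreal D * (ennreal (W y * rho s y) * indicator {0<..} y)"
        using True W[of y] D rho_nonneg[of y s] by (simp add: mult_ac flip: ennreal_mult)
      finally show ?thesis .
    qed simp
  qed
  also have "\<dots> = ennreal D * (\<integral>\<^sup>+ y. ennreal (W y * rho s y) * indicator {0<..} y \<partial>lborel)"
    by (rule nn_integral_cmult) auto
  finally show ?thesis unfolding D_def .
qed

lemma nn_integral_rho_le:
  assumes s: "- 1 < s" "s < 0"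
  shows "(\<integral>\<^sup>+ x. ennreal (rho s x) * indicator {0<..} x \<partial>lborel) \<le> ennreal (1 / (- s) + 1 / (1 + s))"
proof -
  have "((\<lambda>x. x powr (- 2 - s)) has_integral - (1 powr (- 2 - s + 1)) / (- 2 - s + 1)) {1..}"
    using s by (intro has_integral_powr_to_inf) auto
  from nn_integral_has_integral_lebesgue'[OF _ this]
  have I: "(\<integral>\<^sup>+ x. ennreal (x powr (- 2 - s)) * indicator {1..} x \<partial>lborel) = ennreal (1 / (1 + s))"
    using s by (simp add: minus_divide_divide[of 1 "1 + s", symmetric] del: minus_divide_divide)
  have "(\<integral>\<^sup>+ x. ennreal (rho s x) * indicator {0<..} x \<partial>lborel)
    \<le> (\<integral>\<^sup>+ x. ennreal (ker s x) * indicator {0..1} x + ennreal (x powr (- 2 - s)) * indicator {1..} x \<partial>lborel)"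
  proof (rule nn_integral_mono)
    fix x :: real
    consider "x \<le> 0" | "0 < x" "x \<le> 1" | "1 < x" by linarith
    then show "ennreal (rho s x) * indicator {0<..} x \<le> ennreal (ker s x) * indicator {0..1} x + ennreal (x powr (- 2 - s)) * indicator {1..} x"
    proof cases
      case 2
      have "rho s x \<le> ker s x / 1" unfolding rho_def using 2 by (intro divide_left_mono) auto
      then have "rho s x \<le> ker s x" by simp
      then show ?thesis using 2 by (auto intro: order.trans[OF ennreal_leI] simp: indicator_def)
    next
      case 3
      have "rho s x \<le> ker s x / x" unfolding rho_def using 3 by (intro divide_left_mono) auto
      also have "\<dots> = x powr (- 2 - s)"
        unfolding ker_def using 3 by (simp add: powr_diff powr_minus field_simps power2_eq_square powr_numeral)
      finally show ?thesis using 3 by (simp add: ennreal_leI)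
    qed simp
  qed
  also have "\<dots> = ennreal (1 / (- s)) + ennreal (1 / (1 + s))"
    by (subst nn_integral_add) (auto simp: nn_integral_ker_unit[OF s(2)] I)
  also have "\<dots> = ennreal (1 / (- s) + 1 / (1 + s))"
    using s by (intro ennreal_plus[symmetric]) (auto simp: divide_nonpos_neg)
  finally show ?thesis .
qed

section \<open>Differentiation along a curve and variation on the whole line\<close>

context transport
begin

text \<open>Total differentiability on [0, T] times the line follows from the t-derivative at the
  point and joint continuity of the x-derivative; then the chain rule applies to the graph of
  c.\<close>

lemma deriv_along:
  assumes t: "t \<in> {0..T}" and c: "(c has_real_derivative c') (at t within {0..T})"
  shows "((\<lambda>\<tau>. \<theta> \<tau> (c \<tau>)) has_real_derivative \<theta>t t (c t) + c' * \<theta>x t (c t)) (at t within {0..T})"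
proof -
  have "((\<lambda>(\<tau>, x). \<theta> \<tau> x) has_derivative (\<lambda>(h, k). \<theta>t t (c t) * h + blinfun_apply (blinfun_mult_right (\<theta>x t (c t))) k))
      (at (t, c t) within {0..T} \<times> UNIV)"
  proof (rule has_derivative_partialsI)
    show "((\<lambda>\<tau>. \<theta> \<tau> (c t)) has_derivative (\<lambda>h. \<theta>t t (c t) * h)) (at t within {0..T})"
      using deriv_t[OF t] unfolding has_field_derivative_def .
    show "((\<lambda>x. \<theta> \<tau> x) has_derivative blinfun_apply (blinfun_mult_right (\<theta>x \<tau> x))) (at x within UNIV)"
      if "\<tau> \<in> {0..T}" "x \<in> UNIV" for \<tau> x
      using deriv_x[OF that(1)] unfolding has_field_derivative_def by simp
    have "continuous_on ({0..T} \<times> UNIV) (\<lambda>q. blinfun_mult_right ((\<lambda>(\<tau>, x). \<theta>x \<tau> x) q))"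
      by (intro bounded_linear.continuous_on[OF bounded_linear_blinfun_mult_right] cont_x)
    then show "continuous (at (t, c t) within {0..T} \<times> UNIV) (\<lambda>(\<tau>, x). blinfun_mult_right (\<theta>x \<tau> x))"
      using t by (auto simp: continuous_on_eq_continuous_within case_prod_unfold)
  qed auto
  then have "((\<lambda>(\<tau>, x). \<theta> \<tau> x) has_derivative (\<lambda>(h, k). \<theta>t t (c t) * h + \<theta>x t (c t) * k))
      (at (t, c t) within {0..T} \<times> UNIV)" by simp
  then have joint: "((\<lambda>(\<tau>, x). \<theta> \<tau> x) has_derivative (\<lambda>(h, k). \<theta>t t (c t) * h + \<theta>x t (c t) * k))
      (at (t, c t) within (\<lambda>\<tau>. (\<tau>, c \<tau>)) ` {0..T})"
    by (rule has_derivative_subset) auto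
  have "((\<lambda>\<tau>. (\<tau>, c \<tau>)) has_derivative (\<lambda>h. (h, c' * h))) (at t within {0..T})"
    using c unfolding has_field_derivative_def by (intro has_derivative_Pair has_derivative_ident)
  from has_derivative_in_compose[OF this joint]
  have "((\<lambda>\<tau>. \<theta> \<tau> (c \<tau>)) has_derivative (\<lambda>h. \<theta>t t (c t) * h + \<theta>x t (c t) * (c' * h))) (at t within {0..T})"
    by simp
  moreover have "(\<lambda>h. \<theta>t t (c t) * h + \<theta>x t (c t) * (c' * h)) = (*) (\<theta>t t (c t) + c' * \<theta>x t (c t))"
    by (auto simp: algebra_simps)
  ultimately show ?thesis unfolding has_field_derivative_def by (simp only:)
qed

end

lemma (in bump_bounded) nn_total_variation:
  assumes t: "t \<in> {0..T}"
  shows "(\<integral>\<^sup>+ x. ennreal \<bar>\<theta>x t x\<bar> \<partial>lborel) \<le> ennreal (4 * C)"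
proof -
  have [measurable]: "\<theta>x t \<in> borel_measurable borel"
    using continuous_\<theta>x[OF t] by (rule borel_measurable_continuous_onI)
  have "(\<integral>\<^sup>+ x. ennreal \<bar>\<theta>x t x\<bar> \<partial>lborel) = (\<integral>\<^sup>+ x. (SUP n. ennreal \<bar>\<theta>x t x\<bar> * indicator {- real n..real n} x) \<partial>lborel)"
  proof (rule nn_integral_cong)
    fix x
    show "ennreal \<bar>\<theta>x t x\<bar> = (SUP n. ennreal \<bar>\<theta>x t x\<bar> * indicator {- real n..real n} x)"
    proof (rule antisym)
      obtain n where "\<bar>x\<bar> \<le> real n" using real_arch_simple by blast
      then have "x \<in> {- real n..real n}" by auto
      then show "ennreal \<bar>\<theta>x t x\<bar> \<le> (SUP n. ennreal \<bar>\<theta>x t x\<bar> * indicator {- real n..real n} x)"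
        by (intro SUP_upper2[of n]) auto
    qed (auto intro!: SUP_least simp: indicator_def)
  qed
  also have "\<dots> = (SUP n. \<integral>\<^sup>+ x. ennreal \<bar>\<theta>x t x\<bar> * indicator {- real n..real n} x \<partial>lborel)"
    by (rule nn_integral_monotone_convergence_SUP) (auto simp: incseq_def le_fun_def indicator_def)
  also have "\<dots> \<le> ennreal (4 * C)"
  proof (rule SUP_least)
    fix n
    have "((\<lambda>x. \<bar>\<theta>x t x\<bar>) has_integral integral {- real n..real n} (\<lambda>x. \<bar>\<theta>x t x\<bar>)) {- real n..real n}"
      by (intro integrable_integral integrable_continuous_interval continuous_intros continuous_\<theta>x t)
    from nn_integral_has_integral_lebesgue'[OF _ this]
    have "(\<integral>\<^sup>+ x. ennreal \<bar>\<theta>x t x\<bar> * indicator {- real n..real n} x \<partial>lborel) = ennreal (integral {- real n..real n} (\<lambda>x. \<bar>\<theta>x t x\<bar>))" by simp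
    then show "(\<integral>\<^sup>+ x. ennreal \<bar>\<theta>x t x\<bar> * indicator {- real n..real n} x \<partial>lborel) \<le> ennreal (4 * C)"
      using total_variation[OF t, of "- real n" "real n"] by (simp add: ennreal_leI)
  qed
  finally show ?thesis .
qed

section \<open>Persistence of evenness for s < 0\<close>

locale centered = bump_bounded +
  fixes c :: "real \<Rightarrow> real"
  assumes s0: "s < 0" and c0: "c 0 = 0"
    and c: "t \<in> {0..T} \<Longrightarrow> (c has_real_derivative u t (c t)) (at t within {0..T})"
begin

text \<open>The odd part \<open>w\<close> of \<open>\<theta>\<close> about the trajectory \<open>c\<close> is transported with velocity \<open>p\<close>; the source
  involves \<open>v\<close>, which depends linearly on \<open>w\<close> itself. So evenness of the initial values persists.\<close>

definition "w t y = \<theta> t (c t + y) - \<theta> t (c t - y)"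
definition "wx t y = \<theta>x t (c t + y) + \<theta>x t (c t - y)"
definition "p t y = u t (c t + y) - u t (c t)"
definition "v t y = u t (c t + y) + u t (c t - y) - 2 * u t (c t)"
definition "wt t y = - p t y * wx t y + v t y * \<theta>x t (c t - y)"

lemma continuous_c: "continuous_on {0..T} c"
  unfolding continuous_on_eq_continuous_within by (intro ballI DERIV_continuous[OF c])

lemma continuous_u:
  assumes "continuous_on X f" "continuous_on X g" "f ` X \<subseteq> {0..T}"
  shows "continuous_on X (\<lambda>q. u (f q) (g q))"
proof -
  have "continuous_on X (\<lambda>q. (f q, g q))" by (intro continuous_intros assms)
  then have "continuous_on X (\<lambda>q. case (f q, g q) of (t, x) \<Rightarrow> u t x)"
    by (rule continuous_on_compose2[OF velocity_continuous[OF s0]]) (use assms(3) in auto)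
  then show ?thesis by simp
qed

lemma continuous_w:
  assumes "continuous_on X f" "continuous_on X g" "f ` X \<subseteq> {0..T}"
  shows "continuous_on X (\<lambda>q. w (f q) (g q))" "continuous_on X (\<lambda>q. wx (f q) (g q))"
    "continuous_on X (\<lambda>q. p (f q) (g q))" "continuous_on X (\<lambda>q. v (f q) (g q))" "continuous_on X (\<lambda>q. wt (f q) (g q))"
proof -
  have cf: "continuous_on X (\<lambda>q. c (f q))" by (rule continuous_on_compose2[OF continuous_c assms(1,3)])
  note ci = continuous_intros continuous_comp continuous_u cf assms
  show 1: "continuous_on X (\<lambda>q. w (f q) (g q))" unfolding w_def by (intro ci)
  show 2: "continuous_on X (\<lambda>q. wx (f q) (g q))" unfolding wx_def by (intro ci)
  show 3: "continuous_on X (\<lambda>q. p (f q) (g q))" unfolding p_def by (intro ci)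
  show 4: "continuous_on X (\<lambda>q. v (f q) (g q))" unfolding v_def by (intro ci)
  show "continuous_on X (\<lambda>q. wt (f q) (g q))" unfolding wt_def by (intro continuous_intros 2 3 4 continuous_comp cf assms)
qed

lemma continuous_w_x:
  assumes "t \<in> {0..T}" "continuous_on X g"
  shows "continuous_on X (\<lambda>y. w t (g y))" "continuous_on X (\<lambda>y. wx t (g y))" "continuous_on X (\<lambda>y. p t (g y))"
    "continuous_on X (\<lambda>y. v t (g y))" "continuous_on X (\<lambda>y. wt t (g y))" "continuous_on X (\<lambda>y. \<theta>x t (c t - g y))"
proof -
  have im: "(\<lambda>_. t) ` X \<subseteq> {0..T}" using assms(1) by auto
  show "continuous_on X (\<lambda>y. w t (g y))" "continuous_on X (\<lambda>y. wx t (g y))" "continuous_on X (\<lambda>y. p t (g y))"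
    "continuous_on X (\<lambda>y. v t (g y))" "continuous_on X (\<lambda>y. wt t (g y))"
    by (rule continuous_w[OF continuous_on_const assms(2) im])+
  show "continuous_on X (\<lambda>y. \<theta>x t (c t - g y))"
    by (intro continuous_comp(3) continuous_intros assms(2) im)
qed

lemma w_bound: "t \<in> {0..T} \<Longrightarrow> \<bar>w t y\<bar> \<le> 2 * C"
  unfolding w_def using bound(1)[of t "c t + y"] bound(1)[of t "c t - y"] by linarith

lemma p_bound: "t \<in> {0..T} \<Longrightarrow> 0 \<le> y \<Longrightarrow> \<bar>p t y\<bar> \<le> Lip * y"
  unfolding p_def using velocity_Lipschitz[OF s0, of t "c t + y" "c t"] by simp

lemma w_x_deriv: "t \<in> {0..T} \<Longrightarrow> (w t has_real_derivative wx t y) (at y)"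
  unfolding w_def wx_def
  by (auto intro!: derivative_eq_intros DERIV_chain'[OF _ deriv_x])

text \<open>In the moving frame the velocities are u(c + y) - u(c) = p and u(c - y) - u(c) = v - p.
  Collecting the terms with p gives transport of w, and v remains as the source.\<close>

lemma w_t_deriv:
  assumes t: "t \<in> {0..T}"
  shows "((\<lambda>\<tau>. w \<tau> y) has_real_derivative wt t y) (at t within {0..T})"
proof -
  have d: "((\<lambda>\<tau>. c \<tau> + y) has_real_derivative u t (c t)) (at t within {0..T})"
    "((\<lambda>\<tau>. c \<tau> - y) has_real_derivative u t (c t)) (at t within {0..T})"
    using c[OF t] by (auto intro!: derivative_eq_intros)
  have "((\<lambda>\<tau>. w \<tau> y) has_real_derivative (\<theta>t t (c t + y) + u t (c t) * \<theta>x t (c t + y))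
      - (\<theta>t t (c t - y) + u t (c t) * \<theta>x t (c t - y))) (at t within {0..T})"
    unfolding w_def by (intro DERIV_diff deriv_along[OF t d(1)] deriv_along[OF t d(2)])
  moreover have "(\<theta>t t (c t + y) + u t (c t) * \<theta>x t (c t + y)) - (\<theta>t t (c t - y) + u t (c t) * \<theta>x t (c t - y)) = wt t y"
    using pde[OF t, of "c t + y"] pde[OF t, of "c t - y"] unfolding wt_def p_def wx_def v_def by (simp add: algebra_simps)
  ultimately show ?thesis by simp
qed

lemma w_0: "w 0 y = 0"
  unfolding w_def c0 by (simp add: even0)

text \<open>The weighted L1 norm of w. The extended version is suited to Tonelli and monotone
  convergence, the real version \<open>N\<close> to the Gronwall argument.\<close>

definition "Nn t = (\<integral>\<^sup>+ y. ennreal (\<bar>w t y\<bar> * rho s y) * indicator {0<..} y \<partial>lborel)"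
definition "N t = enn2real (Nn t)"

lemma w_measurable [measurable]: "t \<in> {0..T} \<Longrightarrow> w t \<in> borel_measurable borel"
  using continuous_w_x(1)[of t UNIV "\<lambda>y. y"] by (auto intro: borel_measurable_continuous_onI continuous_on_id)

lemma Nn_bound:
  assumes t: "t \<in> {0..T}"
  shows "Nn t \<le> ennreal (2 * C * (1 / (- s) + 1 / (1 + s)))"
proof -
  have "Nn t \<le> (\<integral>\<^sup>+ y. ennreal (2 * C) * (ennreal (rho s y) * indicator {0<..} y) \<partial>lborel)"
    unfolding Nn_def
  proof (rule nn_integral_mono)
    fix y
    show "ennreal (\<bar>w t y\<bar> * rho s y) * indicator {0<..} y \<le> ennreal (2 * C) * (ennreal (rho s y) * indicator {0<..} y)"
      using mult_right_mono[OF w_bound[OF t, of y], of "rho s y"] rho_nonneg[of y s] C_nonneg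
      by (cases "0 < y") (auto simp: ennreal_leI simp flip: ennreal_mult)
  qed
  also have "\<dots> = ennreal (2 * C) * (\<integral>\<^sup>+ y. ennreal (rho s y) * indicator {0<..} y \<partial>lborel)"
    by (rule nn_integral_cmult) auto
  also have "\<dots> \<le> ennreal (2 * C) * ennreal (1 / (- s) + 1 / (1 + s))"
    by (intro mult_left_mono nn_integral_rho_le s s0) auto
  also have "\<dots> = ennreal (2 * C * (1 / (- s) + 1 / (1 + s)))"
    using C_nonneg s s0 by (intro ennreal_mult[symmetric] add_nonneg_nonneg divide_nonneg_pos) auto
  finally show ?thesis .
qed

lemma N_bounds: assumes "t \<in> {0..T}" shows "Nn t = ennreal (N t)" "0 \<le> N t" "N t \<le> 2 * C * (1 / (- s) + 1 / (1 + s))"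
proof -
  have b: "0 \<le> 2 * C * (1 / (- s) + 1 / (1 + s))"
    using C_nonneg s s0 by (intro mult_nonneg_nonneg add_nonneg_nonneg divide_nonneg_pos) auto
  have "Nn t < top" using Nn_bound[OF assms] by (rule order.strict_trans1) simp
  then show 1: "Nn t = ennreal (N t)" unfolding N_def by simp
  show "0 \<le> N t" unfolding N_def by simp
  show "N t \<le> 2 * C * (1 / (- s) + 1 / (1 + s))"
    using Nn_bound[OF assms] unfolding 1 using b by (subst (asm) ennreal_le_iff) auto
qed

lemma continuous_rho: "0 < a \<Longrightarrow> continuous_on {a..b} (rho s)"
  unfolding rho_def[abs_def] by (intro continuous_intros) auto

lemma weighted_w_le_N:
  assumes t: "t \<in> {0..T}" and a: "0 < a"
  shows "integral {a..b} (\<lambda>y. \<bar>w t y\<bar> * rho s y) \<le> N t"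
proof -
  have "ennreal \<bar>integral {a..b} (\<lambda>y. \<bar>w t y\<bar> * rho s y)\<bar>
    \<le> (\<integral>\<^sup>+ y. ennreal \<bar>\<bar>w t y\<bar> * rho s y\<bar> * indicator {a..b} y \<partial>lborel)"
    by (intro ennreal_abs_integral_le continuous_intros continuous_w_x t continuous_rho a)
  also have "\<dots> \<le> Nn t"
    unfolding Nn_def
    by (rule nn_integral_mono) (use a rho_nonneg[of _ s] in \<open>auto simp: indicator_def abs_mult\<close>)
  finally have "ennreal \<bar>integral {a..b} (\<lambda>y. \<bar>w t y\<bar> * rho s y)\<bar> \<le> ennreal (N t)" unfolding N_bounds(1)[OF t] .
  then show ?thesis using N_bounds(2)[OF t] by (subst (asm) ennreal_le_iff) auto
qed

definition "SC = kappa s * (17 * (2 * C / (- s) + 4 * C))"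

lemma SC_nonneg: "0 \<le> SC"
  unfolding SC_def using kappa_pos[OF s] C_nonneg s0
  by (intro mult_nonneg_nonneg add_nonneg_nonneg divide_nonneg_pos) auto

text \<open>The function v is dominated by w integrated against \<open>maj\<close>; Schur's test
  with h = |\<theta>x(c - y)| then returns the norm of w. This closes the estimate.\<close>

lemma source_le_N:
  assumes t: "t \<in> {0..T}" and a: "0 < a"
  shows "integral {a..b} (\<lambda>y. \<bar>v t y * \<theta>x t (c t - y)\<bar> * rho s y) \<le> SC * N t"
proof -
  define h where "h = (\<lambda>y. \<bar>\<theta>x t (c t - y)\<bar>)"
  have hc: "continuous_on UNIV h" unfolding h_def by (intro continuous_intros continuous_w_x t)
  have [measurable]: "h \<in> borel_measurable borel" using hc by (rule borel_measurable_continuous_onI)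
  have mx: "\<theta>x t \<in> borel_measurable borel" using continuous_\<theta>x[OF t] by (rule borel_measurable_continuous_onI)
  have h: "0 \<le> h y" "h y \<le> C" for y unfolding h_def using bound(2)[OF t] by auto
  have hI: "(\<integral>\<^sup>+ y. ennreal (h y) \<partial>lborel) \<le> ennreal (4 * C)"
  proof -
    have "(\<integral>\<^sup>+ y. ennreal (h y) \<partial>lborel) = (\<integral>\<^sup>+ x. ennreal \<bar>\<theta>x t x\<bar> \<partial>lborel)"
      using nn_integral_real_affine[where t = "c t" and c = "- 1" and f = "\<lambda>x. ennreal \<bar>\<theta>x t x\<bar>"] mx by (simp add: h_def)
    then show ?thesis using nn_total_variation[OF t] by simp
  qed
  have [measurable]: "(\<lambda>y. maj s x y) \<in> borel_measurable borel" for x by measurable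
  have [measurable]: "(\<lambda>y. \<bar>w t y\<bar>) \<in> borel_measurable borel" using w_measurable[OF t] by measurable
  define V where "V = (\<lambda>x. \<integral>\<^sup>+ y. ennreal (\<bar>w t y\<bar> * maj s x y) * indicator {0<..} y \<partial>lborel)"
  have V: "ennreal \<bar>v t x\<bar> \<le> ennreal (kappa s) * V x" if "0 < x" for x
    unfolding V_def v_def w_def
    by (rule Lambda_H_second_difference[OF s(1) s0 continuous_x[OF t] bound(1)[OF t] vel[OF t] vel[OF t] vel[OF t] that])
  have [measurable]: "V \<in> borel_measurable borel"
    unfolding V_def by measurable
  have "ennreal \<bar>integral {a..b} (\<lambda>y. \<bar>v t y * \<theta>x t (c t - y)\<bar> * rho s y)\<bar>
    \<le> (\<integral>\<^sup>+ y. ennreal \<bar>\<bar>v t y * \<theta>x t (c t - y)\<bar> * rho s y\<bar> * indicator {a..b} y \<partial>lborel)"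
    by (intro ennreal_abs_integral_le continuous_intros continuous_w_x t continuous_rho a)
  also have "\<dots> \<le> (\<integral>\<^sup>+ x. ennreal (kappa s) * (ennreal (rho s x * h x) * indicator {0<..} x * V x) \<partial>lborel)"
  proof (rule nn_integral_mono)
    fix y
    show "ennreal \<bar>\<bar>v t y * \<theta>x t (c t - y)\<bar> * rho s y\<bar> * indicator {a..b} y
      \<le> ennreal (kappa s) * (ennreal (rho s y * h y) * indicator {0<..} y * V y)"
    proof (cases "y \<in> {a..b}")
      case True
      then have y: "0 < y" using a by auto
      have eq: "\<bar>\<bar>v t y * \<theta>x t (c t - y)\<bar> * rho s y\<bar> = (rho s y * h y) * \<bar>v t y\<bar>"
        unfolding h_def using rho_nonneg[of y s] y by (simp add: abs_mult)
      have "ennreal \<bar>\<bar>v t y * \<theta>x t (c t - y)\<bar> * rho s y\<bar> = ennreal (rho s y * h y) * ennreal \<bar>v t y\<bar>"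
        unfolding eq using rho_nonneg[of y s] y h(1)[of y] by (intro ennreal_mult) auto
      also have "\<dots> \<le> ennreal (rho s y * h y) * (ennreal (kappa s) * V y)" by (intro mult_left_mono V y) auto
      finally show ?thesis using True y by (simp add: mult_ac)
    qed simp
  qed
  also have "\<dots> = ennreal (kappa s) * (\<integral>\<^sup>+ x. ennreal (rho s x * h x) * indicator {0<..} x * V x \<partial>lborel)"
    by (rule nn_integral_cmult) auto
  also have "\<dots> \<le> ennreal (kappa s) * (ennreal (17 * (2 * C / (- s) + 4 * C)) * Nn t)"
    unfolding V_def Nn_def by (intro mult_left_mono schur_test s s0 h hI) auto
  also have "\<dots> = ennreal (SC * N t)"
  proof -
    define D where "D = 17 * (2 * C / (- s) + 4 * C)"
    have "0 \<le> D" unfolding D_def using C_nonneg s0 by (intro mult_nonneg_nonneg add_nonneg_nonneg divide_nonneg_pos) auto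
    then show ?thesis
      unfolding SC_def N_bounds(1)[OF t] D_def[symmetric] using kappa_pos[OF s] N_bounds(2)[OF t] by (simp add: ennreal_mult mult.assoc)
  qed
  finally show ?thesis using N_bounds(2)[OF t] SC_nonneg by (subst (asm) ennreal_le_iff) auto
qed

end

section \<open>The Gronwall estimate for the weighted norm\<close>

lemma rho_has_derivative:
  assumes "0 < y"
  shows "(rho s has_real_derivative - ((1 + s) * y powr (- 2 - s) / (1 + y) + ker s y / (1 + y)\<^sup>2)) (at y)"
proof -
  have "((\<lambda>y. ker s y / (1 + y)) has_real_derivative
      ((- (1 + s) * y powr (- 2 - s)) * (1 + y) - ker s y * 1) / ((1 + y) * (1 + y))) (at y)"
    using assms by (intro DERIV_divide ker_has_derivative) (auto intro!: derivative_eq_intros)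
  moreover have "((- (1 + s) * y powr (- 2 - s)) * (1 + y) - ker s y * 1) / ((1 + y) * (1 + y))
      = - ((1 + s) * y powr (- 2 - s) / (1 + y) + ker s y / (1 + y)\<^sup>2)"
  proof -
    define D where "D = 1 + y"
    have "D \<noteq> 0" using assms by (simp add: D_def)
    moreover define q where "q = 1 + s"
    ultimately show ?thesis unfolding D_def[symmetric] q_def[symmetric] by (simp add: diff_divide_distrib power2_eq_square)
  qed
  ultimately show ?thesis by (simp add: rho_def[abs_def])
qed

text \<open>As p is Lipschitz and vanishes at 0, the derivative of the weight occurs with a factor
  y, and y |rho'| is controlled by rho.\<close>

lemma rho_derivative_bound:
  assumes s: "- 1 < s" "s < 0" and y: "0 < y"
  shows "y * ((1 + s) * y powr (- 2 - s) / (1 + y) + ker s y / (1 + y)\<^sup>2) \<le> 2 * rho s y"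
proof -
  have k: "y * y powr (- 2 - s) = ker s y"
    using y unfolding ker_def by (subst powr_mult_base) (auto intro: arg_cong[where f = "\<lambda>p. y powr p"])
  have "y * ((1 + s) * y powr (- 2 - s) / (1 + y)) = (1 + s) * (y * y powr (- 2 - s)) / (1 + y)" by simp
  also have "\<dots> = (1 + s) * rho s y" unfolding k rho_def by simp
  also have "\<dots> \<le> 1 * rho s y" using s y by (intro mult_right_mono rho_nonneg) auto
  finally have 1: "y * ((1 + s) * y powr (- 2 - s) / (1 + y)) \<le> rho s y" by simp
  have "y * (ker s y / (1 + y)\<^sup>2) = (y / (1 + y)) * rho s y"
    unfolding rho_def by (simp add: power2_eq_square)
  also have "\<dots> \<le> 1 * rho s y" using y by (intro mult_right_mono rho_nonneg) auto
  finally show ?thesis using 1 by (simp add: distrib_left)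
qed

context centered
begin

text \<open>One Lipschitz constant comes from the variation of p in the integration by parts, two
  from the derivative of the weight; \<open>SC\<close> is the source.\<close>

definition "K3 = 3 * Lip + SC"

lemma K3_nonneg: "0 \<le> K3" unfolding K3_def using Lip_nonneg[OF s0] SC_nonneg by simp

text \<open>The factor \<open>z / sqrt (z\<^sup>2 + e\<^sup>2)\<close> is the derivative of \<open>sqrt (z\<^sup>2 + e\<^sup>2) - e\<close>, a smooth substitute
  for \<open>\<bar>z\<bar>\<close>.\<close>

lemma regularized_rate:
  assumes t: "t \<in> {0..T}" and e: "0 < e" and ab: "0 < a" "a \<le> b"
  shows "integral {a..b} (\<lambda>y. w t y / sqrt ((w t y)\<^sup>2 + e\<^sup>2) * wt t y * rho s y)
    \<le> Lip * (2 * C) * (a * rho s a + b * rho s b) + K3 * N t"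
proof -
  define \<phi> where "\<phi> = (\<lambda>z. sqrt (z\<^sup>2 + e\<^sup>2) - e)"
  define \<psi> where "\<psi> = (\<lambda>z. z / sqrt (z\<^sup>2 + e\<^sup>2))"
  have q: "0 < z\<^sup>2 + e\<^sup>2" for z using e by (simp add: add_nonneg_pos)
  have \<phi>d: "(\<phi> has_real_derivative \<psi> z) (at z)" for z
    unfolding \<phi>_def \<psi>_def using q[of z] by (auto intro!: derivative_eq_intros simp: field_simps)
  have \<phi>0: "0 \<le> \<phi> z" for z
    unfolding \<phi>_def using real_sqrt_le_mono[of "e\<^sup>2" "z\<^sup>2 + e\<^sup>2"] e by simp
  have \<phi>1: "\<phi> z \<le> \<bar>z\<bar>" for z
    unfolding \<phi>_def using sqrt_sum_squares_le_sum_abs[of z e] e by simp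
  have \<psi>1: "\<bar>\<psi> z\<bar> \<le> 1" for z
  proof -
    have "\<bar>z\<bar> \<le> sqrt (z\<^sup>2 + e\<^sup>2)" using real_sqrt_le_mono[of "z\<^sup>2" "z\<^sup>2 + e\<^sup>2"] by simp
    then show ?thesis unfolding \<psi>_def using q[of z] by (simp add: divide_le_eq)
  qed
  define \<rho>' where "\<rho>' = (\<lambda>y. - ((1 + s) * y powr (- 2 - s) / (1 + y) + ker s y / (1 + y)\<^sup>2))"
  define f where "f = (\<lambda>y. \<phi> (w t y) * rho s y)"
  define f' where "f' = (\<lambda>y. \<psi> (w t y) * wx t y * rho s y + \<phi> (w t y) * \<rho>' y)"
  define g where "g = (\<lambda>y. v t y * \<theta>x t (c t - y))"
  have pos: "0 < y" "0 \<le> rho s y" if "y \<in> {a..b}" for y using that ab by (auto intro!: rho_nonneg)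
  have wc: "continuous_on X (w t)" "continuous_on X (wx t)" "continuous_on X (p t)" "continuous_on X (wt t)" "continuous_on X g" for X
    unfolding g_def by (intro continuous_intros continuous_w_x t | rule continuous_w_x[OF t continuous_on_id])+
  have \<phi>c: "continuous_on X (\<lambda>y. \<phi> (w t y))" "continuous_on X (\<lambda>y. \<psi> (w t y))" for X
    unfolding \<phi>_def \<psi>_def using q by (auto intro!: continuous_intros wc simp: less_imp_neq[symmetric])
  have rc: "continuous_on {a..b} (rho s)" by (rule continuous_rho[OF ab(1)])
  have r'c: "continuous_on {a..b} \<rho>'"
    unfolding \<rho>'_def using ab by (intro continuous_intros) (auto simp: add_pos_nonneg[THEN less_imp_neq[THEN not_sym]])
  note ci = continuous_intros wc \<phi>c rc r'c
  have fd: "(f has_real_derivative f' y) (at y)" if "y \<in> {a..b}" for y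
    unfolding f_def f'_def \<rho>'_def
    using DERIV_mult[OF DERIV_chain2[OF \<phi>d w_x_deriv[OF t]] rho_has_derivative[OF pos(1)[OF that], of s]]
    by (simp add: algebra_simps)
  have f'c: "continuous_on {a..b} f'" unfolding f'_def by (intro ci)
  have f0: "0 \<le> f y" if "y \<in> {a..b}" for y unfolding f_def using \<phi>0 pos(2)[OF that] by simp
  have fb: "f y \<le> 2 * C * rho s y" if "y \<in> {a..b}" for y
    unfolding f_def using \<phi>1[of "w t y"] w_bound[OF t, of y] pos(2)[OF that] by (intro mult_right_mono) auto
  \<comment> \<open>The transport term - p \<psi> wx rho equals - p f' + p \<phi> \<rho>'. Its first
    part is integrated by parts with the Lipschitz function p; the boundary terms disappear later,
    when a tends to 0 and b to infinity.\<close>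
  have bp: "- integral {a..b} (\<lambda>y. p t y * f' y) \<le> p t a * f a - p t b * f b + Lip * integral {a..b} f"
  proof (rule integral_Lipschitz_by_parts[OF ab(2) Lip_nonneg[OF s0] fd f'c f0])
    show "\<bar>p t x - p t y\<bar> \<le> Lip * \<bar>x - y\<bar>" for x y
      unfolding p_def using velocity_Lipschitz[OF s0 t, of "c t + x" "c t + y"] by simp
  qed
  have bd: "\<bar>p t y * f y\<bar> \<le> Lip * (2 * C) * (y * rho s y)" if "y \<in> {a..b}" for y
  proof -
    have "\<bar>p t y\<bar> * \<bar>f y\<bar> \<le> (Lip * y) * (2 * C * rho s y)"
      using p_bound[OF t, of y] fb[OF that] f0[OF that] pos(1)[OF that] Lip_nonneg[OF s0] by (intro mult_mono) auto
    then show ?thesis by (simp add: abs_mult mult_ac)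
  qed
  have ia: "(\<lambda>y. \<bar>w t y\<bar> * rho s y) integrable_on {a..b}" by (intro integrable_continuous_interval ci)
  have i1: "integral {a..b} f \<le> N t"
  proof -
    have "integral {a..b} f \<le> integral {a..b} (\<lambda>y. \<bar>w t y\<bar> * rho s y)"
    proof (rule integral_le[OF _ ia])
      show "f integrable_on {a..b}" unfolding f_def by (intro integrable_continuous_interval ci)
      show "f y \<le> \<bar>w t y\<bar> * rho s y" if "y \<in> {a..b}" for y
        unfolding f_def using \<phi>1 pos(2)[OF that] by (intro mult_right_mono) auto
    qed
    then show ?thesis using weighted_w_le_N[OF t ab(1), of b] by simp
  qed
  have i2: "integral {a..b} (\<lambda>y. p t y * (\<phi> (w t y) * \<rho>' y)) \<le> 2 * Lip * N t"
  proof -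
    have "integral {a..b} (\<lambda>y. p t y * (\<phi> (w t y) * \<rho>' y)) \<le> integral {a..b} (\<lambda>y. 2 * Lip * (\<bar>w t y\<bar> * rho s y))"
    proof (rule integral_le)
      show "(\<lambda>y. p t y * (\<phi> (w t y) * \<rho>' y)) integrable_on {a..b}" by (intro integrable_continuous_interval ci)
      show "(\<lambda>y. 2 * Lip * (\<bar>w t y\<bar> * rho s y)) integrable_on {a..b}" by (intro integrable_continuous_interval ci)
      fix y assume y: "y \<in> {a..b}"
      have r'0: "\<bar>\<rho>' y\<bar> = (1 + s) * y powr (- 2 - s) / (1 + y) + ker s y / (1 + y)\<^sup>2"
      proof -
        have "0 \<le> (1 + s) * y powr (- 2 - s) / (1 + y)" "0 \<le> ker s y / (1 + y)\<^sup>2"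
          using pos(1)[OF y] s by auto
        then have "0 \<le> (1 + s) * y powr (- 2 - s) / (1 + y) + ker s y / (1 + y)\<^sup>2" by (rule add_nonneg_nonneg)
        then show ?thesis unfolding \<rho>'_def by (simp only: abs_minus_cancel abs_of_nonneg)
      qed
      have "p t y * (\<phi> (w t y) * \<rho>' y) \<le> \<bar>p t y\<bar> * (\<bar>\<phi> (w t y)\<bar> * \<bar>\<rho>' y\<bar>)"
        by (simp flip: abs_mult)
      also have "\<dots> \<le> (Lip * y) * (\<bar>w t y\<bar> * \<bar>\<rho>' y\<bar>)"
        using p_bound[OF t, of y] \<phi>0[of "w t y"] \<phi>1[of "w t y"] pos(1)[OF y] Lip_nonneg[OF s0]
        by (intro mult_mono) auto
      also have "\<dots> = Lip * \<bar>w t y\<bar> * (y * \<bar>\<rho>' y\<bar>)" by simp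
      also have "\<dots> \<le> Lip * \<bar>w t y\<bar> * (2 * rho s y)"
        unfolding r'0 using Lip_nonneg[OF s0] by (intro mult_left_mono rho_derivative_bound s s0 pos(1)[OF y]) auto
      finally show "p t y * (\<phi> (w t y) * \<rho>' y) \<le> 2 * Lip * (\<bar>w t y\<bar> * rho s y)" by (simp add: mult_ac)
    qed
    also have "\<dots> = 2 * Lip * integral {a..b} (\<lambda>y. \<bar>w t y\<bar> * rho s y)" by simp
    also have "\<dots> \<le> 2 * Lip * N t"
      using weighted_w_le_N[OF t ab(1), of b] Lip_nonneg[OF s0] by (intro mult_left_mono) auto
    finally show ?thesis .
  qed
  have i3: "integral {a..b} (\<lambda>y. \<psi> (w t y) * g y * rho s y) \<le> SC * N t"
  proof -
    have "integral {a..b} (\<lambda>y. \<psi> (w t y) * g y * rho s y) \<le> integral {a..b} (\<lambda>y. \<bar>g y\<bar> * rho s y)"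
    proof (rule integral_le)
      show "(\<lambda>y. \<psi> (w t y) * g y * rho s y) integrable_on {a..b}" "(\<lambda>y. \<bar>g y\<bar> * rho s y) integrable_on {a..b}"
        by (intro integrable_continuous_interval ci)+
      fix y assume y: "y \<in> {a..b}"
      have "\<psi> (w t y) * g y \<le> \<bar>\<psi> (w t y)\<bar> * \<bar>g y\<bar>" by (simp flip: abs_mult)
      also have "\<dots> \<le> 1 * \<bar>g y\<bar>" using \<psi>1 by (intro mult_right_mono) auto
      finally show "\<psi> (w t y) * g y * rho s y \<le> \<bar>g y\<bar> * rho s y" using pos(2)[OF y] by (intro mult_right_mono) auto
    qed
    then show ?thesis using source_le_N[OF t ab(1), of b] unfolding g_def by simp
  qed
  have "integral {a..b} (\<lambda>y. \<psi> (w t y) * wt t y * rho s y)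
    = integral {a..b} (\<lambda>y. - (p t y * f' y) + p t y * (\<phi> (w t y) * \<rho>' y) + \<psi> (w t y) * g y * rho s y)"
    unfolding f'_def wt_def g_def by (simp add: algebra_simps)
  also have "\<dots> = - integral {a..b} (\<lambda>y. p t y * f' y) + integral {a..b} (\<lambda>y. p t y * (\<phi> (w t y) * \<rho>' y))
      + integral {a..b} (\<lambda>y. \<psi> (w t y) * g y * rho s y)"
  proof -
    have j1: "(\<lambda>y. p t y * f' y) integrable_on {a..b}" and j2: "(\<lambda>y. p t y * (\<phi> (w t y) * \<rho>' y)) integrable_on {a..b}"
      and j3: "(\<lambda>y. \<psi> (w t y) * g y * rho s y) integrable_on {a..b}"
      by (intro integrable_continuous_interval ci f'c)+
    show ?thesis
      using integral_add[OF integrable_add[OF integrable_neg[OF j1] j2] j3] integral_add[OF integrable_neg[OF j1] j2] by simp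
  qed
  finally show ?thesis
    using bp bd[of a] bd[of b] i1 i2 i3 ab mult_left_mono[OF i1 Lip_nonneg[OF s0]]
    unfolding \<psi>_def K3_def distrib_right distrib_left by (simp add: abs_le_iff)
qed

lemma weighted_w_growth:
  assumes S: "\<And>r. r \<in> {0..T} \<Longrightarrow> N r \<le> S * exp (K * r)" "0 \<le> S" and K: "0 < K"
    and t: "t \<in> {0..T}" and ab: "0 < a" "a \<le> b"
  shows "integral {a..b} (\<lambda>y. \<bar>w t y\<bar> * rho s y)
    \<le> Lip * (2 * C) * (a * rho s a + b * rho s b) * T + K3 * (S * exp (K * t) / K)"
proof -
  define bd where "bd = Lip * (2 * C) * (a * rho s a + b * rho s b)"
  have bd0: "0 \<le> bd" unfolding bd_def using Lip_nonneg[OF s0] C_nonneg rho_nonneg[of a s] rho_nonneg[of b s] ab by simp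
  have rc: "continuous_on {a..b} (rho s)" by (rule continuous_rho[OF ab(1)])
  define I where "I = integral {a..b} (rho s)"
  have I0: "0 \<le> I" unfolding I_def by (rule integral_nonneg) (use ab rc rho_nonneg[of _ s] in \<open>auto intro: integrable_continuous_interval\<close>)
  \<comment> \<open>|w| exceeds its smooth substitute by at most e. The error e I is removed
    afterwards by letting e tend to 0 with a and b fixed.\<close>
  have main: "integral {a..b} (\<lambda>y. \<bar>w t y\<bar> * rho s y) \<le> bd * T + K3 * (S * exp (K * t) / K) + e * I" if e: "0 < e" for e
  proof -
    define \<Phi> where "\<Phi> = (\<lambda>\<tau>. integral {a..b} (\<lambda>y. (sqrt ((w \<tau> y)\<^sup>2 + e\<^sup>2) - e) * rho s y))"
    define \<Phi>' where "\<Phi>' = (\<lambda>\<tau>. integral {a..b} (\<lambda>y. w \<tau> y / sqrt ((w \<tau> y)\<^sup>2 + e\<^sup>2) * wt \<tau> y * rho s y))"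
    have q: "0 < z\<^sup>2 + e\<^sup>2" for z :: real using e by (simp add: add_nonneg_pos)
    have qn: "sqrt (z\<^sup>2 + e\<^sup>2) \<noteq> 0" for z using q[of z] e by simp
    have der: "(\<Phi> has_vector_derivative \<Phi>' \<tau>) (at \<tau> within {0..T})" if \<tau>: "\<tau> \<in> {0..T}" for \<tau>
    proof -
      have "((\<lambda>\<tau>. integral (cbox a b) (\<lambda>y. (sqrt ((w \<tau> y)\<^sup>2 + e\<^sup>2) - e) * rho s y)) has_vector_derivative
          integral (cbox a b) (\<lambda>y. w \<tau> y / sqrt ((w \<tau> y)\<^sup>2 + e\<^sup>2) * wt \<tau> y * rho s y)) (at \<tau> within {0..T})"
      proof (rule leibniz_rule_vector_derivative[where fx = "\<lambda>\<tau> y. w \<tau> y / sqrt ((w \<tau> y)\<^sup>2 + e\<^sup>2) * wt \<tau> y * rho s y"])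
        fix r y assume r: "r \<in> {0..T}"
        have "((\<lambda>z. sqrt (z\<^sup>2 + e\<^sup>2) - e) has_real_derivative w r y / sqrt ((w r y)\<^sup>2 + e\<^sup>2)) (at (w r y))"
          using q[of "w r y"] by (auto intro!: derivative_eq_intros simp: field_simps)
        from DERIV_cmult_right[OF DERIV_chain2[OF this w_t_deriv[OF r]], of "rho s y"]
        show "((\<lambda>\<tau>. (sqrt ((w \<tau> y)\<^sup>2 + e\<^sup>2) - e) * rho s y) has_vector_derivative w r y / sqrt ((w r y)\<^sup>2 + e\<^sup>2) * wt r y * rho s y) (at r within {0..T})"
          unfolding has_real_derivative_iff_has_vector_derivative .
      next
        fix r assume r: "r \<in> {0..T}"
        show "(\<lambda>y. (sqrt ((w r y)\<^sup>2 + e\<^sup>2) - e) * rho s y) integrable_on cbox a b"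
          unfolding cbox_interval
          by (intro integrable_continuous_interval continuous_intros continuous_w_x r rc)
      next
        have rr: "continuous_on ({0..T} \<times> cbox a b) (\<lambda>q. rho s (snd q))"
          by (rule continuous_on_compose2[OF rc]) (auto intro!: continuous_intros)
        show "continuous_on ({0..T} \<times> cbox a b) (\<lambda>(\<tau>, y). w \<tau> y / sqrt ((w \<tau> y)\<^sup>2 + e\<^sup>2) * wt \<tau> y * rho s y)"
          unfolding case_prod_unfold
          by (intro continuous_intros continuous_w rr) (use qn in auto)
      qed (use \<tau> in auto)
      then show ?thesis by (simp add: \<Phi>_def \<Phi>'_def)
    qed
    have ft: "(\<Phi>' has_integral \<Phi> t - \<Phi> 0) {0..t}"
    proof (rule fundamental_theorem_of_calculus)
      show "(\<Phi> has_vector_derivative \<Phi>' x) (at x within {0..t})" if "x \<in> {0..t}" for x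
        by (rule has_vector_derivative_within_subset[OF der]) (use that t in auto)
    qed (use t in auto)
    have G: "((\<lambda>\<tau>. bd + K3 * (S * exp (K * \<tau>))) has_integral (bd * t + K3 * (S * exp (K * t) / K)) - (bd * 0 + K3 * (S * exp (K * 0) / K))) {0..t}"
      by (rule fundamental_theorem_of_calculus)
        (use t K in \<open>auto intro!: derivative_eq_intros simp: has_real_derivative_iff_has_vector_derivative[symmetric]\<close>)
    have "\<Phi> t - \<Phi> 0 \<le> (bd * t + K3 * (S * exp (K * t) / K)) - (bd * 0 + K3 * (S * exp (K * 0) / K))"
    proof (rule has_integral_le[OF ft G])
      fix \<tau> assume "\<tau> \<in> {0..t}"
      then have \<tau>: "\<tau> \<in> {0..T}" using t by auto
      have "\<Phi>' \<tau> \<le> bd + K3 * N \<tau>" unfolding \<Phi>'_def bd_def by (rule regularized_rate[OF \<tau> e ab])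
      also have "\<dots> \<le> bd + K3 * (S * exp (K * \<tau>))" using S(1)[OF \<tau>] K3_nonneg by (simp add: mult_left_mono)
      finally show "\<Phi>' \<tau> \<le> bd + K3 * (S * exp (K * \<tau>))" .
    qed
    moreover have "\<Phi> 0 = 0" unfolding \<Phi>_def w_0 using e by simp
    moreover have "0 \<le> K3 * (S * exp (K * 0) / K)" using K3_nonneg S(2) K by simp
    moreover have "bd * t \<le> bd * T" using bd0 t by (intro mult_left_mono) auto
    ultimately have 1: "\<Phi> t \<le> bd * T + K3 * (S * exp (K * t) / K)" by linarith
    have "integral {a..b} (\<lambda>y. \<bar>w t y\<bar> * rho s y) \<le> integral {a..b} (\<lambda>y. (sqrt ((w t y)\<^sup>2 + e\<^sup>2) - e) * rho s y + e * rho s y)"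
    proof (rule integral_le)
      show "(\<lambda>y. \<bar>w t y\<bar> * rho s y) integrable_on {a..b}"
        "(\<lambda>y. (sqrt ((w t y)\<^sup>2 + e\<^sup>2) - e) * rho s y + e * rho s y) integrable_on {a..b}"
        by (intro integrable_continuous_interval continuous_intros continuous_w_x t rc)+
      fix y assume y: "y \<in> {a..b}"
      have "\<bar>w t y\<bar> \<le> sqrt ((w t y)\<^sup>2 + e\<^sup>2)" using real_sqrt_le_mono[of "(w t y)\<^sup>2" "(w t y)\<^sup>2 + e\<^sup>2"] by simp
      then have "\<bar>w t y\<bar> * rho s y \<le> sqrt ((w t y)\<^sup>2 + e\<^sup>2) * rho s y"
        using y ab by (intro mult_right_mono rho_nonneg) auto
      then show "\<bar>w t y\<bar> * rho s y \<le> (sqrt ((w t y)\<^sup>2 + e\<^sup>2) - e) * rho s y + e * rho s y" by (simp add: left_diff_distrib)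
    qed
    also have "\<dots> = \<Phi> t + e * I"
      unfolding \<Phi>_def I_def
      by (subst integral_add) (auto intro!: integrable_continuous_interval continuous_intros continuous_w_x t rc)
    finally show ?thesis using 1 by linarith
  qed
  have "integral {a..b} (\<lambda>y. \<bar>w t y\<bar> * rho s y) \<le> bd * T + K3 * (S * exp (K * t) / K)"
  proof (rule field_le_epsilon)
    fix \<epsilon> :: real assume "0 < \<epsilon>"
    then have "0 < \<epsilon> / (I + 1)" "\<epsilon> / (I + 1) * I \<le> \<epsilon>" using I0 by (auto simp: field_simps)
    then show "integral {a..b} (\<lambda>y. \<bar>w t y\<bar> * rho s y) \<le> bd * T + K3 * (S * exp (K * t) / K) + \<epsilon>"
      using main[of "\<epsilon> / (I + 1)"] by linarith
  qed
  then show ?thesis unfolding bd_def .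
qed

end

context centered
begin

text \<open>x rho(x) is at most x^(-s), which vanishes at 0 since s < 0, and at most ker s x, which
  vanishes at infinity since s > -1.\<close>

lemma boundary_tendsto_0:
  "(\<lambda>n. 1 / real (Suc n) * rho s (1 / real (Suc n)) + real (Suc n) * rho s (real (Suc n))) \<longlonglongrightarrow> 0"
proof -
  have 1: "(\<lambda>n. (1 / real (Suc n)) powr (- s)) \<longlonglongrightarrow> 0"
  proof -
    have "filterlim (\<lambda>n. real (Suc n)) at_top sequentially"
      using filterlim_Suc filterlim_real_sequentially by (rule filterlim_compose[rotated])
    then have "(\<lambda>n. real (Suc n) powr s) \<longlonglongrightarrow> 0" using s0 by (intro tendsto_neg_powr) auto
    then show ?thesis by (simp add: powr_divide powr_minus)
  qed
  have 2: "(\<lambda>n. ker s (real (Suc n))) \<longlonglongrightarrow> 0"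
  proof -
    have "filterlim (\<lambda>n. real (Suc n)) at_top sequentially"
      using filterlim_Suc filterlim_real_sequentially by (rule filterlim_compose[rotated])
    then show ?thesis unfolding ker_def using s by (intro tendsto_neg_powr) auto
  qed
  have b1: "x * rho s x \<le> x powr (- s)" "0 \<le> x * rho s x" if "0 < x" for x
  proof -
    have "x * rho s x = x powr (- s) * (1 / (1 + x))"
      unfolding rho_def ker_def using that powr_mult_base[of x "- 1 - s"] by simp
    also have "\<dots> \<le> x powr (- s) * 1" using that by (intro mult_left_mono) auto
    finally show "x * rho s x \<le> x powr (- s)" by simp
    show "0 \<le> x * rho s x" using rho_nonneg[of x s] that by simp
  qed
  have b2: "x * rho s x \<le> ker s x" if "0 < x" for x
  proof -
    have "x * rho s x = ker s x * (x / (1 + x))" unfolding rho_def by simp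
    also have "\<dots> \<le> ker s x * 1" using that by (intro mult_left_mono) auto
    finally show ?thesis by simp
  qed
  have "(\<lambda>n. (1 / real (Suc n)) powr (- s) + ker s (real (Suc n))) \<longlonglongrightarrow> 0 + 0" by (intro tendsto_add 1 2)
  then have lim: "(\<lambda>n. (1 / real (Suc n)) powr (- s) + ker s (real (Suc n))) \<longlonglongrightarrow> 0" by simp
  show ?thesis
  proof (rule Lim_null_comparison[OF always_eventually lim], rule allI)
    fix n
    have "0 < 1 / real (Suc n)" "0 < real (Suc n)" by simp_all
    from b1[OF this(1)] b1(2)[OF this(2)] b2[OF this(2)]
    show "norm (1 / real (Suc n) * rho s (1 / real (Suc n)) + real (Suc n) * rho s (real (Suc n)))
      \<le> (1 / real (Suc n)) powr (- s) + ker s (real (Suc n))"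
      unfolding real_norm_def by linarith
  qed
qed

text \<open>For fixed n the bound on the larger interval of index m is used and m is sent to
  infinity, which removes the boundary terms. Then n is sent to infinity by monotone
  convergence.\<close>

lemma N_growth:
  assumes S: "\<And>r. r \<in> {0..T} \<Longrightarrow> N r \<le> S * exp (K * r)" "0 \<le> S" and K: "0 < K" and t: "t \<in> {0..T}"
  shows "N t \<le> K3 * (S * exp (K * t) / K)"
proof -
  define X where "X = K3 * (S * exp (K * t) / K)"
  have X: "0 \<le> X" unfolding X_def using K3_nonneg S K by simp
  define a b where "a = (\<lambda>n. 1 / real (Suc n))" and "b = (\<lambda>n. real (Suc n))"
  have ab: "0 < a n" "a n \<le> b n" for n
  proof -
    show "0 < a n" by (simp add: a_def)
    have "a n \<le> 1" "1 \<le> b n" by (simp_all add: a_def b_def)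
    then show "a n \<le> b n" by linarith
  qed
  have mono: "a m \<le> a n" "b n \<le> b m" if "n \<le> m" for n m
    unfolding a_def b_def using that by (auto simp: frac_le)
  have rc: "continuous_on {a n..b n} (rho s)" for n by (rule continuous_rho[OF ab(1)])
  have int: "(\<lambda>y. \<bar>w t y\<bar> * rho s y) integrable_on {a n..b n}" for n
    by (intro integrable_continuous_interval continuous_intros continuous_w_x t rc)
  have pos: "0 \<le> \<bar>w t y\<bar> * rho s y" if "y \<in> {a n..b n}" for y n
    using that ab(1)[of n] rho_nonneg[of y s] by auto
  have le: "integral {a n..b n} (\<lambda>y. \<bar>w t y\<bar> * rho s y) \<le> X" for n
  proof (rule LIMSEQ_le_const)
    have "(\<lambda>m. Lip * (2 * C) * (a m * rho s (a m) + b m * rho s (b m)) * T + X) \<longlonglongrightarrow> Lip * (2 * C) * 0 * T + X"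
      unfolding a_def b_def by (intro tendsto_intros boundary_tendsto_0)
    then show "(\<lambda>m. Lip * (2 * C) * (a m * rho s (a m) + b m * rho s (b m)) * T + X) \<longlonglongrightarrow> X" by simp
    show "\<exists>k. \<forall>m\<ge>k. integral {a n..b n} (\<lambda>y. \<bar>w t y\<bar> * rho s y)
      \<le> Lip * (2 * C) * (a m * rho s (a m) + b m * rho s (b m)) * T + X"
    proof (intro exI allI impI)
      fix m assume "n \<le> m"
      then have "integral {a n..b n} (\<lambda>y. \<bar>w t y\<bar> * rho s y) \<le> integral {a m..b m} (\<lambda>y. \<bar>w t y\<bar> * rho s y)"
        using mono[OF \<open>n \<le> m\<close>] by (intro integral_subset_le[OF _ int int]) (auto intro: pos)
      also have "\<dots> \<le> Lip * (2 * C) * (a m * rho s (a m) + b m * rho s (b m)) * T + X"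
        unfolding X_def by (rule weighted_w_growth[OF S K t ab])
      finally show "integral {a n..b n} (\<lambda>y. \<bar>w t y\<bar> * rho s y)
        \<le> Lip * (2 * C) * (a m * rho s (a m) + b m * rho s (b m)) * T + X" .
    qed
  qed
  have "Nn t = (\<integral>\<^sup>+ y. (SUP n. ennreal (\<bar>w t y\<bar> * rho s y) * indicator {a n..b n} y) \<partial>lborel)"
    unfolding Nn_def
  proof (rule nn_integral_cong)
    fix y :: real
    show "ennreal (\<bar>w t y\<bar> * rho s y) * indicator {0<..} y = (SUP n. ennreal (\<bar>w t y\<bar> * rho s y) * indicator {a n..b n} y)"
    proof (cases "0 < y")
      case True
      obtain n1 where n1: "1 / y \<le> real n1" using real_arch_simple by blast
      obtain n2 where n2: "y \<le> real n2" using real_arch_simple by blast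
      define n where "n = max n1 n2"
      have "y \<le> b n" unfolding b_def n_def using n2 by auto
      moreover have "a n \<le> y"
      proof -
        have "1 / y \<le> real (Suc n)" using n1 unfolding n_def by auto
        then show ?thesis unfolding a_def using True by (simp add: field_simps)
      qed
      ultimately have yn: "y \<in> {a n..b n}" by simp
      show ?thesis
      proof (rule antisym)
        show "ennreal (\<bar>w t y\<bar> * rho s y) * indicator {0<..} y \<le> (SUP n. ennreal (\<bar>w t y\<bar> * rho s y) * indicator {a n..b n} y)"
          using yn by (intro SUP_upper2[of n]) (auto simp: indicator_def)
        show "(SUP n. ennreal (\<bar>w t y\<bar> * rho s y) * indicator {a n..b n} y) \<le> ennreal (\<bar>w t y\<bar> * rho s y) * indicator {0<..} y"
          using True by (intro SUP_least) (auto simp: indicator_def)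
      qed
    next
      case False
      then have "y \<notin> {a n..b n}" for n using ab(1)[of n] by auto
      then show ?thesis using False by simp
    qed
  qed
  also have "\<dots> = (SUP n. \<integral>\<^sup>+ y. ennreal (\<bar>w t y\<bar> * rho s y) * indicator {a n..b n} y \<partial>lborel)"
  proof (rule nn_integral_monotone_convergence_SUP)
    show "incseq (\<lambda>n y. ennreal (\<bar>w t y\<bar> * rho s y) * indicator {a n..b n} y)"
      unfolding incseq_def le_fun_def using mono by (force simp: indicator_def)
    show "(\<lambda>y. ennreal (\<bar>w t y\<bar> * rho s y) * indicator {a n..b n} y) \<in> borel_measurable lborel" for n
      using w_measurable[OF t] by measurable
  qed
  also have "\<dots> \<le> ennreal X"
  proof (rule SUP_least)
    fix n
    have "(\<integral>\<^sup>+ y. ennreal (\<bar>w t y\<bar> * rho s y) * indicator {a n..b n} y \<partial>lborel) = ennreal (integral {a n..b n} (\<lambda>y. \<bar>w t y\<bar> * rho s y))"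
      by (rule nn_integral_has_integral_lebesgue'[OF pos integrable_integral[OF int]])
    then show "(\<integral>\<^sup>+ y. ennreal (\<bar>w t y\<bar> * rho s y) * indicator {a n..b n} y \<partial>lborel) \<le> ennreal X"
      using le by (simp add: ennreal_leI)
  qed
  finally have "ennreal (N t) \<le> ennreal X" unfolding N_bounds(1)[OF t] .
  then show ?thesis using X unfolding X_def by (subst (asm) ennreal_le_iff) auto
qed

lemma N_zero: assumes t: "t \<in> {0..T}" shows "N t = 0"
proof -
  \<comment> \<open>With K3 / K \<le> 1/2 the weighted supremum satisfies S \<le> S / 2, and it is
    finite by \<open>N_bounds\<close>; hence it vanishes.\<close>
  define K where "K = 2 * K3 + 1"
  have K: "0 < K" "K3 / K \<le> 1 / 2" using K3_nonneg by (auto simp: K_def field_simps)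
  define S where "S = (SUP r\<in>{0..T}. N r * exp (- K * r))"
  have bdd: "bdd_above ((\<lambda>r. N r * exp (- K * r)) ` {0..T})"
  proof (rule bdd_aboveI2)
    fix r assume r: "r \<in> {0..T}"
    have "exp (- K * r) \<le> 1" using K r by (auto simp: mult_nonneg_nonneg)
    then have "N r * exp (- K * r) \<le> N r * 1" using N_bounds(2)[OF r] by (intro mult_left_mono) auto
    then show "N r * exp (- K * r) \<le> 2 * C * (1 / (- s) + 1 / (1 + s))" using N_bounds(3)[OF r] by linarith
  qed
  have NS: "N r \<le> S * exp (K * r)" if r: "r \<in> {0..T}" for r
  proof -
    have "N r * exp (- K * r) \<le> S" unfolding S_def by (rule cSUP_upper[OF r bdd])
    then have "N r * exp (- K * r) * exp (K * r) \<le> S * exp (K * r)" by (rule mult_right_mono) auto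
    then show ?thesis by (simp add: mult.assoc flip: exp_add)
  qed
  have S0: "0 \<le> S" using NS[of 0] N_bounds(2)[of 0] T by auto
  have "(SUP r\<in>{0..T}. N r * exp (- K * r)) \<le> S / 2"
  proof (rule cSUP_least)
    fix r assume r: "r \<in> {0..T}"
    have "N r * exp (- K * r) \<le> K3 * (S * exp (K * r) / K) * exp (- K * r)"
      by (intro mult_right_mono N_growth[OF NS S0 K(1) r]) auto
    also have "\<dots> = (K3 / K) * S" by (simp add: mult.assoc flip: exp_add)
    also have "\<dots> \<le> (1 / 2) * S" using K S0 by (intro mult_right_mono) auto
    finally show "N r * exp (- K * r) \<le> S / 2" by simp
  qed (use T in auto)
  then have "S \<le> S / 2" unfolding S_def[symmetric] .
  then have "S = 0" using S0 by simp
  then show ?thesis using NS[OF t] N_bounds(2)[OF t] by simp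
qed

lemma w_zero: assumes t: "t \<in> {0..T}" and y: "0 < y" shows "w t y = 0"
proof -
  have c1: "continuous_on {y..y + 1} (\<lambda>z. \<bar>w t z\<bar> * rho s z)"
    by (intro continuous_intros continuous_w_x t continuous_rho y)
  have p1: "0 \<le> \<bar>w t z\<bar> * rho s z" if "z \<in> {y..y + 1}" for z using that y rho_nonneg[of z s] by auto
  have "0 \<le> integral {y..y + 1} (\<lambda>z. \<bar>w t z\<bar> * rho s z)"
    by (intro integral_nonneg integrable_continuous_interval c1 p1)
  moreover have "integral {y..y + 1} (\<lambda>z. \<bar>w t z\<bar> * rho s z) \<le> 0"
    using weighted_w_le_N[OF t y, of "y + 1"] N_zero[OF t] by simp
  ultimately have "integral {y..y + 1} (\<lambda>z. \<bar>w t z\<bar> * rho s z) = 0" by simp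
  then have "\<bar>w t y\<bar> * rho s y = 0" using integral_eq_0_iff[OF c1 _ p1] by simp
  moreover have "0 < rho s y" unfolding rho_def using y ker_pos[of y s] by simp
  ultimately show ?thesis by simp
qed

lemma center_velocity_zero: assumes t: "t \<in> {0..T}" shows "u t (c t) = 0"
proof -
  have "eventually (\<lambda>R. kappa s * integral {1/R..R} (\<lambda>y. odd_diff (\<theta> t) (c t) y * ker s y) = 0) at_top"
    using eventually_gt_at_top[of 0]
  proof eventually_elim
    case (elim R)
    have "integral {1/R..R} (\<lambda>y. odd_diff (\<theta> t) (c t) y * ker s y) = integral {1/R..R} (\<lambda>y. 0)"
    proof (rule Henstock_Kurzweil_Integration.integral_cong)
      fix y assume y: "y \<in> {1/R..R}"
      have "0 < 1 / R" using elim by simp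
      moreover have "1 / R \<le> y" using y by simp
      ultimately have "0 < y" by (rule less_le_trans)
      then show "odd_diff (\<theta> t) (c t) y * ker s y = 0" using w_zero[OF t, of y] by (simp add: odd_diff_def w_def)
    qed
    then show ?case by simp
  qed
  then have "((\<lambda>R. kappa s * integral {1/R..R} (\<lambda>y. odd_diff (\<theta> t) (c t) y * ker s y)) \<longlongrightarrow> 0) at_top"
    by (rule tendsto_eventually)
  with has_Lambda_H_limit[OF vel[OF t] continuous_x[OF t], of "c t"] show ?thesis
    by (intro tendsto_unique[of at_top]) auto
qed

lemma center_zero: assumes t: "t \<in> {0..T}" shows "c t = 0"
proof -
  have "(c has_real_derivative 0) (at r within {0..T})" if "r \<in> {0..T}" for r
    using c[OF that] center_velocity_zero[OF that] by simp
  moreover have "(*) (0::real) = (\<lambda>h. 0)" by auto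
  ultimately have "\<exists>k. \<forall>r\<in>{0..T}. c r = k"
    by (intro has_derivative_zero_constant) (simp_all add: has_field_derivative_def)
  then show ?thesis using c0 t T by auto
qed

end

lemma (in bump_bounded) velocity_origin_zero:
  assumes "s < 0" and t: "t \<in> {0..T}"
  shows "u t 0 = 0"
proof -
  obtain c where c: "c 0 = 0" "\<And>t. t \<in> {0..T} \<Longrightarrow> (c has_real_derivative u t (c t)) (at t within {0..T})"
    using trajectory[OF assms(1)] by blast
  interpret centered s T C \<theta> \<theta>t \<theta>x u M A c by unfold_locales (use assms c in auto)
  show ?thesis using center_velocity_zero[OF t] center_zero[OF t] by simp
qed

section \<open>Bound on the time of existence\<close>

text \<open>For s < 0 the a priori bound is 0, by evenness. For s \<ge> 0 the exponent \<beta> is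
  1/2, the growth that the Gronwall estimate at the origin expects.\<close>

lemma (in bump) velocity_bounded:
  obtains A where "bump_bounded s T C \<theta> \<theta>t \<theta>x u M A"
proof (cases "s < 0")
  case True
  show ?thesis
  proof (rule velocity_bounded_by_continuation[OF _ that, of 0])
    fix \<tau> A t
    assume "bump_bounded s \<tau> C \<theta> \<theta>t \<theta>x u M A" "t \<in> {0..\<tau>}"
    then show "\<bar>u t 0\<bar> \<le> 0" using bump_bounded.velocity_origin_zero True by fastforce
  qed
next
  case False
  obtain B where B: "0 \<le> B" "\<And>t x. t \<in> {0..T} \<Longrightarrow> \<bar>u t x - u t 0\<bar> \<le> B * (1 + \<bar>x\<bar>) powr \<beta>"
    using velocity_growth by blast
  have \<beta>: "\<beta> = 1 / 2" using False by (simp add: \<beta>_def)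
  show ?thesis
  proof (rule velocity_bounded_by_continuation[OF _ that])
    fix \<tau> A t
    assume h: "\<tau> \<le> T" "bump_bounded s \<tau> C \<theta> \<theta>t \<theta>x u M A" "t \<in> {0..\<tau>}"
    show "\<bar>u t 0\<bar> \<le> 2 * (kappa s * (2 * C / (1 - s) + 16 * C * B * T)) * exp ((16 * C * kappa s + 1) * T)"
      by (rule bump_bounded.apriori_velocity_bound[OF h(2) _ h(1) B(1) _ h(3)]) (use False h B(2) \<beta> in auto)
  qed
qed

text \<open>The restriction on T is free of \<open>C\<close>. This is essential: T has to be fixed
  before the C^1 bound on [0, T] is available.\<close>

lemma (in bump) duration_bound:
  defines "q \<equiv> (1 / 2) powr ((1 + s) / 2)"
  assumes b: "0 \<le> b" "\<And>x. b \<le> \<bar>x\<bar> \<Longrightarrow> \<theta> 0 x < M / 8"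
  shows "rate s * (M / 4) * (1 - q)\<^sup>2 * T < (2 * b + 1) powr (1 + s)"
proof (rule ccontr)
  assume "\<not> ?thesis"
  then have "(2 * b + 1) powr (1 + s) \<le> rate s * (M / 4) * (1 - q)\<^sup>2 * T" by simp
  moreover obtain A where "bump_bounded s T C \<theta> \<theta>t \<theta>x u M A" using velocity_bounded by blast
  ultimately show False using bump_bounded.blow_up[of s T C \<theta> \<theta>t \<theta>x u M A b] b unfolding q_def by blast
qed

section \<open>From a global solution to the setting on a compact time interval\<close>

lemma even_antimono_at_0:
  fixes f :: "real \<Rightarrow> real"
  assumes f: "isCont f 0" and even: "\<And>x. f (- x) = f x" and anti: "antimono_on {0<..} f" and x: "0 \<le> x" "x \<le> y"
  shows "f y \<le> f x"
proof (cases "0 < x")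
  case True
  then show ?thesis using monotone_onD[OF anti, of x y] x by auto
next
  case False
  then have x0: "x = 0" using x by simp
  show ?thesis
  proof (cases "y = 0")
    case False
    then have y: "0 < y" using x x0 by simp
    have "(f \<longlongrightarrow> f 0) (at_right 0)"
      using f by (simp add: continuous_at_imp_continuous_at_within continuous_within[symmetric])
    moreover have "eventually (\<lambda>z. f y \<le> f z) (at_right 0)"
      unfolding eventually_at_right_field using monotone_onD[OF anti, of _ y] y by (intro exI[of _ y]) auto
    ultimately show ?thesis unfolding x0 by (rule tendsto_lowerbound) simp
  qed (simp add: x0)
qed

text \<open>The C^1 bound is given on an open time interval; continuity in t extends it to the
  initial time.\<close>

lemma tendsto_at_0_abs_le:
  fixes f :: "real \<Rightarrow> real"
  assumes f: "continuous_on {0..} f" and b: "\<And>t. t \<in> {0<..<T} \<Longrightarrow> \<bar>f t\<bar> \<le> B" and T: "0 < T"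
  shows "\<bar>f 0\<bar> \<le> B"
proof (rule tendsto_upperbound)
  show "((\<lambda>t. \<bar>f t\<bar>) \<longlongrightarrow> \<bar>f 0\<bar>) (at_right 0)"
  proof (intro tendsto_intros)
    have "(f \<longlongrightarrow> f 0) (at 0 within {0..})" using f by (simp add: continuous_on_def)
    then show "(f \<longlongrightarrow> f 0) (at_right 0)" by (rule tendsto_within_subset) auto
  qed
  show "eventually (\<lambda>t. \<bar>f t\<bar> \<le> B) (at_right 0)"
    unfolding eventually_at_right_field using b T by (intro exI[of _ T]) auto
qed simp

theorem theorem4p4:
  fixes \<theta>0 :: "real \<Rightarrow> real" and s :: real
  assumes "smooth \<theta>0"
    and "\<not> \<theta>0 constant_on UNIV"
    and "(\<theta>0 \<longlongrightarrow> 0) at_infinity"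
    and "\<And>x. \<theta>0 (- x) = \<theta>0 x"
    and "\<And>x. 0 \<le> \<theta>0 x"
    and "antimono_on {0<..} \<theta>0"
    and "-1 < s" and "s < 1"
  shows "\<not> (\<exists>\<theta>. global_C1_solution s \<theta>0 \<theta>)"
proof
  assume "\<exists>\<theta>. global_C1_solution s \<theta>0 \<theta>"
  then obtain \<theta> where sol: "global_C1_solution s \<theta>0 \<theta>" by blast
  then obtain \<theta>t \<theta>x u
    where ct: "continuous_on ({0..} \<times> UNIV) (\<lambda>(t, x). \<theta>t t x)"
      and cx: "continuous_on ({0..} \<times> UNIV) (\<lambda>(t, x). \<theta>x t x)"
      and dt: "\<And>t x. 0 \<le> t \<Longrightarrow> ((\<lambda>\<tau>. \<theta> \<tau> x) has_real_derivative \<theta>t t x) (at t within {0..})"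
      and dx: "\<And>t x. 0 \<le> t \<Longrightarrow> (\<theta> t has_real_derivative \<theta>x t x) (at x)"
      and vel: "\<And>t x. 0 \<le> t \<Longrightarrow> has_Lambda_H s (\<theta> t) x (u t x)"
      and pde: "\<And>t x. 0 \<le> t \<Longrightarrow> \<theta>t t x + u t x * \<theta>x t x = 0"
      and init: "\<And>x. \<theta> 0 x = \<theta>0 x"
    unfolding global_C1_solution_def classical_solution_def by blast
  have \<theta>0: "\<theta> 0 = \<theta>0" using init by auto
  have anti: "\<theta> 0 y \<le> \<theta> 0 x" if "0 \<le> x" "x \<le> y" for x y
    using even_antimono_at_0[OF DERIV_isCont[OF dx[of 0 0]], of x y] assms(4,6) that by (simp add: \<theta>0)
  have "\<theta> 0 0 \<noteq> 0"
  proof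
    assume 0: "\<theta> 0 0 = 0"
    have "\<theta>0 x = 0" for x
      using anti[of 0 "\<bar>x\<bar>"] 0 assms(4)[of x] assms(5)[of x] by (cases "0 \<le> x") (auto simp: \<theta>0)
    then show False using assms(2) by (auto simp: constant_on_def)
  qed
  then have M: "0 < \<theta> 0 0" using assms(5)[of 0] by (simp add: \<theta>0)
  have "eventually (\<lambda>x. dist (\<theta>0 x) 0 < \<theta> 0 0 / 8) at_infinity" using M by (intro tendstoD[OF assms(3)]) simp
  then obtain b where b: "\<And>x. b \<le> \<bar>x\<bar> \<Longrightarrow> dist (\<theta>0 x) 0 < \<theta> 0 0 / 8" unfolding eventually_at_infinity by auto
  define D where "D = rate s * (\<theta> 0 0 / 4) * (1 - (1 / 2) powr ((1 + s) / 2))\<^sup>2"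
  have "(1 / 2 :: real) powr ((1 + s) / 2) < 1 powr ((1 + s) / 2)" using assms(7) by (intro powr_less_mono2) auto
  then have D: "0 < D" using M kappa_pos[OF assms(7,8)] assms(7) unfolding D_def rate_def by simp
  \<comment> \<open>Chosen so that D T equals (2 |b| + 1)^(1+s), which contradicts the strict bound
    on the duration.\<close>
  define T where "T = (2 * \<bar>b\<bar> + 1) powr (1 + s) / D"
  have T: "0 < T" unfolding T_def using D by (intro divide_pos_pos) auto
  \<comment> \<open>The longer interval makes the bound valid at the final time T as well.\<close>
  obtain C where C': "\<And>t x. t \<in> {0<..<T + 1} \<Longrightarrow> \<bar>\<theta> t x\<bar> \<le> C \<and> \<bar>deriv (\<theta> t) x\<bar> \<le> C"
    using sol T unfolding global_C1_solution_def by (meson add_pos_pos zero_less_one)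
  have C: "\<bar>\<theta> t x\<bar> \<le> C" "\<bar>\<theta>x t x\<bar> \<le> C" if "t \<in> {0<..<T + 1}" for t x
    using C'[OF that, of x] DERIV_imp_deriv[OF dx[of t x]] that by simp_all
  have "continuous_on {0..} (\<lambda>t. \<theta> t x)" for x
    by (rule DERIV_continuous_on[OF dt]) simp
  moreover have "continuous_on {0..} (\<lambda>t. \<theta>x t x)" for x
    using continuous_on_compose2[OF cx continuous_on_Pair[OF continuous_on_id continuous_on_const[where c = x]], where s = "{0..}"] by auto
  ultimately have C0: "\<bar>\<theta> 0 x\<bar> \<le> C" "\<bar>\<theta>x 0 x\<bar> \<le> C" for x
    using C T by (auto intro: tendsto_at_0_abs_le[of "\<lambda>t. \<theta> t x" "T + 1" C] tendsto_at_0_abs_le[of "\<lambda>t. \<theta>x t x" "T + 1" C])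
  have bound: "\<bar>\<theta> t x\<bar> \<le> C" "\<bar>\<theta>x t x\<bar> \<le> C" if "t \<in> {0..T}" for t x
    using that C[of t x] C0[of x] by (cases "t = 0"; simp)+
  interpret bump s T C \<theta> \<theta>t \<theta>x u "\<theta> 0 0"
  proof
    show "continuous_on ({0..T} \<times> UNIV) (\<lambda>(t, x). \<theta>t t x)" "continuous_on ({0..T} \<times> UNIV) (\<lambda>(t, x). \<theta>x t x)"
      by (auto intro: continuous_on_subset[OF ct] continuous_on_subset[OF cx])
    show "((\<lambda>\<tau>. \<theta> \<tau> x) has_real_derivative \<theta>t t x) (at t within {0..T})" if "t \<in> {0..T}" for t x
      using that by (intro DERIV_subset[OF dt]) auto
  qed (use assms(3,4,5,7,8) T dx vel pde bound anti M in \<open>auto simp: \<theta>0\<close>)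
  have "\<theta> 0 x < \<theta> 0 0 / 8" if "\<bar>b\<bar> \<le> \<bar>x\<bar>" for x
    using b[of x] that assms(5)[of x] by (simp add: \<theta>0 dist_real_def)
  from duration_bound[OF abs_ge_zero this] have "D * T < (2 * \<bar>b\<bar> + 1) powr (1 + s)" by (simp add: D_def)
  then show False using D by (simp add: T_def)
qed

end
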